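(* Let $\Pi=(P,\mathcal{L})$ be a polar space or a thin polar space of rank $n\ge 5$, and let $\Pi'=(P',\mathcal{L}')$ be a polar space of rank $n'$. Let $1\le k\le n-4$ and $0\le k'\le n'-1$, and let $f$ be an isometric embedding of the polar Grassmann graph $\Gamma_{k}(\Pi)$ in the polar Grassmann graph $\Gamma_{k'}(\Pi')$. Then $$k\le k',\qquad n-k\le n'-k',$$ and there is a $(k'-k-1)$-dimensional singular subspace $S$ of $\Pi'$ (the empty set if $k'=k$) such that $f(\mathcal{G}_k(\Pi))\subset [S\rangle_{k'}$ and $f$ is induced by a collinearity preserving injection of $\Pi$ to $\Pi'_{S}$.
   Context: A partial linear space is a pair $(P,\mathcal{L})$ where $P$ is a non-empty set (points) and $\mathcal{L}$ is a family of proper subsets of $P$ (lines), each line has at least two points, every point lies on some line, and two distinct points lie on at most one line; distinct points on a common line are collinear. A subspace is a set $S\subset P$ containing the line through any two collinear points of $S$; it is singular if any two distinct points of it are collinear. A polar space is a partial linear space such that (P1) every line has at least three points, (P2) no point is collinear to all points, (P3) each point is collinear to one or to all points of each line, (P4) every chain of mutually distinct incident singular subspaces is finite. All maximal singular subspaces of a polar space are projective spaces of the same dimension $n-1$ ($n\ge2$), and $n$ is the rank; singular subspaces have a projective dimension, the empty set having dimension $-1$. A thin polar space of rank $n$ is a partial linear space isomorphic to the one with point set $\{\pm1,\dots,\pm n\}$ whose lines are the 2-element sets $\{i,j\}$ with $j\ne -i$; its singular subspaces are the subsets containing no pair $\{i,-i\}$, and a singular subspace $S$ has dimension $|S|-1$.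 For a (thin) polar space $\Pi$ of rank $n$ and $0\le k\le n-1$, $\mathcal{G}_k(\Pi)$ is the set of $k$-dimensional singular subspaces. The polar Grassmann graph $\Gamma_k(\Pi)$ has vertex set $\mathcal{G}_k(\Pi)$; for $k\le n-2$ two distinct vertices are adjacent iff they are contained in a common $(k+1)$-dimensional singular subspace; for $k=n-1$ two distinct vertices are adjacent iff their intersection is $(n-2)$-dimensional (so $\Gamma_0(\Pi)$ has adjacency = collinearity). For a singular subspace $S$, $[S\rangle_k$ denotes the set of $k$-dimensional singular subspaces containing $S$; for incident singular subspaces $S\subset U$, $[S,U]_k$ is the set of $X\in\mathcal{G}_k$ with $S\subset X\subset U$. An isometric embedding of a connected graph $\Gamma$ in a connected graph $\Gamma'$ is an injection of vertex sets preserving the path distance. For an $m$-dimensional singular subspace $S$ of $\Pi'$ ($-1\le m$), $\Pi'_S$ is the partial linear space whose points are the elements of $[S\rangle_{m+1}$ and whose lines are the sets $[S,U]_{m+1}$ with $U$ an $(m+2)$-dimensional singular subspace containing $S$; it is a polar space of rank $n'-m-1$ when this is $\ge 2$, and $\Pi'_\emptyset=\Pi'$. A collinearity preserving injection $h$ of $\Pi$ to $\Pi'_S$ is an injection from $P$ to the point set of $\Pi'_S$ such that distinct points $p,q$ are collinear in $\Pi$ iff $h(p),h(q)$ are collinear in $\Pi'_S$. A map $f:\mathcal{G}_k(\Pi)\to\mathcal{G}_{k'}(\Pi')$ is induced by $h$ if for every $U\in\mathcal{G}_k(\Pi)$, $f(U)$ is the singular subspace of $\Pi'$ spanned by $\bigcup_{p\in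 U}h(p)$ (equivalently, the element of $[S\rangle_{k'}$ corresponding to the singular subspace of $\Pi'_S$ spanned by $h(U)$). *)

theory Defs
  imports Main "HOL-Library.Extended_Nat"
begin

section \<open>Partial linear spaces\<close>

record 'a pls =
  points :: "'a set"
  lines :: "'a set set"

locale partial_linear_space =
  fixes \<Pi> :: "'a pls"
  assumes points_nonempty: "points \<Pi> \<noteq> {}"
    and line_proper: "l \<in> lines \<Pi> \<Longrightarrow> l \<subset> points \<Pi>"
    and line_two_points: "l \<in> lines \<Pi> \<Longrightarrow> \<exists>p\<in>l. \<exists>q\<in>l. p \<noteq> q"
    and point_on_line: "p \<in> points \<Pi> \<Longrightarrow> \<exists>l\<in>lines \<Pi>. p \<in> l"
    and line_unique: "\<lbrakk>p \<noteq> q; l \<in> lines \<Pi>; l' \<in> lines \<Pi>; p \<in> l; q \<in> l; p \<in> l'; q \<in> l'\<rbrakk> \<Longrightarrow> l = l'"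

definition collinear :: "'a pls \<Rightarrow> 'a \<Rightarrow> 'a \<Rightarrow> bool" where
  "collinear \<Pi> p q \<longleftrightarrow> p \<noteq> q \<and> (\<exists>l\<in>lines \<Pi>. p \<in> l \<and> q \<in> l)"

definition subspace :: "'a pls \<Rightarrow> 'a set \<Rightarrow> bool" where
  "subspace \<Pi> S \<longleftrightarrow> S \<subseteq> points \<Pi> \<and>
     (\<forall>p\<in>S. \<forall>q\<in>S. \<forall>l\<in>lines \<Pi>. p \<noteq> q \<and> p \<in> l \<and> q \<in> l \<longrightarrow> l \<subseteq> S)"

definition singular_subspace :: "'a pls \<Rightarrow> 'a set \<Rightarrow> bool" where
  "singular_subspace \<Pi> S \<longleftrightarrow> subspace \<Pi> S \<and> (\<forall>p\<in>S. \<forall>q\<in>S. p \<noteq> q \<longrightarrow> collinear \<Pi> p q)"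

definition maximal_singular_subspace :: "'a pls \<Rightarrow> 'a set \<Rightarrow> bool" where
  "maximal_singular_subspace \<Pi> M \<longleftrightarrow> singular_subspace \<Pi> M \<and>
     (\<forall>S. singular_subspace \<Pi> S \<and> M \<subseteq> S \<longrightarrow> S = M)"

definition pspan :: "'a pls \<Rightarrow> 'a set \<Rightarrow> 'a set" where
  "pspan \<Pi> X = \<Inter>{S. subspace \<Pi> S \<and> X \<subseteq> S}"

text \<open>
  The projective dimension is the least size of a generating set minus one. It is only used for
  singular subspaces of polar and thin polar spaces, which are finitely generated. In particular
  the empty set has dimension -1, and in a thin polar space every singular subspace is its own
  only generating set, so that its dimension is its cardinality minus one.
\<close>

definition pdim :: "'a pls \<Rightarrow> 'a set \<Rightarrow> int" where
  "pdim \<Pi> S = int (LEAST m. \<exists>B. finite B \<and> card B = m \<and> B \<subseteq> S \<and> pspan \<Pi> B = S) - 1"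

definition isomorphic :: "'a pls \<Rightarrow> 'b pls \<Rightarrow> bool" where
  "isomorphic \<Pi> \<Pi>' \<longleftrightarrow>
     (\<exists>\<phi>. bij_betw \<phi> (points \<Pi>) (points \<Pi>') \<and> lines \<Pi>' = (\<lambda>l. \<phi> ` l) ` lines \<Pi>)"


section \<open>Polar spaces and thin polar spaces\<close>

text \<open>
  In the second and third axiom a point counts as collinear to itself: otherwise the second
  axiom would hold trivially, and the third would fail for the points of the line.
\<close>

locale polar_space = partial_linear_space +
  assumes P1: "l \<in> lines \<Pi> \<Longrightarrow> \<exists>p\<in>l. \<exists>q\<in>l. \<exists>r\<in>l. p \<noteq> q \<and> q \<noteq> r \<and> p \<noteq> r"
    and P2: "\<not> (\<exists>p\<in>points \<Pi>. \<forall>q\<in>points \<Pi>. p = q \<or> collinear \<Pi> p q)"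
    and P3: "\<lbrakk>p \<in> points \<Pi>; l \<in> lines \<Pi>\<rbrakk> \<Longrightarrow>
      (\<exists>!q. q \<in> l \<and> (p = q \<or> collinear \<Pi> p q)) \<or> (\<forall>q\<in>l. p = q \<or> collinear \<Pi> p q)"
    and P4: "subset.chain {S. singular_subspace \<Pi> S} C \<Longrightarrow> finite C"

definition has_rank :: "'a pls \<Rightarrow> int \<Rightarrow> bool" where
  "has_rank \<Pi> n \<longleftrightarrow> (\<forall>M. maximal_singular_subspace \<Pi> M \<longrightarrow> pdim \<Pi> M = n - 1)"

definition polar_space_of_rank :: "'a pls \<Rightarrow> int \<Rightarrow> bool" where
  "polar_space_of_rank \<Pi> n \<longleftrightarrow> polar_space \<Pi> \<and> has_rank \<Pi> n"

definition standard_thin :: "int \<Rightarrow> int pls" where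
  "standard_thin n =
     \<lparr>points = {i. i \<noteq> 0 \<and> \<bar>i\<bar> \<le> n},
      lines = {{i, j} | i j. i \<noteq> 0 \<and> \<bar>i\<bar> \<le> n \<and> j \<noteq> 0 \<and> \<bar>j\<bar> \<le> n \<and> i \<noteq> j \<and> j \<noteq> - i}\<rparr>"

definition thin_polar_space_of_rank :: "'a pls \<Rightarrow> int \<Rightarrow> bool" where
  "thin_polar_space_of_rank \<Pi> n \<longleftrightarrow> partial_linear_space \<Pi> \<and> isomorphic \<Pi> (standard_thin n)"


section \<open>Polar Grassmannians and their graphs\<close>

definition grassmannian :: "'a pls \<Rightarrow> int \<Rightarrow> 'a set set" where
  "grassmannian \<Pi> k = {X. singular_subspace \<Pi> X \<and> pdim \<Pi> X = k}"

definition subspaces_above :: "'a pls \<Rightarrow> 'a set \<Rightarrow> int \<Rightarrow> 'a set set" where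
  "subspaces_above \<Pi> S k = {X \<in> grassmannian \<Pi> k. S \<subseteq> X}"

definition subspaces_between :: "'a pls \<Rightarrow> 'a set \<Rightarrow> 'a set \<Rightarrow> int \<Rightarrow> 'a set set" where
  "subspaces_between \<Pi> S U k = {X \<in> grassmannian \<Pi> k. S \<subseteq> X \<and> X \<subseteq> U}"

text \<open>The parameter \<open>n\<close> is the rank of \<open>\<Pi>\<close>.\<close>

definition grassmann_edges :: "'a pls \<Rightarrow> int \<Rightarrow> int \<Rightarrow> ('a set \<times> 'a set) set" where
  "grassmann_edges \<Pi> n k =
     {(X, Y). X \<in> grassmannian \<Pi> k \<and> Y \<in> grassmannian \<Pi> k \<and> X \<noteq> Y \<and>
        (if k = n - 1 then X \<inter> Y \<in> grassmannian \<Pi> (n - 2)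
         else \<exists>U\<in>grassmannian \<Pi> (k + 1). X \<subseteq> U \<and> Y \<subseteq> U)}"

text \<open>The length of a shortest path, infinite if there is none.\<close>

definition path_distance :: "('v \<times> 'v) set \<Rightarrow> 'v \<Rightarrow> 'v \<Rightarrow> enat" where
  "path_distance E x y = Inf {enat m | m. (x, y) \<in> E ^^ m}"

definition isometric_embedding ::
    "'v set \<Rightarrow> ('v \<times> 'v) set \<Rightarrow> 'w set \<Rightarrow> ('w \<times> 'w) set \<Rightarrow> ('v \<Rightarrow> 'w) \<Rightarrow> bool" where
  "isometric_embedding V E V' E' f \<longleftrightarrow>
     f ` V \<subseteq> V' \<and> inj_on f V \<and>
     (\<forall>x\<in>V. \<forall>y\<in>V. path_distance E' (f x) (f y) = path_distance E x y)"


section \<open>Residues and induced maps\<close>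

text \<open>
  The points of the residue of \<open>S\<close> are the singular subspaces of dimension one more than \<open>S\<close> that
  contain \<open>S\<close>. For \<open>S = {}\<close> they are the singletons \<open>{p}\<close>, so this residue is \<open>\<Pi>\<close> up to
  identifying \<open>p\<close> with \<open>{p}\<close>.
\<close>

definition residue :: "'a pls \<Rightarrow> 'a set \<Rightarrow> 'a set pls" where
  "residue \<Pi> S =
     \<lparr>points = subspaces_above \<Pi> S (pdim \<Pi> S + 1),
      lines = {subspaces_between \<Pi> S U (pdim \<Pi> S + 1) | U. U \<in> subspaces_above \<Pi> S (pdim \<Pi> S + 2)}\<rparr>"

definition collinearity_preserving_injection :: "'a pls \<Rightarrow> 'b pls \<Rightarrow> ('a \<Rightarrow> 'b) \<Rightarrow> bool" where
  "collinearity_preserving_injection \<Pi> \<Pi>' h \<longleftrightarrow>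
     h ` points \<Pi> \<subseteq> points \<Pi>' \<and> inj_on h (points \<Pi>) \<and>
     (\<forall>p\<in>points \<Pi>. \<forall>q\<in>points \<Pi>. p \<noteq> q \<longrightarrow>
        (collinear \<Pi> p q \<longleftrightarrow> collinear \<Pi>' (h p) (h q)))"

text \<open>Here \<open>h\<close> maps points of \<open>\<Pi>\<close> to points of a residue of \<open>\<Pi>'\<close>, that is, to subspaces of \<open>\<Pi>'\<close>.\<close>

definition induced_by ::
    "'a pls \<Rightarrow> int \<Rightarrow> 'b pls \<Rightarrow> ('a set \<Rightarrow> 'b set) \<Rightarrow> ('a \<Rightarrow> 'b set) \<Rightarrow> bool" where
  "induced_by \<Pi> k \<Pi>' f h \<longleftrightarrow> (\<forall>U\<in>grassmannian \<Pi> k. f U = pspan \<Pi>' (\<Union>p\<in>U. h p))"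

end

theory Submission
  imports Defs
begin

text \<open>
  A triangle of mutually adjacent vertices is of star type if it has two nonadjacent common
  neighbours. As \<open>k \<le> n - 4\<close>, every triangle of \<open>k\<close>-subspaces through a common \<open>(k-1)\<close>-subspace \<open>A\<close>
  has such neighbours, so its image is of star type, and connectedness of the residue of \<open>A\<close> shows
  that \<open>g A = f X \<inter> f Y\<close> is the same for all adjacent \<open>X, Y\<close> through \<open>A\<close>. The map \<open>g\<close> is injective on
  adjacent pairs: opposite \<open>k\<close>-subspaces through adjacent \<open>A\<close> and \<open>B\<close> would otherwise have images that
  are too close to each other. Given this, a triangle of \<open>(k-1)\<close>-subspaces is a section of the
  triangle of its spans, whose images intersect pairwise in the images of the vertices; so \<open>g\<close> again
  maps star triangles to star triangles and one descends further. On points this gives \<open>h\<close>, and on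
  the empty subspace it gives \<open>S\<close>.

  Exchange and modularity of singular subspaces are derived without the Veblen axiom and without
  thickness of lines, from the fact that every point outside a singular subspace \<open>X\<close> is separated
  from it by some \<open>w \<in> X\<^sup>\<bottom>\<close>. Hence thin polar spaces need no separate treatment.
\<close>

section \<open>Polar spaces with lines of arbitrary size\<close>

text \<open>Triangles of mutually adjacent vertices come in two kinds: three vertices through a
  common hyperplane, and three hyperplanes of one subspace. Only the first kind determines a
  subspace of smaller rank, so the descent stands or falls with keeping the second kind out. With
  \<open>r = k + 1\<close>, a triangle of the first kind lies in a singular subspace of rank at most
  \<open>r + 2\<close>. The bound \<open>k \<le> n - 4\<close> makes this smaller than the rank of
  the space and leaves two non-orthogonal points in its perp. That images are "too close" is a
  count. Vertices through a common subspace of rank \<open>t\<close> have distance at most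
  \<open>r - t + 1\<close>. Above adjacent \<open>B1\<close>, \<open>B2\<close> of rank
  \<open>j\<close> there are vertices at distance at least \<open>r - j + 2\<close>, because
  everything in one that is orthogonal to the other lies in \<open>B1 \<inter> B2\<close>, of rank
  \<open>j - 1\<close>. A common image of \<open>B1\<close> and \<open>B2\<close> has corank
  \<open>r - j\<close> in the images of vertices above them and would bound their distance by
  \<open>r - j + 1\<close>. The inequality \<open>n - k \<le> n' - k'\<close> rests on
  \<open>h\<close> preserving non-orthogonality: a point outside a singular subspace is separated
  from it, and the separation survives in the image.\<close>

locale weak_polar_space = partial_linear_space +
  assumes nondegenerate: "p \<in> points \<Pi> \<Longrightarrow> \<exists>q\<in>points \<Pi>. p \<noteq> q \<and> \<not> collinear \<Pi> p q"
    and one_or_all: "\<lbrakk>p \<in> points \<Pi>; l \<in> lines \<Pi>\<rbrakk> \<Longrightarrow>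
      (\<exists>!q. q \<in> l \<and> (p = q \<or> collinear \<Pi> p q)) \<or> (\<forall>q\<in>l. p = q \<or> collinear \<Pi> p q)"
    and finite_chain: "subset.chain {S. singular_subspace \<Pi> S} C \<Longrightarrow> finite C"
begin

text \<open>Collinear or equal, with membership in the point set built in, so that an orthogonality
  fact also certifies both points.\<close>

definition orth :: "'a \<Rightarrow> 'a \<Rightarrow> bool" where
  "orth p q \<longleftrightarrow> p \<in> points \<Pi> \<and> q \<in> points \<Pi> \<and> (p = q \<or> collinear \<Pi> p q)"

definition perp :: "'a set \<Rightarrow> 'a set" where
  "perp X = {p \<in> points \<Pi>. \<forall>x\<in>X. orth p x}"

text \<open>This is the unique line through \<open>a\<close> and \<open>b\<close> only if they are
  distinct and orthogonal. Otherwise it is empty or a union of possibly several lines, and the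
  lemmas on \<open>join\<close> therefore carry both conditions.\<close>

definition join :: "'a \<Rightarrow> 'a \<Rightarrow> 'a set" where
  "join a b = \<Union>{l \<in> lines \<Pi>. a \<in> l \<and> b \<in> l}"

abbreviation "sub \<equiv> subspace \<Pi>"
abbreviation "sing \<equiv> singular_subspace \<Pi>"
abbreviation "gen \<equiv> pspan \<Pi>"

section \<open>Orthogonality and lines\<close>

lemma orth_sym: "orth p q \<Longrightarrow> orth q p"
  by (auto simp: orth_def collinear_def)

lemma orth_refl: "p \<in> points \<Pi> \<Longrightarrow> orth p p"
  by (simp add: orth_def)

lemma orth_points: "orth p q \<Longrightarrow> p \<in> points \<Pi>" "orth p q \<Longrightarrow> q \<in> points \<Pi>"
  by (auto simp: orth_def)

lemma line_collinear: "\<lbrakk>l \<in> lines \<Pi>; a \<in> l; b \<in> l\<rbrakk> \<Longrightarrow> orth a b"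
  using line_proper by (fastforce simp: orth_def collinear_def)

lemma join_obtain:
  assumes "orth a b" "a \<noteq> b"
  obtains l where "l \<in> lines \<Pi>" "a \<in> l" "b \<in> l" "join a b = l"
proof -
  from assms obtain l where l: "l \<in> lines \<Pi>" "a \<in> l" "b \<in> l"
    by (auto simp: orth_def collinear_def)
  then have "join a b = l"
    using line_unique[OF assms(2)] by (auto simp: join_def)
  with l show ?thesis using that by blast
qed

lemma join_ends: "\<lbrakk>orth a b; a \<noteq> b\<rbrakk> \<Longrightarrow> a \<in> join a b" "\<lbrakk>orth a b; a \<noteq> b\<rbrakk> \<Longrightarrow> b \<in> join a b"
  by (metis join_obtain)+

lemma join_orth: "\<lbrakk>orth a b; a \<noteq> b; c \<in> join a b; d \<in> join a b\<rbrakk> \<Longrightarrow> orth c d"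
  by (metis join_obtain line_collinear)

lemma join_exchange:
  assumes "orth a b" "a \<noteq> b" "c \<in> join a b" "c \<noteq> a"
  shows "b \<in> join a c"
  using assms by (metis join_obtain line_collinear line_unique)

lemma orth_join:
  assumes "orth p a" "orth p b" "a \<noteq> b" "orth a b" "c \<in> join a b"
  shows "orth p c"
proof -
  from join_obtain[OF assms(4,3)] obtain l where l: "l \<in> lines \<Pi>" "a \<in> l" "b \<in> l" "join a b = l" .
  have p: "p \<in> points \<Pi>" using assms(1) orth_points by blast
  have c: "c \<in> points \<Pi>" using l assms(5) line_proper by blast
  show ?thesis
    using one_or_all[OF p l(1)] assms l c p unfolding orth_def by metis
qed

text \<open>Read contrapositively, this is the mechanism of the separation arguments below: a point
  orthogonal to \<open>a\<close> but not to \<open>b\<close> is orthogonal to no point of the line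
  other than \<open>a\<close>.\<close>

lemma orth_join': "\<lbrakk>orth p a; orth p c; orth a b; a \<noteq> b; c \<in> join a b; c \<noteq> a\<rbrakk> \<Longrightarrow> orth p b"
  by (metis join_exchange orth_join join_orth join_ends)

lemma join_meets_perp:
  assumes "p \<in> points \<Pi>" "orth a b" "a \<noteq> b"
  obtains c where "c \<in> join a b" "orth p c"
proof -
  from join_obtain[OF assms(2,3)] obtain l where l: "l \<in> lines \<Pi>" "a \<in> l" "b \<in> l" "join a b = l" .
  have "\<exists>q\<in>l. p = q \<or> collinear \<Pi> p q" using one_or_all[OF assms(1) l(1)] l(2) by blast
  moreover have "q \<in> points \<Pi>" if "q \<in> l" for q using l that line_proper by blast
  ultimately show ?thesis using that l assms(1) unfolding orth_def by blast
qed

lemma perp_points: "perp X \<subseteq> points \<Pi>"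
  by (auto simp: perp_def)

lemma perp_orth: "\<lbrakk>p \<in> perp X; x \<in> X\<rbrakk> \<Longrightarrow> orth p x"
  by (simp add: perp_def)

lemma perp_antimono: "X \<subseteq> Y \<Longrightarrow> perp Y \<subseteq> perp X"
  by (auto simp: perp_def)

lemma perp_sym: "\<lbrakk>X \<subseteq> perp Y; Y \<subseteq> points \<Pi>\<rbrakk> \<Longrightarrow> Y \<subseteq> perp X"
  by (auto simp: perp_def intro: orth_sym)

lemma in_perp_insert: "p \<in> perp (insert x Y) \<longleftrightarrow> orth p x \<and> p \<in> perp Y"
  by (auto simp: perp_def)

lemma in_perp_singleton: "p \<in> perp {x} \<longleftrightarrow> orth p x"
  by (auto simp: perp_def orth_def)

section \<open>Subspaces, perps and spans\<close>

lemma subspace_iff: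
  "sub S \<longleftrightarrow> S \<subseteq> points \<Pi> \<and> (\<forall>a\<in>S. \<forall>b\<in>S. a \<noteq> b \<longrightarrow> orth a b \<longrightarrow> join a b \<subseteq> S)"
proof
  assume "sub S"
  then show "S \<subseteq> points \<Pi> \<and> (\<forall>a\<in>S. \<forall>b\<in>S. a \<noteq> b \<longrightarrow> orth a b \<longrightarrow> join a b \<subseteq> S)"
    unfolding subspace_def join_def by blast
next
  assume R: "S \<subseteq> points \<Pi> \<and> (\<forall>a\<in>S. \<forall>b\<in>S. a \<noteq> b \<longrightarrow> orth a b \<longrightarrow> join a b \<subseteq> S)"
  have "l \<subseteq> S" if "p \<in> S" "q \<in> S" "l \<in> lines \<Pi>" "p \<noteq> q" "p \<in> l" "q \<in> l" for p q l
  proof -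
    have "orth p q" using line_collinear that by blast
    moreover have "l \<subseteq> join p q" using that by (auto simp: join_def)
    ultimately show ?thesis using R that by blast
  qed
  with R show "sub S" unfolding subspace_def by blast
qed

lemma subspace_join: "\<lbrakk>sub S; a \<in> S; b \<in> S; a \<noteq> b; orth a b; c \<in> join a b\<rbrakk> \<Longrightarrow> c \<in> S"
  by (auto simp: subspace_iff)

lemma perp_subspace: "sub (perp X)"
  unfolding subspace_iff
proof (intro conjI ballI impI subsetI)
  fix a b c assume h: "a \<in> perp X" "b \<in> perp X" "a \<noteq> b" "orth a b" "c \<in> join a b"
  have "c \<in> points \<Pi>" using join_orth[OF h(4,3,5,5)] by (rule orth_points)
  moreover have "orth c x" if "x \<in> X" for x
    using orth_join[OF orth_sym[OF perp_orth[OF h(1) that]] orth_sym[OF perp_orth[OF h(2) that]] h(3-5)]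
    by (rule orth_sym)
  ultimately show "c \<in> perp X" by (simp add: perp_def)
qed (simp add: perp_def)

lemma subspaceI:
  assumes "S \<subseteq> points \<Pi>"
    and "\<And>p q l x. \<lbrakk>p \<in> S; q \<in> S; l \<in> lines \<Pi>; p \<noteq> q; p \<in> l; q \<in> l; x \<in> l\<rbrakk> \<Longrightarrow> x \<in> S"
  shows "sub S"
  unfolding subspace_def
  by (meson assms(2) subset_iff assms(1))

lemma subspaceD: "\<lbrakk>sub S; p \<in> S; q \<in> S; l \<in> lines \<Pi>; p \<noteq> q; p \<in> l; q \<in> l; x \<in> l\<rbrakk> \<Longrightarrow> x \<in> S"
  by (meson subspace_def subsetD)

lemma subspace_points: "sub S \<Longrightarrow> S \<subseteq> points \<Pi>"
  by (simp add: subspace_def)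

lemma subspace_Int: "\<lbrakk>sub S; sub T\<rbrakk> \<Longrightarrow> sub (S \<inter> T)"
  by (rule subspaceI) (use subspace_points in blast, metis IntE IntI subspaceD)

lemma singular_iff: "sing S \<longleftrightarrow> sub S \<and> S \<subseteq> perp S"
  unfolding singular_subspace_def perp_def orth_def
  using subspace_points[of S] by (auto simp: subset_eq)

lemma singular_orth: "\<lbrakk>sing S; a \<in> S; b \<in> S\<rbrakk> \<Longrightarrow> orth a b"
  unfolding singular_iff by (meson perp_orth subsetD)

lemma singular_points: "sing S \<Longrightarrow> S \<subseteq> points \<Pi>"
  unfolding singular_iff using perp_points by blast

lemma singular_Int: "\<lbrakk>sing S; sub T\<rbrakk> \<Longrightarrow> sing (S \<inter> T)"
  unfolding singular_iff using subspace_Int[of S T] perp_antimono[of "S \<inter> T" S] by blast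

lemma singular_sub: "sing S \<Longrightarrow> sub S"
  by (simp add: singular_iff)

lemma gen_superset: "X \<subseteq> gen X"
  by (auto simp: pspan_def)

lemma gen_minimal: "\<lbrakk>sub S; X \<subseteq> S\<rbrakk> \<Longrightarrow> gen X \<subseteq> S"
  by (auto simp: pspan_def)

lemma points_subspace: "sub (points \<Pi>)"
  unfolding subspace_def using line_proper by blast

lemma gen_subspace:
  assumes "X \<subseteq> points \<Pi>"
  shows "sub (gen X)"
proof (rule subspaceI)
  show "gen X \<subseteq> points \<Pi>" using gen_minimal points_subspace assms by metis
next
  fix p q l x
  assume h: "p \<in> gen X" "q \<in> gen X" and l: "l \<in> lines \<Pi>" "p \<noteq> q" "p \<in> l" "q \<in> l" "x \<in> l"
  have "x \<in> S" if S: "sub S" "X \<subseteq> S" for S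
    using subspaceD[OF S(1) _ _ l] h S by (auto simp: pspan_def)
  then show "x \<in> gen X" by (simp add: pspan_def)
qed

lemma gen_mono: "X \<subseteq> Y \<Longrightarrow> gen X \<subseteq> gen Y"
  unfolding pspan_def by blast

lemma gen_subspace_eq: "sub S \<Longrightarrow> gen S = S"
  by (simp add: gen_minimal gen_superset subset_antisym)

text \<open>A double perp is a subspace, so \<open>X \<subseteq> perp (perp X)\<close> already
  forces \<open>gen X\<close> into it.\<close>

lemma perp_gen: "X \<subseteq> points \<Pi> \<Longrightarrow> perp (gen X) = perp X"
proof
  assume X: "X \<subseteq> points \<Pi>"
  show "perp (gen X) \<subseteq> perp X" by (rule perp_antimono[OF gen_superset])
  have "X \<subseteq> perp (perp X)" using X by (auto simp: perp_def intro: orth_sym)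
  then have "gen X \<subseteq> perp (perp X)" by (rule gen_minimal[OF perp_subspace])
  then show "perp X \<subseteq> perp (gen X)" by (rule perp_sym[OF _ perp_points])
qed

lemma perp_self_points: "X \<subseteq> perp X \<Longrightarrow> X \<subseteq> points \<Pi>"
  using perp_points by blast

lemma gen_singular: "X \<subseteq> perp X \<Longrightarrow> sing (gen X)"
  unfolding singular_iff
  by (metis perp_self_points perp_gen perp_subspace gen_minimal gen_subspace)

lemma clique_insert: "\<lbrakk>B \<subseteq> perp B; x \<in> perp B\<rbrakk> \<Longrightarrow> insert x B \<subseteq> perp (insert x B)"
  by (auto simp: perp_def intro: orth_sym orth_refl)

lemma clique_subset: "\<lbrakk>B \<subseteq> perp B; C \<subseteq> B\<rbrakk> \<Longrightarrow> C \<subseteq> perp C"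
  by (meson perp_antimono subset_trans)

lemma empty_singular: "sing {}"
  by (simp add: singular_subspace_def subspace_def)

lemma gen_empty: "gen {} = {}"
  using empty_singular gen_subspace_eq singular_sub by blast

subsection \<open>Points outside a singular subspace\<close>

text \<open>Induction on the generators. If every point of \<open>perp (insert x B)\<close> were
  orthogonal to \<open>u\<close>, a point \<open>v\<close> separating \<open>u\<close> from
  \<open>B\<close> could not be orthogonal to \<open>x\<close>. Its perp then meets the line
  \<open>x u\<close> in a third point \<open>u'\<close>, again outside \<open>gen B\<close>. Two
  projections, involving \<open>v\<close> and a point \<open>s\<close> that separates
  \<open>u'\<close> from \<open>B\<close>, produce a point of \<open>perp B\<close> orthogonal to
  \<open>x\<close> but not to \<open>u'\<close>, contrary to the assumption.\<close>

lemma perp_separates: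
  assumes "finite B" "B \<subseteq> perp B" "u \<in> points \<Pi>" "u \<notin> gen B"
  shows "\<exists>w\<in>perp B. \<not> orth w u"
  using assms
proof (induction B arbitrary: u rule: finite_induct)
  case empty
  then show ?case
    using nondegenerate[of u] orth_sym by (auto simp: perp_def orth_def collinear_def)
next
  case (insert x B)
  have BB: "B \<subseteq> perp B" and xB: "x \<in> perp B"
    using insert.prems(1) perp_antimono[of B "insert x B"] by auto
  have xp: "x \<in> points \<Pi>" using xB perp_points by blast
  have spB: "gen B \<subseteq> gen (insert x B)" by (rule gen_mono) blast
  have ss: "sub (gen (insert x B))" by (rule gen_subspace[OF perp_self_points[OF insert.prems(1)]])
  show ?case
  proof (rule ccontr)
    assume "\<not> ?thesis"
    then have all: "\<And>w. w \<in> perp (insert x B) \<Longrightarrow> orth w u" by blast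
    have ux: "orth u x" using orth_sym[OF all[of x]] insert.prems(1) by simp
    have "orth u b" if "b \<in> B" for b using orth_sym[OF all[of b]] insert.prems(1) that by auto
    then have uB: "u \<in> perp B" by (simp add: perp_def insert.prems(2))
    obtain v where v: "v \<in> perp B" "\<not> orth v u"
      using insert.IH[OF BB insert.prems(2)] insert.prems(3) spB by blast
    have vp: "v \<in> points \<Pi>" using v perp_points by blast
    have vx: "\<not> orth v x" using all[of v] v by (auto simp: perp_def)
    have uneqx: "u \<noteq> x" using insert.prems(3) gen_superset[of "insert x B"] by blast
    obtain u' where u': "u' \<in> join x u" "orth v u'"
      using join_meets_perp[OF vp orth_sym[OF ux] uneqx[symmetric]] .
    have u'x: "u' \<noteq> x" and u'u: "u' \<noteq> u" using u' v vx by auto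
    have u'p: "u' \<in> points \<Pi>" using u' orth_points by blast
    have ou'x: "orth u' x" using join_orth join_ends u' ux uneqx orth_sym by metis
    have ou'u: "orth u' u" using join_orth join_ends u' ux uneqx orth_sym by metis
    have u'B: "u' \<in> perp B"
      using subspace_join[OF perp_subspace xB uB] u' uneqx orth_sym[OF ux] by simp
    have "u' \<notin> gen B"
    proof
      assume "u' \<in> gen B"
      then have "u' \<in> gen (insert x B)" using spB by blast
      moreover have "x \<in> gen (insert x B)" using gen_superset[of "insert x B"] by blast
      moreover have "u \<in> join x u'" using join_exchange u' ux uneqx u'x orth_sym by metis
      ultimately show False using subspace_join[OF ss] insert.prems(3) u'x ou'x orth_sym by metis
    qed
    then obtain s where s: "s \<in> perp B" "\<not> orth s u'"
      using insert.IH[OF BB u'p] by blast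
    have sp: "s \<in> points \<Pi>" using s perp_points by blast
    have key: "orth t u'" if t: "t \<in> perp B" "orth t x" for t
    proof (cases "t = x")
      case True then show ?thesis using orth_sym[OF ou'x] ou'x orth_refl[OF xp] orth_sym by metis
    next
      case False
      obtain w where w: "w \<in> join x t" "orth v w"
        using join_meets_perp[OF vp orth_sym[OF t(2)]] False by metis
      have wB: "w \<in> perp B" using subspace_join[OF perp_subspace xB t(1)] False t w orth_sym by metis
      have wx: "orth w x" using join_orth join_ends w False t orth_sym by metis
      have "orth w u" using all wB wx by (auto simp: perp_def)
      then have "orth w u'" using orth_join[of w x u u'] wx uneqx ux u' orth_sym by metis
      moreover have "w \<noteq> x" using w vx by blast
      ultimately show ?thesis
        using orth_join'[of u' x w t] ou'x w False t orth_sym by metis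
    qed
    have vu': "v \<noteq> u'" using ou'u v by blast
    \<comment> \<open>\<open>v0\<close> replaces \<open>v\<close> by a point that is also orthogonal
      to \<open>s\<close>, so that \<open>v0\<close> and \<open>s\<close> span a line on which a
      point orthogonal to \<open>x\<close> can be found.\<close>
    obtain v0 where v0: "v0 \<in> join u' v" "orth s v0"
      using join_meets_perp[OF sp orth_sym[OF u'(2)]] vu' by metis
    have v0u': "v0 \<noteq> u'" using v0 s by blast
    have v0B: "v0 \<in> perp B"
      using subspace_join[OF perp_subspace u'B v(1)] vu' u' v0 orth_sym by metis
    have ov0u': "orth v0 u'" using join_orth join_ends v0 vu' u' orth_sym by metis
    have v0x: "\<not> orth v0 x"
      using orth_join'[of x u' v0 v] v0 vu' u' v0u' vx ou'x orth_sym by metis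
    have sv0: "s \<noteq> v0" using ov0u' s by blast
    obtain s1 where s1: "s1 \<in> join v0 s" "orth x s1"
      using join_meets_perp[OF xp orth_sym[OF v0(2)]] sv0 by metis
    have "s1 \<in> perp B"
      using subspace_join[OF perp_subspace v0B s(1)] sv0 s1 v0 orth_sym by metis
    then have "orth s1 u'" using key s1 orth_sym by blast
    moreover have "s1 \<noteq> v0" using v0x s1 orth_sym by blast
    ultimately have "orth u' s"
      using orth_join'[of u' v0 s1 s] ov0u' s1 v0 sv0 orth_sym by metis
    then show False using s orth_sym by blast
  qed
qed

text \<open>Within \<open>perp B\<close>, every point orthogonal to \<open>p\<close> is orthogonal
  to \<open>c\<close>, because \<open>c\<close> lies in the span of \<open>p\<close> and
  \<open>B\<close>. If \<open>p\<close> were outside the span of \<open>c\<close> and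
  \<open>B\<close>, some \<open>z\<close> would be orthogonal to \<open>c\<close> and
  \<open>B\<close> but not to \<open>p\<close>. With a \<open>y\<close> in \<open>perp B\<close> not
  orthogonal to \<open>c\<close>, projecting twice yields a point of \<open>perp B\<close>
  orthogonal to \<open>p\<close> but not to \<open>c\<close>.\<close>

lemma gen_exchange:
  assumes B: "finite B" "insert p B \<subseteq> perp (insert p B)"
    and c: "c \<in> gen (insert p B)" "c \<notin> gen B"
  shows "p \<in> gen (insert c B)"
proof (rule ccontr)
  assume n: "p \<notin> gen (insert c B)"
  have sg: "sing (gen (insert p B))" using B gen_singular by blast
  have mem: "insert p B \<subseteq> gen (insert p B)" by (rule gen_superset)
  have pp: "p \<in> points \<Pi>" using B perp_points by blast
  have cp: "c \<in> points \<Pi>" using singular_points[OF sg] c by blast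
  have cc: "insert c B \<subseteq> perp (insert c B)"
    using singular_orth[OF sg] c mem cp B perp_points by (auto simp: perp_def)
  have BB: "B \<subseteq> perp B" by (rule clique_subset[OF cc]) blast
  have pc: "orth p c" using singular_orth[OF sg] c mem by blast
  obtain z where z: "z \<in> perp (insert c B)" "\<not> orth z p"
    using perp_separates[OF _ cc pp n] B(1) by auto
  obtain y where y: "y \<in> perp B" "\<not> orth y c"
    using perp_separates[OF B(1) BB cp c(2)] by metis
  have zc: "orth z c" and zB: "z \<in> perp B" using z(1) by (simp_all add: in_perp_insert)
  have inc: "orth t c" if "t \<in> perp B" "orth t p" for t
  proof -
    have "t \<in> perp (insert p B)" using that by (simp add: in_perp_insert)
    then have "t \<in> perp (gen (insert p B))" using perp_gen[OF perp_self_points[OF B(2)]] by simp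
    then show ?thesis by (rule perp_orth) (rule c)
  qed
  have cB: "c \<in> perp B" using cc by (simp add: in_perp_insert)
  have zneqc: "z \<noteq> c" using z pc orth_sym by blast
  have yp: "y \<in> points \<Pi>" using y perp_points by blast
  obtain e where e: "e \<in> join c z" "orth y e"
    using join_meets_perp[OF yp orth_sym[OF zc]] zneqc by metis
  have ec: "e \<noteq> c" using e y by blast
  have eB: "e \<in> perp B" using subspace_join[OF perp_subspace cB zB] zneqc e zc orth_sym by metis
  have oec: "orth e c" using join_orth join_ends e zneqc zc orth_sym by metis
  have ep: "\<not> orth e p" using orth_join'[of p c e z] e zneqc zc pc ec z orth_sym by metis
  have eney: "e \<noteq> y" using oec y by blast
  obtain t where t: "t \<in> join e y" "orth p t"
    using join_meets_perp[OF pp orth_sym[OF e(2)]] eney by metis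
  have "t \<in> perp B" using subspace_join[OF perp_subspace eB y(1)] eney e t orth_sym by metis
  then have tc: "orth t c" using inc t orth_sym by blast
  have "t \<noteq> e" using t ep orth_sym by blast
  then have "orth c y" using orth_join'[of c e t y] tc oec t eney e orth_sym by metis
  then show False using y orth_sym by blast
qed

subsection \<open>Rank of singular subspaces\<close>

definition indep :: "'a set \<Rightarrow> bool" where
  "indep B \<longleftrightarrow> (\<forall>b\<in>B. b \<notin> gen (B - {b}))"

text \<open>Ranks are projective dimensions plus one, so that the empty subspace has rank \<open>0\<close>.\<close>

definition rk :: "'a set \<Rightarrow> nat" where
  "rk S = (LEAST m. \<exists>B. finite B \<and> card B = m \<and> B \<subseteq> S \<and> gen B = S)"

lemma pdim_rk: "pdim \<Pi> S = int (rk S) - 1"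
  by (simp add: pdim_def rk_def)

lemma gen_subset_gen: "\<lbrakk>X \<subseteq> gen Y; Y \<subseteq> points \<Pi>\<rbrakk> \<Longrightarrow> gen X \<subseteq> gen Y"
  by (rule gen_minimal[OF gen_subspace])

lemma gen_least_singular: "\<lbrakk>sing S; X \<subseteq> S\<rbrakk> \<Longrightarrow> gen X \<subseteq> S"
  by (rule gen_minimal[OF singular_sub])

lemma singular_clique: "\<lbrakk>sing S; X \<subseteq> S\<rbrakk> \<Longrightarrow> X \<subseteq> perp X"
  by (meson clique_subset singular_iff)

lemma singular_gen_subset: "\<lbrakk>sing S; X \<subseteq> S\<rbrakk> \<Longrightarrow> sing (gen X)"
  by (rule gen_singular[OF singular_clique])

text \<open>One exchange per step, with \<open>card (B - C)\<close> as measure. \<open>D\<close> is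
  a smallest subset of \<open>C\<close> that contains \<open>B \<inter> C\<close> and spans
  \<open>b\<close>. Independence of \<open>B\<close> puts into \<open>D\<close> an element
  \<open>c\<close> outside \<open>B\<close>, and minimality of \<open>D\<close> allows
  \<open>b\<close> to replace this \<open>c\<close>.\<close>

lemma steinitz:
  assumes "finite B" "indep B"
  shows "\<lbrakk>finite C; C \<subseteq> perp C; B \<subseteq> gen C\<rbrakk> \<Longrightarrow> card B \<le> card C"
proof (induction "card (B - C)" arbitrary: C rule: less_induct)
  case less
  show ?case
  proof (cases "B \<subseteq> C")
    case True
    then show ?thesis using less.prems(1) by (simp add: card_mono)
  next
    case False
    then obtain b where b: "b \<in> B" "b \<notin> C" by blast
    define P where "P D \<longleftrightarrow> D \<subseteq> C \<and> B \<inter> C \<subseteq> D \<and> b \<in> gen D" for D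
    have "P C" using b less.prems(3) by (auto simp: P_def)
    then obtain D where D: "P D" and Dmin: "\<And>D'. P D' \<Longrightarrow> card D \<le> card D'"
      using ex_has_least_nat[of P C card] by blast
    have finD: "finite D" using D less.prems(1) finite_subset by (auto simp: P_def)
    have "B \<inter> C \<subseteq> B - {b}" using b by blast
    then have "b \<notin> gen (B \<inter> C)"
      using assms(2) b gen_mono[of "B \<inter> C" "B - {b}"] by (auto simp: indep_def)
    then have "D \<noteq> B \<inter> C" using D by (auto simp: P_def)
    then obtain c where c: "c \<in> D" "c \<notin> B" "c \<in> C" using D by (auto simp: P_def)
    have cD: "insert c (D - {c}) = D" using c by blast
    have nb: "b \<notin> gen (D - {c})"
    proof
      assume "b \<in> gen (D - {c})"
      then have "P (D - {c})" using D c by (auto simp: P_def)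
      then have "card D \<le> card (D - {c})" by (rule Dmin)
      then show False using card_Diff1_less[OF finD c(1)] by linarith
    qed
    have Dcl: "D \<subseteq> perp D" using D by (intro clique_subset[OF less.prems(2)]) (simp add: P_def)
    have cg: "c \<in> gen (insert b (D - {c}))"
      by (rule gen_exchange) (use finD Dcl cD nb D in \<open>simp_all add: P_def\<close>)
    define C' where "C' = insert b (C - {c})"
    have sgC: "sing (gen C)" by (rule gen_singular[OF less.prems(2)])
    have C'g: "C' \<subseteq> gen C" using b less.prems(3) gen_superset[of C] by (auto simp: C'_def)
    have C'cl: "C' \<subseteq> perp C'" by (rule singular_clique[OF sgC C'g])
    have "insert b (D - {c}) \<subseteq> C'" using D by (auto simp: C'_def P_def)
    then have "c \<in> gen C'" using cg gen_mono by blast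
    then have "C \<subseteq> gen C'" using gen_superset[of C'] by (auto simp: C'_def)
    then have "gen C \<subseteq> gen C'" by (rule gen_subset_gen[OF _ perp_self_points[OF C'cl]])
    then have BC': "B \<subseteq> gen C'" using less.prems(3) by (rule order_trans[rotated])
    have "B - C' \<subset> B - C" using b c by (auto simp: C'_def)
    then have "card (B - C') < card (B - C)" using assms(1) by (simp add: psubset_card_mono)
    then have "card B \<le> card C'"
      using less.hyps[of C'] C'cl BC' less.prems(1) by (simp add: C'_def)
    also have "card C' = card C"
      unfolding C'_def using b(2) c(3) less.prems(1)
      by (metis DiffE card_Suc_Diff1 card_insert_disjoint finite_Diff)
    finally show ?thesis .
  qed
qed

text \<open>By the finite chain axiom: otherwise, choosing points outside the span of the earlier
  ones would yield an infinite strictly ascending chain of singular subspaces.\<close>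

lemma singular_finitely_generated:
  assumes S: "sing S"
  shows "\<exists>B. finite B \<and> B \<subseteq> S \<and> gen B = S"
proof (rule ccontr)
  assume n: "\<not> ?thesis"
  have ex: "\<exists>x. x \<in> S \<and> x \<notin> gen B" if "finite B" "B \<subseteq> S" for B
    using n that gen_least_singular[OF S that(2)] by blast
  define F where "F = rec_nat {} (\<lambda>_ B. insert (SOME x. x \<in> S \<and> x \<notin> gen B) B)"
  have F0: "F 0 = {}" and FS: "\<And>i. F (Suc i) = insert (SOME x. x \<in> S \<and> x \<notin> gen (F i)) (F i)"
    by (simp_all add: F_def)
  have fin: "finite (F i) \<and> F i \<subseteq> S" for i
  proof (induction i)
    case (Suc i)
    then show ?case using someI_ex[OF ex[of "F i"]] by (simp add: FS)
  qed (simp add: F0)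
  have new: "(SOME x. x \<in> S \<and> x \<notin> gen (F i)) \<notin> gen (F i)" for i
    using someI_ex[OF ex[of "F i"]] fin[of i] by blast
  have step: "gen (F i) \<subset> gen (F (Suc i))" for i
  proof
    show "gen (F i) \<subseteq> gen (F (Suc i))" by (rule gen_mono) (auto simp: FS)
    show "gen (F i) \<noteq> gen (F (Suc i))" using new[of i] gen_superset[of "F (Suc i)"] by (auto simp: FS)
  qed
  have sm: "strict_mono (\<lambda>i. gen (F i))" using step by (simp add: strict_mono_Suc_iff)
  have "subset.chain {S. sing S} (range (\<lambda>i. gen (F i)))"
    unfolding subset.chain_def
  proof (intro conjI ballI)
    show "range (\<lambda>i. gen (F i)) \<subseteq> {S. sing S}"
      using fin singular_gen_subset[OF S] by auto
    fix x y assume "x \<in> range (\<lambda>i. gen (F i))" "y \<in> range (\<lambda>i. gen (F i))"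
    then obtain i j where "x = gen (F i)" "y = gen (F j)" by auto
    then show "(\<subset>)\<^sup>=\<^sup>= x y \<or> (\<subset>)\<^sup>=\<^sup>= y x"
      using strict_mono_less[OF sm, of i j] strict_mono_less[OF sm, of j i]
      by (cases i j rule: linorder_cases) auto
  qed
  then have "finite (range (\<lambda>i. gen (F i)))" by (rule finite_chain)
  moreover have "inj (\<lambda>i. gen (F i))" using sm by (rule strict_mono_imp_inj_on)
  ultimately show False using finite_imageD by blast
qed

lemma singular_basis:
  assumes S: "sing S"
  obtains B where "finite B" "B \<subseteq> S" "gen B = S" "card B = rk S" "indep B"
proof -
  have "\<exists>m B. finite B \<and> card B = m \<and> B \<subseteq> S \<and> gen B = S"
    using singular_finitely_generated[OF S] by blast
  from LeastI_ex[OF this] obtain B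
    where B: "finite B" "card B = rk S" "B \<subseteq> S" "gen B = S"
    unfolding rk_def[symmetric] by blast
  have "b \<notin> gen (B - {b})" if b: "b \<in> B" for b
  proof
    assume h: "b \<in> gen (B - {b})"
    have "B \<subseteq> gen (B - {b})" using h gen_superset[of "B - {b}"] by blast
    then have "S \<subseteq> gen (B - {b})" using gen_subset_gen[of B "B - {b}"] B singular_points[OF S] by blast
    moreover have "gen (B - {b}) \<subseteq> S" using gen_least_singular[OF S] B(3) by blast
    ultimately have "gen (B - {b}) = S" by simp
    then have "rk S \<le> card (B - {b})"
      unfolding rk_def using B by (intro Least_le exI[of _ "B - {b}"]) auto
    then show False using card_Diff1_less[OF B(1) b] B(2) by linarith
  qed
  then show ?thesis using that B by (simp add: indep_def)
qed

lemma rk_mono_basis: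
  assumes "sing S" "finite B" "indep B" "B \<subseteq> S"
  shows "card B \<le> rk S"
  using singular_basis[OF assms(1)] steinitz[OF assms(2,3)] assms(4) singular_clique[OF assms(1)] by metis

lemma rk_eq_card:
  assumes "sing S" "finite B" "gen B = S" "indep B"
  shows "rk S = card B"
proof (rule antisym)
  have "B \<subseteq> S" using assms(3) gen_superset[of B] by simp
  then show "rk S \<le> card B" unfolding rk_def using assms by (intro Least_le) auto
  show "card B \<le> rk S" using rk_mono_basis assms(1,2,4) \<open>B \<subseteq> S\<close> by metis
qed

lemma rk_mono: "\<lbrakk>sing S; sing T; S \<subseteq> T\<rbrakk> \<Longrightarrow> rk S \<le> rk T"
  by (metis order_trans rk_mono_basis singular_basis)

lemma indep_insert:
  assumes "finite B" "indep B" "insert x B \<subseteq> perp (insert x B)" "x \<notin> gen B"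
  shows "indep (insert x B)"
  unfolding indep_def
proof
  fix b assume b: "b \<in> insert x B"
  show "b \<notin> gen (insert x B - {b})"
  proof (cases "b = x")
    case True
    then show ?thesis using assms(4) gen_mono[of "B - {x}" B] by auto
  next
    case False
    then have bB: "b \<in> B" and eq: "insert x B - {b} = insert x (B - {b})" using b by auto
    have "x \<in> gen (insert b (B - {b}))" if "b \<in> gen (insert x (B - {b}))"
    proof (rule gen_exchange[OF _ _ that])
      show "insert x (B - {b}) \<subseteq> perp (insert x (B - {b}))"
        by (rule clique_subset[OF assms(3)]) blast
    qed (use assms bB in \<open>simp_all add: indep_def\<close>)
    then show ?thesis using assms(4) bB eq by (auto simp: insert_absorb)
  qed
qed

lemma extend_singular: "\<lbrakk>sing S; x \<in> perp S\<rbrakk> \<Longrightarrow> sing (gen (insert x S))"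
  by (meson clique_insert gen_singular singular_iff)

lemma extend_superset: "S \<subseteq> gen (insert x S)"
  using gen_superset[of "insert x S"] by auto

lemma extend_mem: "x \<in> gen (insert x S)"
  using gen_superset[of "insert x S"] by auto

lemma in_perp_extend:
  assumes "sing S" "x \<in> perp S"
  shows "p \<in> perp (gen (insert x S)) \<longleftrightarrow> orth p x \<and> p \<in> perp S"
  using perp_gen[of "insert x S"] singular_points[OF assms(1)] assms(2) perp_points[of S]
  by (auto simp: in_perp_insert)

lemma rk_extend:
  assumes S: "sing S" and x: "x \<in> perp S" "x \<notin> S"
  shows "rk (gen (insert x S)) = Suc (rk S)"
proof -
  obtain B where B: "finite B" "B \<subseteq> S" "gen B = S" "card B = rk S" "indep B"
    using singular_basis[OF S] .
  have cl: "insert x S \<subseteq> perp (insert x S)"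
    using S x(1) clique_insert by (simp add: singular_iff)
  have "indep (insert x B)"
  proof (rule indep_insert[OF B(1,5)])
    show "insert x B \<subseteq> perp (insert x B)" by (rule clique_subset[OF cl]) (use B(2) in blast)
  qed (use x B(3) in simp)
  moreover have "gen (insert x B) = gen (insert x S)"
  proof
    show "gen (insert x B) \<subseteq> gen (insert x S)" by (rule gen_mono) (use B(2) in blast)
    have "insert x S \<subseteq> gen (insert x B)"
      using B(3) gen_mono[of B "insert x B"] gen_superset[of "insert x B"] by auto
    then show "gen (insert x S) \<subseteq> gen (insert x B)"
      using gen_subset_gen B(2) perp_self_points[OF cl] by (meson insert_mono subset_trans)
  qed
  ultimately have "rk (gen (insert x S)) = card (insert x B)"
    using rk_eq_card[OF extend_singular[OF S x(1)]] B(1) by simp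
  then show ?thesis using B x(2) by (metis card_insert_disjoint subsetD)
qed

lemma rk_strict:
  assumes "sing S" "sing T" "S \<subset> T"
  shows "rk S < rk T"
proof -
  obtain x where x: "x \<in> T" "x \<notin> S" using assms(3) by blast
  have p: "x \<in> perp S" using assms x unfolding singular_iff by (meson perp_antimono psubsetE subsetD)
  have "gen (insert x S) \<subseteq> T" by (rule gen_least_singular[OF assms(2)]) (use x assms(3) in blast)
  then have "rk (gen (insert x S)) \<le> rk T" using rk_mono extend_singular assms p by blast
  then show ?thesis using rk_extend[OF assms(1) p x(2)] by simp
qed

lemma rk_empty: "rk {} = 0"
  using rk_eq_card[OF empty_singular _ gen_empty] by (simp add: indep_def)

lemma rk_0_iff: "sing S \<Longrightarrow> rk S = 0 \<longleftrightarrow> S = {}"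
  using rk_empty rk_strict[OF empty_singular] by fastforce

lemma eq_of_rk: "\<lbrakk>sing S; sing T; S \<subseteq> T; rk T \<le> rk S\<rbrakk> \<Longrightarrow> S = T"
  using rk_strict by fastforce

section \<open>Separating points, hyperplanes and codimension of perps\<close>

lemma separate_point:
  assumes "sing S" "u \<in> points \<Pi>" "u \<notin> S"
  obtains w where "w \<in> perp S" "\<not> orth w u"
proof -
  obtain B where B: "finite B" "B \<subseteq> S" "gen B = S"
    using singular_finitely_generated[OF assms(1)] by blast
  have "\<exists>w\<in>perp B. \<not> orth w u"
    using perp_separates[OF B(1) singular_clique[OF assms(1) B(2)]] assms B(3) by simp
  moreover have "perp S = perp B"
    using perp_gen[of B] B singular_points[OF assms(1)] by simp
  ultimately show ?thesis using that by auto
qed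

lemma singular_in_perp: "\<lbrakk>sing T; S \<subseteq> T; x \<in> T\<rbrakk> \<Longrightarrow> x \<in> perp S"
  unfolding singular_iff by (meson perp_antimono subsetD)

lemma hyperplane_extend:
  assumes "sing U" "sing X" "X \<subseteq> U" "rk U = Suc (rk X)" "y \<in> U" "y \<notin> X"
  shows "U = gen (insert y X)"
proof -
  have y: "y \<in> perp X" by (rule singular_in_perp[OF assms(1,3,5)])
  have "gen (insert y X) \<subseteq> U" by (rule gen_least_singular[OF assms(1)]) (use assms in blast)
  then have "gen (insert y X) = U"
    using eq_of_rk[OF extend_singular[OF assms(2) y] assms(1)] rk_extend[OF assms(2) y assms(6)] assms(4)
    by simp
  then show ?thesis by simp
qed

lemma rk_between:
  assumes "sing S" "sing X" "S \<subseteq> X" "rk S \<le> m" "m \<le> rk X"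
  obtains Y where "sing Y" "S \<subseteq> Y" "Y \<subseteq> X" "rk Y = m"
proof -
  have "\<exists>Y. sing Y \<and> S \<subseteq> Y \<and> Y \<subseteq> X \<and> rk Y = m"
    using assms(4,5)
  proof (induction m rule: dec_induct)
    case base
    then show ?case using assms by blast
  next
    case (step i)
    then obtain Y where Y: "sing Y" "S \<subseteq> Y" "Y \<subseteq> X" "rk Y = i" by auto
    then have "Y \<noteq> X" using step by auto
    then obtain x where x: "x \<in> X" "x \<notin> Y" using Y by blast
    have p: "x \<in> perp Y" by (rule singular_in_perp[OF assms(2) Y(3) x(1)])
    have "gen (insert x Y) \<subseteq> X" by (rule gen_least_singular[OF assms(2)]) (use x Y in blast)
    then show ?case
      using extend_singular[OF Y(1) p] rk_extend[OF Y(1) p x(2)] extend_superset[of Y x] Y(2,4)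
      by (intro exI[of _ "gen (insert x Y)"]) auto
  qed
  then show ?thesis using that by blast
qed

text \<open>For \<open>s\<close> in \<open>S\<close> not orthogonal to \<open>p\<close>, every line
  of \<open>S\<close> through \<open>s\<close> meets \<open>perp {p}\<close>, so \<open>s\<close>
  and the intersection already generate \<open>S\<close>.\<close>

lemma rk_perp_point:
  assumes S: "sing S" and p: "p \<in> points \<Pi>"
  shows "rk S \<le> Suc (rk (S \<inter> perp {p}))"
proof (cases "S \<subseteq> perp {p}")
  case True
  then show ?thesis by (simp add: Int_absorb2)
next
  case False
  define H where "H = S \<inter> perp {p}"
  have H: "sing H" unfolding H_def by (rule singular_Int[OF S perp_subspace])
  obtain s where s: "s \<in> S" "\<not> orth p s" using False orth_sym in_perp_singleton by blast
  have sH: "s \<notin> H" "s \<in> perp H"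
    using s orth_sym singular_in_perp[OF S, of H s] by (auto simp: H_def in_perp_singleton)
  have "t \<in> gen (insert s H)" if t: "t \<in> S" for t
  proof (cases "t = s")
    case True
    then show ?thesis by (simp add: extend_mem)
  next
    case False
    have st: "orth s t" using singular_orth S s t by blast
    obtain c where c: "c \<in> join s t" "orth p c" using join_meets_perp[OF p st] False by metis
    have cS: "c \<in> S" using subspace_join[OF singular_sub[OF S] s(1) t] False st c by simp
    then have cH: "c \<in> H" using c orth_sym by (simp add: H_def in_perp_singleton)
    have cs: "c \<noteq> s" using c s by blast
    have "t \<in> join s c" using join_exchange[OF st _ c(1) cs] False by simp
    then show ?thesis
      using subspace_join[OF singular_sub[OF extend_singular[OF H sH(2)]], of s c t] cH cs
        extend_superset[of H s] extend_mem[of s H] singular_orth[OF S s(1) cS] by blast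
  qed
  then have "S \<subseteq> gen (insert s H)" by blast
  then have "rk S \<le> rk (gen (insert s H))" using rk_mono S extend_singular H sH by blast
  then show ?thesis using rk_extend[OF H sH(2,1)] by (simp add: H_def)
qed

text \<open>The modular law for a hyperplane. A point \<open>z\<close> of \<open>perp X\<close> that
  is not orthogonal to some \<open>u\<close> of \<open>U\<close> outside \<open>X\<close> cuts out
  exactly \<open>X = U \<inter> perp {z}\<close>, so intersecting with \<open>X\<close> becomes
  intersecting with the perp of a point.\<close>

lemma rk_Int_hyperplane:
  assumes U: "sing U" and X: "sing X" "X \<subseteq> U" "rk U \<le> Suc (rk X)" and Y: "sing Y" "Y \<subseteq> U"
  shows "rk Y \<le> Suc (rk (X \<inter> Y))"
proof (cases "X = U")
  case True
  then show ?thesis using Y by (simp add: Int_absorb1)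
next
  case False
  then obtain u where u: "u \<in> U" "u \<notin> X" using X by blast
  obtain z where z: "z \<in> perp X" "\<not> orth z u"
    using separate_point[OF X(1)] u singular_points[OF U] by blast
  have zp: "z \<in> points \<Pi>" using z perp_points by blast
  have sU: "sing (U \<inter> perp {z})" by (rule singular_Int[OF U perp_subspace])
  have "X \<subseteq> U \<inter> perp {z}"
    using X z orth_sym by (auto simp: in_perp_singleton perp_def[of X])
  moreover have "rk (U \<inter> perp {z}) < rk U"
  proof (rule rk_strict[OF sU U])
    have "u \<notin> perp {z}" using z(2) orth_sym[of u z] by (auto simp: in_perp_singleton)
    then show "U \<inter> perp {z} \<subset> U" using u(1) by blast
  qed
  ultimately have "X = U \<inter> perp {z}" using eq_of_rk[OF X(1) sU] X(3) by simp
  then have "Y \<inter> perp {z} = X \<inter> Y" using Y by blast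
  then show ?thesis using rk_perp_point[OF Y(1) zp] by simp
qed

text \<open>Growing \<open>D\<close> to \<open>Y\<close> point by point costs the part of
  \<open>X\<close> that stays orthogonal at most one rank per point. \<open>D\<close> is the part of
  \<open>Y\<close> that comes for free.\<close>

lemma rk_perp_codim:
  assumes "sing D" "sing Y" "D \<subseteq> Y"
  shows "\<lbrakk>sing X; D \<subseteq> perp X\<rbrakk> \<Longrightarrow> rk X + rk D \<le> rk (X \<inter> perp Y) + rk Y"
  using assms(1,3)
proof (induction "rk Y - rk D" arbitrary: D X rule: less_induct)
  case less
  show ?case
  proof (cases "D = Y")
    case True
    then have "X \<subseteq> perp Y" using perp_sym less.prems(2) singular_points[OF less.prems(1)] by blast
    then show ?thesis using True by (simp add: Int_absorb2)
  next
    case False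
    then obtain y where y: "y \<in> Y" "y \<notin> D" using less.prems by blast
    have yD: "y \<in> perp D" by (rule singular_in_perp[OF assms(2) less.prems(4) y(1)])
    have yp: "y \<in> points \<Pi>" using yD perp_points by blast
    define D1 X1 where "D1 = gen (insert y D)" and "X1 = X \<inter> perp {y}"
    have D1: "sing D1" "rk D1 = Suc (rk D)"
      unfolding D1_def using extend_singular[OF less.prems(3) yD] rk_extend[OF less.prems(3) yD y(2)] by auto
    have D1Y: "D1 \<subseteq> Y" unfolding D1_def by (rule gen_least_singular[OF assms(2)]) (use less.prems(4) y(1) in blast)
    have X1: "sing X1" unfolding X1_def by (rule singular_Int[OF less.prems(1) perp_subspace])
    have "insert y D \<subseteq> perp X1"
      using less.prems(2) perp_antimono[of X1 X] yp orth_sym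
      by (auto simp: X1_def perp_def)
    then have "D1 \<subseteq> perp X1" unfolding D1_def by (rule gen_minimal[OF perp_subspace])
    moreover have "rk D < rk Y" using rk_strict[OF less.prems(3) assms(2)] less.prems False by blast
    ultimately have "rk X1 + rk D1 \<le> rk (X1 \<inter> perp Y) + rk Y"
      using less.hyps[of D1 X1] D1 D1Y X1 by simp
    moreover have "X1 \<inter> perp Y = X \<inter> perp Y"
      using y perp_antimono[of "{y}" Y] by (auto simp: X1_def)
    moreover have "rk X \<le> Suc (rk X1)" unfolding X1_def by (rule rk_perp_point[OF less.prems(1) yp])
    ultimately show ?thesis using D1(2) by simp
  qed
qed

subsection \<open>Grassmann graphs\<close>

definition grass :: "nat \<Rightarrow> 'a set set" where
  "grass r = {X. sing X \<and> rk X = r}"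

text \<open>No rank is fixed, so that one relation serves all levels of the descent. Between maximal
  singular subspaces it never holds, and their graph is treated separately.\<close>

definition nb :: "'a set \<Rightarrow> 'a set \<Rightarrow> bool" where
  "nb X Y \<longleftrightarrow> sing X \<and> sing Y \<and> rk X = rk Y \<and> X \<noteq> Y \<and>
     (\<exists>U. sing U \<and> rk U = Suc (rk X) \<and> X \<subseteq> U \<and> Y \<subseteq> U)"

definition edges :: "nat \<Rightarrow> ('a set \<times> 'a set) set" where
  "edges r = {(X, Y). nb X Y \<and> rk X = r}"

text \<open>Distance at most \<open>d\<close>, phrased with walks so that bounds can be handled
  without speaking of infima or connectedness.\<close>

definition near :: "nat \<Rightarrow> nat \<Rightarrow> 'a set \<Rightarrow> 'a set \<Rightarrow> bool" where
  "near r d X Y \<longleftrightarrow> (\<exists>m\<le>d. (X, Y) \<in> edges r ^^ m)"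

lemma grassD: "X \<in> grass r \<Longrightarrow> sing X" "X \<in> grass r \<Longrightarrow> rk X = r"
  by (auto simp: grass_def)

lemma grassI: "\<lbrakk>sing X; rk X = r\<rbrakk> \<Longrightarrow> X \<in> grass r"
  by (simp add: grass_def)

lemma nb_sym: "nb X Y \<Longrightarrow> nb Y X"
  by (auto simp: nb_def)

lemma singular_Int_singular: "\<lbrakk>sing X; sing Y\<rbrakk> \<Longrightarrow> sing (X \<inter> Y)"
  using singular_Int singular_sub by simp

lemma nb_rk_Int:
  assumes "nb X Y"
  shows "rk X = Suc (rk (X \<inter> Y))"
proof -
  have h: "sing X" "sing Y" "rk X = rk Y" "X \<noteq> Y" using assms by (simp_all add: nb_def)
  obtain U where U: "sing U" "rk U = Suc (rk X)" "X \<subseteq> U" "Y \<subseteq> U"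
    using assms unfolding nb_def by blast
  have "rk Y \<le> Suc (rk (X \<inter> Y))" using rk_Int_hyperplane[OF U(1) h(1) U(3) _ h(2) U(4)] U(2) by simp
  moreover have "X \<inter> Y \<noteq> X" using eq_of_rk[OF h(1,2)] h by auto
  then have "rk (X \<inter> Y) < rk X" using rk_strict[OF singular_Int_singular[OF h(1,2)] h(1)] by blast
  ultimately show ?thesis using h by simp
qed

lemma nb_perp: "nb X Y \<Longrightarrow> X \<subseteq> perp Y"
  using singular_in_perp by (auto simp: nb_def)

text \<open>Orthogonality makes the span of \<open>X\<close> and a further point of \<open>Y\<close>
  singular, and this point together with the large intersection already generates
  \<open>Y\<close>.\<close>

lemma nbI:
  assumes h: "sing X" "sing Y" "rk X = rk Y" "X \<noteq> Y" and p: "X \<subseteq> perp Y" and r: "rk X \<le> Suc (rk (X \<inter> Y))"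
  shows "nb X Y"
proof -
  have "\<not> Y \<subseteq> X" using eq_of_rk[OF h(2,1)] h by auto
  then obtain y where y: "y \<in> Y" "y \<notin> X" by blast
  have yX: "y \<in> perp X" using perp_sym[OF p singular_points[OF h(2)]] y by blast
  have I: "sing (X \<inter> Y)" by (rule singular_Int_singular[OF h(1,2)])
  have "rk (X \<inter> Y) < rk Y" using rk_strict[OF I h(2)] y by blast
  then have "Y = gen (insert y (X \<inter> Y))"
    using hyperplane_extend[OF h(2) I _ _ y(1)] r h y by simp
  also have "\<dots> \<subseteq> gen (insert y X)" by (rule gen_mono) blast
  finally show ?thesis
    unfolding nb_def using h extend_singular[OF h(1) yX] rk_extend[OF h(1) yX y(2)] extend_superset by blast
qed

lemma near_refl: "near r d X X"
  unfolding near_def by (rule exI[of _ 0]) simp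

lemma near_mono: "\<lbrakk>near r d X Y; d \<le> e\<rbrakk> \<Longrightarrow> near r e X Y"
  unfolding near_def using order_trans by blast

lemma edges_sym: "sym (edges r)"
  by (auto simp: edges_def sym_def nb_sym) (simp_all add: nb_def)

lemma sym_relpow: "sym R \<Longrightarrow> (x, y) \<in> R ^^ m \<Longrightarrow> (y, x) \<in> R ^^ m"
proof (induction m arbitrary: y)
  case (Suc m)
  then show ?case by (meson relpow_Suc_E relpow_Suc_I2 symD)
qed simp

lemma near_sym: "near r d X Y \<Longrightarrow> near r d Y X"
  unfolding near_def using sym_relpow[OF edges_sym] by blast

lemma near_step:
  assumes "near r d X Y" "nb Y Z" "rk Y = r"
  shows "near r (Suc d) X Z"
proof -
  obtain m where m: "m \<le> d" "(X, Y) \<in> edges r ^^ m" using assms(1) by (auto simp: near_def)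
  have "(X, Z) \<in> edges r ^^ Suc m" using m(2) assms(2,3) by (auto simp: edges_def intro: relpow_Suc_I)
  then show ?thesis using m(1) unfolding near_def by (intro exI[of _ "Suc m"]) simp
qed

lemma near_one: "near r 1 X Y \<longleftrightarrow> X = Y \<or> nb X Y \<and> rk X = r"
proof -
  have "(\<exists>m\<le>1. P m) \<longleftrightarrow> P 0 \<or> P 1" for P :: "nat \<Rightarrow> bool" by (metis le_Suc_eq le_zero_eq One_nat_def zero_le)
  then show ?thesis by (simp add: near_def edges_def)
qed

text \<open>Adjacent vertices share a hyperplane, so each edge of the walk lowers the rank of the
  intersection with its start by at most one.\<close>

lemma relpow_edges_rk_Int:
  "\<lbrakk>(X, Y) \<in> edges r ^^ e; X \<in> grass r\<rbrakk> \<Longrightarrow> r \<le> rk (X \<inter> Y) + e"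
proof (induction e arbitrary: Y)
  case 0
  then show ?case by (simp add: grass_def)
next
  case (Suc e)
  from Suc.prems(1) obtain Z where Z: "(X, Z) \<in> edges r ^^ e" "(Z, Y) \<in> edges r" by auto
  have nb: "nb Z Y" using Z by (simp add: edges_def)
  have sX: "sing X" and sZ: "sing Z" and sY: "sing Y"
    using Suc.prems(2) nb by (auto simp: nb_def grass_def)
  have "rk (X \<inter> Z) \<le> Suc (rk ((Z \<inter> Y) \<inter> (X \<inter> Z)))"
    by (rule rk_Int_hyperplane[OF sZ])
      (use nb_rk_Int[OF nb] sX sY sZ singular_Int_singular in auto)
  also have "\<dots> \<le> Suc (rk (X \<inter> Y))"
    using rk_mono[of "(Z \<inter> Y) \<inter> (X \<inter> Z)" "X \<inter> Y"] sX sY sZ singular_Int_singular by (simp add: le_infI1 le_infI2)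
  finally show ?case using Suc.IH[OF Z(1) Suc.prems(2)] by simp
qed

text \<open>The last vertex before \<open>Y\<close> on a path is orthogonal to \<open>Y\<close>, so it can share only \<open>D\<close> with \<open>X\<close>.\<close>

lemma near_lower_bound:
  assumes "near r d X Y" "X \<in> grass r" "sing D" "X \<inter> perp Y \<subseteq> D" "rk D < r"
  shows "Suc r \<le> rk D + d"
proof -
  obtain e where e: "e \<le> d" "(X, Y) \<in> edges r ^^ e" using assms(1) by (auto simp: near_def)
  have sX: "sing X" using assms(2) by (simp add: grass_def)
  show ?thesis
  proof (cases e)
    case 0
    then have "X \<subseteq> D" using e assms(4) sX by (auto simp: singular_iff)
    then show ?thesis using rk_mono[OF sX assms(3)] assms(2,5) by (simp add: grass_def)
  next
    case (Suc e')
    then obtain Z where Z: "(X, Z) \<in> edges r ^^ e'" "(Z, Y) \<in> edges r" using e by auto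
    have "nb Z Y" using Z by (simp add: edges_def)
    then have "X \<inter> Z \<subseteq> D" and sZ: "sing Z" using nb_perp assms(4) by (auto simp: nb_def)
    then have "rk (X \<inter> Z) \<le> rk D" using rk_mono[OF singular_Int_singular[OF sX sZ] assms(3)] by simp
    then show ?thesis using relpow_edges_rk_Int[OF Z(1) assms(2)] Suc e(1) by simp
  qed
qed

text \<open>\<open>S\<close> is a hyperplane of \<open>gen (insert x S)\<close> and is orthogonal to
  \<open>p\<close>, while the whole is not; so \<open>S\<close> is exactly the part orthogonal to
  \<open>p\<close>.\<close>

lemma extend_Int_perp:
  assumes S: "sing S" and x: "x \<in> perp S" and p: "p \<in> perp S" "\<not> orth x p"
    and t: "t \<in> gen (insert x S)" "orth t p"
  shows "t \<in> S"
proof -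
  define T where "T = gen (insert x S) \<inter> perp {p}"
  have sT: "sing T" unfolding T_def by (rule singular_Int[OF extend_singular[OF S x] perp_subspace])
  have xS: "x \<notin> S" using p perp_orth orth_sym by blast
  have "S \<subseteq> T"
    using p(1) orth_sym extend_superset[of S x] by (auto simp: T_def in_perp_singleton perp_def[of S])
  moreover have "T \<subset> gen (insert x S)"
    using p(2) extend_mem[of x S] by (auto simp: T_def in_perp_singleton)
  then have "rk T \<le> rk S" using rk_strict[OF sT extend_singular[OF S x]] rk_extend[OF S x xS] by simp
  ultimately have "S = T" using eq_of_rk[OF S sT] by blast
  moreover have "t \<in> T" using t by (simp add: T_def in_perp_singleton)
  ultimately show ?thesis by simp
qed

subsection \<open>Triangles\<close>

text \<open>The covering relation: for fixed \<open>A\<close>, these \<open>X\<close> are the points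
  of the residue of \<open>A\<close>.\<close>

definition over :: "'a set \<Rightarrow> 'a set \<Rightarrow> bool" where
  "over A X \<longleftrightarrow> sing A \<and> sing X \<and> A \<subseteq> X \<and> rk X = Suc (rk A)"

lemma over_point:
  assumes "over A X"
  obtains x where "x \<in> X" "x \<notin> A" "x \<in> perp A" "X = gen (insert x A)"
proof -
  have h: "sing A" "sing X" "A \<subseteq> X" "rk X = Suc (rk A)" using assms by (auto simp: over_def)
  then have "\<not> X \<subseteq> A" using rk_mono[OF h(2,1)] by auto
  then obtain x where x: "x \<in> X" "x \<notin> A" by blast
  show ?thesis
    using that[OF x] singular_in_perp[OF h(2,3) x(1)] hyperplane_extend[OF h(2,1,3,4) x] by blast
qed

lemma over_extend: "\<lbrakk>sing A; x \<in> perp A; x \<notin> A\<rbrakk> \<Longrightarrow> over A (gen (insert x A))"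
  by (simp add: over_def extend_singular rk_extend extend_superset)

lemma over_Int:
  assumes "over A X" "over A Y" "X \<noteq> Y"
  shows "X \<inter> Y = A"
proof -
  have h: "sing A" "sing X" "A \<subseteq> X" "rk X = Suc (rk A)" "sing Y" "A \<subseteq> Y" "rk Y = Suc (rk A)"
    using assms by (auto simp: over_def)
  have I: "sing (X \<inter> Y)" by (rule singular_Int_singular[OF h(2,5)])
  have "X \<inter> Y \<noteq> X" using eq_of_rk[OF h(2,5)] h assms(3) by auto
  then have "rk (X \<inter> Y) < rk X" using rk_strict[OF I h(2)] by blast
  then show ?thesis using eq_of_rk[OF h(1) I] h by simp
qed

lemma over_nb:
  assumes "over A X" "over A Y" "X \<noteq> Y" "X \<subseteq> perp Y"
  shows "nb X Y"
  by (rule nbI) (use assms over_Int[OF assms(1-3)] in \<open>auto simp: over_def\<close>)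

lemma nbD: "nb X Y \<Longrightarrow> sing X" "nb X Y \<Longrightarrow> sing Y" "nb X Y \<Longrightarrow> rk X = rk Y" "nb X Y \<Longrightarrow> X \<noteq> Y"
  by (simp_all add: nb_def)

lemma nb_over: "nb X Y \<Longrightarrow> over (X \<inter> Y) X"
  unfolding over_def using nb_rk_Int[of X Y] singular_Int_singular[OF nbD(1,2)] nbD(1) by blast

lemma nb_over': "nb X Y \<Longrightarrow> over (X \<inter> Y) Y"
  using nb_over[OF nb_sym] by (simp add: Int_commute)

lemma over_perp_subset:
  assumes "sing A" "z \<in> perp A" "z \<in> perp Y" "A \<subseteq> Y" "sing Y"
  shows "gen (insert z A) \<subseteq> perp Y"
  by (rule gen_minimal[OF perp_subspace]) (use assms in \<open>auto simp: singular_iff\<close>)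

text \<open>As the hyperplanes \<open>Z \<inter> X\<close> and \<open>X \<inter> Y\<close> of
  \<open>X\<close> differ, \<open>Z \<inter> Y\<close> has a point outside \<open>X\<close>, and
  together with \<open>Z \<inter> X\<close> it generates \<open>Z\<close>.\<close>

lemma nb_in_hyperplane:
  assumes U: "sing U" "X \<subseteq> U" "Y \<subseteq> U" and nb: "nb X Y" "nb Z X" "nb Z Y" and ne: "Z \<inter> X \<noteq> X \<inter> Y"
  shows "Z \<subseteq> U"
proof -
  have s: "sing X" "sing Y" "sing Z" "rk Z = rk X" "rk Y = rk X"
    using nbD[OF nb(1)] nbD[OF nb(2)] by auto
  note I = singular_Int_singular
  have r: "rk (X \<inter> Y) = rk (Z \<inter> Y)" "rk (Z \<inter> X) = rk (X \<inter> Y)"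
    using nb_rk_Int[OF nb(1)] nb_rk_Int[OF nb(2)] nb_rk_Int[OF nb(3)] s by auto
  have "\<not> Z \<inter> Y \<subseteq> X"
  proof
    assume "Z \<inter> Y \<subseteq> X"
    then have "Z \<inter> Y \<subseteq> X \<inter> Y" by blast
    then have "Z \<inter> Y = X \<inter> Y" by (rule eq_of_rk[OF I[OF s(3,2)] I[OF s(1,2)]]) (use r in linarith)
    then have "X \<inter> Y \<subseteq> Z \<inter> X" by blast
    then have "X \<inter> Y = Z \<inter> X" by (rule eq_of_rk[OF I[OF s(1,2)] I[OF s(3,1)]]) (use r in linarith)
    then show False using ne by simp
  qed
  then obtain y where y: "y \<in> Z" "y \<in> Y" "y \<notin> X" by blast
  have "Z = gen (insert y (Z \<inter> X))"
    by (rule hyperplane_extend[OF s(3) I[OF s(3,1)] _ nb_rk_Int[OF nb(2)]]) (use y in auto)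
  also have "\<dots> \<subseteq> U" by (rule gen_least_singular[OF U(1)]) (use U y in blast)
  finally show ?thesis .
qed

text \<open>Otherwise all common neighbours of the triangle would lie in its span \<open>U\<close>, in which they are
  hyperplanes, hence pairwise adjacent.\<close>

lemma star_triangle:
  assumes nb: "nb X Y" "nb X Z" "nb Y Z"
    and P: "nb P X" "nb P Y" "nb P Z" and Q: "nb Q X" "nb Q Y" "nb Q Z"
    and PQ: "P \<noteq> Q" "\<not> nb P Q"
  shows "X \<inter> Y = X \<inter> Z"
proof (rule ccontr)
  assume ne: "X \<inter> Y \<noteq> X \<inter> Z"
  obtain U where U: "sing U" "rk U = Suc (rk X)" "X \<subseteq> U" "Y \<subseteq> U"
    using nb(1) unfolding nb_def by blast
  have Z: "Z \<subseteq> U"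
    by (rule nb_in_hyperplane[OF U(1,3,4) nb(1) nb_sym[OF nb(2)] nb_sym[OF nb(3)]]) (use ne in blast)
  have in_U: "R \<subseteq> U" if R: "nb R X" "nb R Y" "nb R Z" for R
  proof (cases "R \<inter> X = X \<inter> Y")
    case True
    then show ?thesis using nb_in_hyperplane[OF U(1,3) Z nb(2) R(1,3)] ne by simp
  next
    case False
    then show ?thesis by (rule nb_in_hyperplane[OF U(1,3,4) nb(1) R(1,2)])
  qed
  have "nb P Q"
    unfolding nb_def using in_U[OF P] in_U[OF Q] U nbD[OF P(1)] nbD[OF Q(1)] PQ(1) by auto
  then show False using PQ by simp
qed

section \<open>Points as subspaces, and agreement with the given Grassmann graphs\<close>

lemma singleton_singular: "p \<in> points \<Pi> \<Longrightarrow> sing {p}"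
  by (simp add: singular_subspace_def subspace_def)

lemma singleton_grass: "p \<in> points \<Pi> \<Longrightarrow> {p} \<in> grass 1"
  using rk_extend[OF empty_singular, of p] gen_subspace_eq[OF singular_sub[OF singleton_singular[of p]]]
  by (simp add: grass_def singleton_singular rk_empty perp_def)

lemma grass_1_singleton:
  assumes "X \<in> grass 1"
  obtains p where "p \<in> points \<Pi>" "X = {p}"
proof -
  have s: "sing X" "rk X = 1" using assms by (auto simp: grass_def)
  then obtain p where p: "p \<in> X" using rk_0_iff[of X] by auto
  have pp: "p \<in> points \<Pi>" using p singular_points[OF s(1)] by blast
  have "{p} = X"
    by (rule eq_of_rk[OF singleton_singular[OF pp] s(1)]) (use singleton_grass[OF pp] s p in \<open>auto simp: grass_def\<close>)
  then show ?thesis using that pp by blast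
qed

lemma nb_singletons: "\<lbrakk>orth p q; p \<noteq> q\<rbrakk> \<Longrightarrow> nb {p} {q}"
  using singleton_grass[of p] singleton_grass[of q] orth_points[of p q]
  by (intro nbI) (auto simp: grass_def in_perp_singleton)

lemma grassmannian_grass: "0 \<le> k + 1 \<Longrightarrow> grassmannian \<Pi> k = grass (nat (k + 1))"
  by (auto simp: grassmannian_def grass_def pdim_rk)

lemma grassmann_edges_edges:
  assumes "0 \<le> k + 1" "k \<noteq> n - 1"
  shows "grassmann_edges \<Pi> n k = edges (nat (k + 1))"
proof -
  have s: "nat (k + 1 + 1) = Suc (nat (k + 1))" using assms(1) by simp
  have "grassmannian \<Pi> (k + 1) = grass (Suc (nat (k + 1)))"
    using grassmannian_grass[of "k + 1"] assms(1) s by simp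
  then show ?thesis
    using assms(2) unfolding grassmann_edges_def edges_def grassmannian_grass[OF assms(1)]
    by (auto simp: nb_def grass_def)
qed

end

locale ranked_weak_polar_space = weak_polar_space +
  fixes N :: nat
  assumes rank_maximal: "maximal_singular_subspace \<Pi> M \<Longrightarrow> rk M = N"
begin

lemma below_maximal:
  assumes "sing S"
  obtains M where "maximal_singular_subspace \<Pi> M" "S \<subseteq> M"
proof -
  have "\<exists>M\<in>{T. sing T \<and> S \<subseteq> T}. \<forall>X\<in>{T. sing T \<and> S \<subseteq> T}. M \<subseteq> X \<longrightarrow> X = M"
  proof (rule subset_Zorn)
    fix C assume C: "subset.chain {T. sing T \<and> S \<subseteq> T} C"
    then have "subset.chain {T. sing T} C" by (auto simp: subset.chain_def)
    then have fin: "finite C" by (rule finite_chain)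
    show "\<exists>U\<in>{T. sing T \<and> S \<subseteq> T}. \<forall>X\<in>C. X \<subseteq> U"
    proof (cases "C = {}")
      case True
      then show ?thesis using assms by blast
    next
      case False
      then have "\<Union>C \<in> C" using Union_in_chain[OF fin _ C] by blast
      then show ?thesis using C by (intro bexI[of _ "\<Union>C"]) (auto simp: subset.chain_def)
    qed
  qed
  then obtain M where M: "sing M" "S \<subseteq> M" "\<And>X. \<lbrakk>sing X; S \<subseteq> X; M \<subseteq> X\<rbrakk> \<Longrightarrow> X = M" by auto
  then have "maximal_singular_subspace \<Pi> M" by (auto simp: maximal_singular_subspace_def)
  then show ?thesis using that M(2) by blast
qed

lemma rk_le_rank: "sing S \<Longrightarrow> rk S \<le> N"
  by (metis below_maximal maximal_singular_subspace_def rank_maximal rk_mono)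

lemma point_outside:
  assumes "sing S" "rk S < N"
  obtains z where "z \<in> perp S" "z \<notin> S"
proof -
  obtain M where M: "maximal_singular_subspace \<Pi> M" "S \<subseteq> M" using below_maximal[OF assms(1)] .
  then have "S \<noteq> M" using rank_maximal assms(2) by blast
  then obtain z where z: "z \<in> M" "z \<notin> S" using M by blast
  have "sing M" using M by (simp add: maximal_singular_subspace_def)
  then show ?thesis using that singular_in_perp[OF _ M(2) z(1)] z by blast
qed

lemma nonorthogonal_pair:
  assumes "sing S" "rk S < N"
  obtains z w where "z \<in> perp S" "w \<in> perp S" "\<not> orth z w"
proof -
  obtain z where z: "z \<in> perp S" "z \<notin> S" using point_outside[OF assms] .
  then have "z \<in> points \<Pi>" using perp_points by blast
  then obtain w where "w \<in> perp S" "\<not> orth w z" using separate_point[OF assms(1)] z by metis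
  then show ?thesis using that z orth_sym by metis
qed

text \<open>The residue of \<open>S\<close> has rank at least two, so some \<open>t\<close> enlarges
  the span of \<open>y\<close> and \<open>S\<close>, and the line \<open>y t\<close> meets the perp
  of \<open>y'\<close>. Since \<open>t\<close> is outside that span, the meeting point is outside
  \<open>S\<close>.\<close>

lemma common_neighbour:
  assumes S: "sing S" "Suc (Suc (rk S)) \<le> N" and y: "y \<in> perp S" "y' \<in> perp S" "\<not> orth y y'"
  obtains z where "z \<in> perp S" "z \<notin> S" "orth z y" "orth z y'"
proof -
  have yS: "y \<notin> S" using y perp_orth orth_sym by blast
  have y'p: "y' \<in> points \<Pi>" using y perp_points by blast
  have G: "sing (gen (insert y S))" "rk (gen (insert y S)) < N"
    using extend_singular[OF S(1) y(1)] rk_extend[OF S(1) y(1) yS] S(2) by auto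
  obtain t where t: "t \<in> perp (gen (insert y S))" "t \<notin> gen (insert y S)" using point_outside[OF G] .
  have ty: "orth t y" "t \<in> perp S" using t(1) in_perp_extend[OF S(1) y(1)] by auto
  have neq: "t \<noteq> y" using t(2) extend_mem by blast
  obtain z where z: "z \<in> join y t" "orth y' z" using join_meets_perp[OF y'p orth_sym[OF ty(1)]] neq by metis
  have zS: "z \<in> perp S" using subspace_join[OF perp_subspace y(1) ty(2)] neq orth_sym[OF ty(1)] z by simp
  have zy: "orth z y" using join_orth[OF orth_sym[OF ty(1)]] join_ends[OF orth_sym[OF ty(1)]] neq z by metis
  have zney: "z \<noteq> y" using z y orth_sym by blast
  have "z \<notin> S"
  proof
    assume "z \<in> S"
    then have zG: "z \<in> gen (insert y S)" using extend_superset by blast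
    have "t \<in> join y z" using join_exchange[OF orth_sym[OF ty(1)] _ z(1) zney] neq by simp
    then have "t \<in> gen (insert y S)"
      using subspace_join[OF singular_sub[OF G(1)] extend_mem zG _ orth_sym[OF zy]] zney by metis
    then show False using t by blast
  qed
  then show ?thesis using that[OF zS _ zy] z orth_sym by blast
qed

subsection \<open>Diameter bounds\<close>

text \<open>\<open>d\<close> is the corank of \<open>T\<close>, which need not be all of
  \<open>X \<inter> Y\<close>. The two bounds are proved together: the sharper one, for
  \<open>X\<close> with a point outside \<open>T\<close> orthogonal to \<open>Y\<close>, uses both
  bounds for smaller \<open>d\<close>, and the general one moves \<open>X\<close> by one edge into
  that position. Everything is quantified because \<open>X\<close> and \<open>Y\<close> exchange
  roles and \<open>T\<close> grows.\<close>

lemma near_upper_bound: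
  assumes r: "r < N"
  shows "\<forall>X Y T. X \<in> grass r \<longrightarrow> Y \<in> grass r \<longrightarrow> sing T \<longrightarrow> T \<subseteq> X \<inter> Y \<longrightarrow> r = rk T + d \<longrightarrow>
     near r (Suc d) X Y \<and> (\<forall>w\<in>X. w \<notin> T \<longrightarrow> w \<in> perp Y \<longrightarrow> near r d X Y)"
proof (induction d)
  case 0
  show ?case
  proof (intro allI impI)
    fix X Y T
    assume h: "X \<in> grass r" "Y \<in> grass r" "sing T" "T \<subseteq> X \<inter> Y" "r = rk T + 0"
    have "T = X" by (rule eq_of_rk) (use h in \<open>auto simp: grass_def\<close>)
    moreover have "T = Y" by (rule eq_of_rk) (use h in \<open>auto simp: grass_def\<close>)
    ultimately show "near r (Suc 0) X Y \<and> (\<forall>w\<in>X. w \<notin> T \<longrightarrow> w \<in> perp Y \<longrightarrow> near r 0 X Y)"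
      using near_refl by simp
  qed
next
  case (Suc d)
  have close: "near r (Suc d) X Y"
    if h: "X \<in> grass r" "Y \<in> grass r" "sing T" "T \<subseteq> X \<inter> Y" "r = rk T + Suc d"
      and w: "w \<in> X" "w \<notin> T" "w \<in> perp Y" for X Y T w
  proof -
    have sX: "sing X" and rX: "rk X = r" and sY: "sing Y" and rY: "rk Y = r"
      using h by (auto simp: grass_def)
    have wT: "w \<in> perp T" by (rule singular_in_perp[OF sX _ w(1)]) (use h in blast)
    define T1 where "T1 = gen (insert w T)"
    have T1: "sing T1" "rk T1 = Suc (rk T)" "T \<subseteq> T1" "w \<in> T1"
      unfolding T1_def using extend_singular[OF h(3) wT] rk_extend[OF h(3) wT w(2)] extend_superset extend_mem by auto
    have T1X: "T1 \<subseteq> X" unfolding T1_def by (rule gen_least_singular[OF sX]) (use w h in blast)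
    show ?thesis
    proof (cases "X \<inter> Y = T")
      case False
      then obtain v where v: "v \<in> X" "v \<in> Y" "v \<notin> T" using h(4) by blast
      have vT: "v \<in> perp T" by (rule singular_in_perp[OF sX _ v(1)]) (use h in blast)
      have "gen (insert v T) \<subseteq> X \<inter> Y"
        by (rule gen_least_singular[OF singular_Int_singular[OF sX sY]]) (use v h in blast)
      then show ?thesis
        using Suc.IH h extend_singular[OF h(3) vT] rk_extend[OF h(3) vT v(3)] by simp
    next
      case XY: True
      then have wY: "w \<notin> Y" using w by blast
      show ?thesis
      proof (cases d)
        case 0
        have "X = gen (insert w T)"
          by (rule hyperplane_extend[OF sX h(3)]) (use h w 0 rX in auto)
        moreover have "insert w T \<subseteq> perp Y"
          using w singular_in_perp[OF sY] h(4) sY unfolding singular_iff by blast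
        ultimately have "X \<subseteq> perp Y" using gen_minimal[OF perp_subspace] by blast
        then have "nb X Y" by (intro nbI) (use sX sY rX rY w wY XY h(5) 0 in auto)
        then show ?thesis using near_one rX 0 by simp
      next
        case (Suc e)
        have "T1 \<subseteq> perp Y" unfolding T1_def
          by (rule gen_minimal[OF perp_subspace]) (use w h(4) sY in \<open>auto simp: singular_iff\<close>)
        \<comment> \<open>\<open>T1\<close> has one rank more than \<open>T\<close>, so the count
          leaves a point \<open>y\<close> of \<open>Y\<close> outside \<open>T\<close> orthogonal to
          \<open>X\<close>: the condition of the sharper bound also holds from the side of
          \<open>Y\<close>.\<close>
        then have "rk Y + rk T1 \<le> rk (Y \<inter> perp X) + rk X"
          using rk_perp_codim[OF T1(1) sX T1X sY] by blast
        then have "rk T < rk (Y \<inter> perp X)" using rX rY T1 by simp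
        then have "\<not> Y \<inter> perp X \<subseteq> T"
          using rk_mono[OF singular_Int[OF sY perp_subspace] h(3)] by force
        then obtain y where y: "y \<in> Y" "y \<in> perp X" "y \<notin> T" by blast
        have yT: "y \<in> perp T" by (rule singular_in_perp[OF sY _ y(1)]) (use h in blast)
        have Ty: "gen (insert y T) \<subseteq> Y" by (rule gen_least_singular[OF sY]) (use y h in blast)
        obtain H where H: "sing H" "gen (insert y T) \<subseteq> H" "H \<subseteq> Y" "rk H = r - 1"
          using rk_between[OF extend_singular[OF h(3) yT] sY Ty, of "r - 1"]
            rk_extend[OF h(3) yT y(3)] h(5) Suc rY by auto
        have wH: "w \<in> perp H" using w(3) perp_antimono[OF H(3)] by blast
        have wnH: "w \<notin> H" using H wY by blast
        \<comment> \<open>\<open>Y1\<close> keeps the hyperplane \<open>H\<close> of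
          \<open>Y\<close> and takes \<open>w\<close> instead of the rest. It is adjacent to
          \<open>Y\<close>, contains \<open>T1\<close>, and still has the point \<open>y\<close>
          outside \<open>T1\<close> orthogonal to \<open>X\<close>.\<close>
        define Y1 where "Y1 = gen (insert w H)"
        have Y1: "sing Y1" "rk Y1 = r" unfolding Y1_def
          using extend_singular[OF H(1) wH] rk_extend[OF H(1) wH wnH] H(4) h(5) by auto
        have "Y1 \<subseteq> gen (insert w Y)" unfolding Y1_def by (rule gen_mono) (use H in blast)
        moreover have "w \<in> Y1" unfolding Y1_def by (rule extend_mem)
        ultimately have "nb Y1 Y" unfolding nb_def
          using Y1 sY rY extend_singular[OF sY w(3)] rk_extend[OF sY w(3) wY] extend_superset[of Y w] wY by metis
        have HY1: "H \<subseteq> Y1" unfolding Y1_def by (rule extend_superset)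
        have yY1: "y \<in> Y1" and TY1: "T \<subseteq> Y1"
          using HY1 H(2) extend_mem[of y T] extend_superset[of T y] by blast+
        have "T1 \<subseteq> Y1" unfolding T1_def
          by (rule gen_least_singular[OF Y1(1)]) (use TY1 \<open>w \<in> Y1\<close> in blast)
        moreover have "y \<notin> T1" using T1X y XY by blast
        ultimately have "near r d Y1 X"
          using Suc.IH[rule_format, of Y1 X T1] yY1 y(2) Y1 T1 T1X h(1,5) by (simp add: grass_def)
        then show ?thesis using near_step[OF near_sym \<open>nb Y1 Y\<close>] Y1 by blast
      qed
    qed
  qed
  have far: "near r (Suc (Suc d)) X Y"
    if h: "X \<in> grass r" "Y \<in> grass r" "sing T" "T \<subseteq> X \<inter> Y" "r = rk T + Suc d" for X Y T
  proof -
    have sX: "sing X" and rX: "rk X = r" and sY: "sing Y" and rY: "rk Y = r"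
      using h by (auto simp: grass_def)
    obtain z where z: "z \<in> perp X" "z \<notin> X" using point_outside[OF sX] rX r by blast
    \<comment> \<open>One extra rank above \<open>X\<close> makes the count positive:
      \<open>W\<close> has a point \<open>w\<close> outside \<open>T\<close> orthogonal to
      \<open>Y\<close>, and a vertex of \<open>W\<close> through \<open>T\<close> and
      \<open>w\<close> is \<open>X\<close> or adjacent to it.\<close>
    define W where "W = gen (insert z X)"
    have W: "sing W" "rk W = Suc r" "X \<subseteq> W" unfolding W_def
      using extend_singular[OF sX z(1)] rk_extend[OF sX z] rX extend_superset by auto
    have "T \<subseteq> perp W" using h(4) W singular_iff by blast
    then have "rk W + rk T \<le> rk (W \<inter> perp Y) + rk Y"
      using rk_perp_codim[OF h(3) sY _ W(1)] h(4) by blast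
    then have "rk T < rk (W \<inter> perp Y)" using W rY by simp
    then have "\<not> W \<inter> perp Y \<subseteq> T"
      using rk_mono[OF singular_Int[OF W(1) perp_subspace] h(3)] by force
    then obtain w where w: "w \<in> W" "w \<in> perp Y" "w \<notin> T" by blast
    have TW: "T \<subseteq> W" using h(4) W by blast
    have wT: "w \<in> perp T" by (rule singular_in_perp[OF W(1) TW w(1)])
    have Tw: "gen (insert w T) \<subseteq> W" by (rule gen_least_singular[OF W(1)]) (use w TW in blast)
    obtain X1 where X1: "sing X1" "gen (insert w T) \<subseteq> X1" "X1 \<subseteq> W" "rk X1 = r"
      using rk_between[OF extend_singular[OF h(3) wT] W(1) Tw, of r] rk_extend[OF h(3) wT w(3)] h(5) W(2)
      by auto
    have wX1: "w \<in> X1" "T \<subseteq> X1" using X1(2) extend_mem[of w T] extend_superset[of T w] by blast+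
    have n: "near r (Suc d) X1 Y"
      by (rule close[of X1 Y T w]) (use X1 wX1 h w in \<open>auto simp: grass_def\<close>)
    show ?thesis
    proof (cases "X1 = X")
      case True
      then show ?thesis using n near_mono by simp
    next
      case False
      then have "nb X1 X" unfolding nb_def using X1 W sX rX by auto
      then show ?thesis using near_step[OF near_sym[OF n]] X1(4) near_sym by blast
    qed
  qed
  show ?case using close far by blast
qed

lemma near_above:
  assumes "r < N" "X \<in> grass r" "Y \<in> grass r" "sing T" "T \<subseteq> X" "T \<subseteq> Y"
  shows "near r (Suc (r - rk T)) X Y"
proof -
  have "rk T \<le> r" using rk_mono[OF assms(4) _ assms(5)] assms(2) by (auto simp: grass_def)
  then show ?thesis using near_upper_bound[OF assms(1), of "r - rk T"] assms by simp
qed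

subsection \<open>Opposite subspaces\<close>

text \<open>To each of \<open>B1\<close>, \<open>B2\<close> a point of its perp is added that is not
  orthogonal to all of the other. A point of one extension orthogonal to the other extension is then
  forced down twice by \<open>extend_Int_perp\<close>, for instance from the extension to
  \<open>B1\<close> and from \<open>B1\<close> to \<open>B1 \<inter> B2\<close>.\<close>

lemma opposite_start:
  assumes nb: "nb B1 B2"
  shows "\<exists>X Y. X \<in> grass (Suc (rk B1)) \<and> Y \<in> grass (Suc (rk B1)) \<and> B1 \<subseteq> X \<and> B2 \<subseteq> Y \<and>
    X \<inter> perp Y \<subseteq> B1 \<inter> B2 \<and> Y \<inter> perp X \<subseteq> B1 \<inter> B2"
proof -
  have half: "\<exists>x. x \<in> perp B \<and> x \<notin> B \<and> \<not> C \<subseteq> perp {x}" if "nb B C" for B C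
  proof -
    have BC: "sing B" "sing C" "rk B = rk C" "B \<noteq> C" using that by (auto simp: nb_def)
    then have "\<not> C \<subseteq> B" using eq_of_rk[of C B] by auto
    then obtain c where c: "c \<in> C" "c \<notin> B" by blast
    have cB: "c \<in> perp B" using nb_perp[OF nb_sym[OF that]] c by blast
    obtain x where x: "x \<in> perp B" "\<not> orth x c"
      using separate_point[OF BC(1) _ c(2)] cB perp_points by blast
    have "x \<notin> B" using x(2) perp_orth[OF cB] orth_sym by blast
    moreover have "c \<notin> perp {x}" using x(2) orth_sym[of c x] by (auto simp: in_perp_singleton)
    ultimately show ?thesis using x c by blast
  qed
  have meet: "gen (insert x B) \<inter> perp (gen (insert y C)) \<subseteq> B \<inter> C"
    if "nb B C" and x: "x \<in> perp B" "\<not> C \<subseteq> perp {x}" and y: "y \<in> perp C" "\<not> B \<subseteq> perp {y}" for B C x y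
  proof
    fix t assume t: "t \<in> gen (insert x B) \<inter> perp (gen (insert y C))"
    have BC: "sing B" "sing C" "rk B = rk C" using that by (auto simp: nb_def)
    have tC: "orth t y" "t \<in> perp C" using t in_perp_extend[OF BC(2) y(1)] by auto
    have "\<exists>c\<in>C. \<not> orth x c" using x(2) orth_sym in_perp_singleton by (meson subsetI)
    then obtain c where c: "c \<in> C" "\<not> orth x c" by blast
    have tB: "t \<in> B"
      by (rule extend_Int_perp[OF BC(1) x(1) _ c(2)])
        (use t tC c perp_orth nb_perp[OF nb_sym[OF that(1)]] in auto)
    have "\<exists>b\<in>B. \<not> orth b y" using y(2) in_perp_singleton by (meson subsetI)
    then obtain b where b: "b \<in> B" "\<not> orth b y" by blast
    have bC: "b \<notin> C" using b y(1) perp_orth orth_sym by blast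
    have sI: "sing (B \<inter> C)" by (rule singular_Int_singular[OF BC(1,2)])
    have B: "B = gen (insert b (B \<inter> C))"
      by (rule hyperplane_extend[OF BC(1) sI _ nb_rk_Int[OF that(1)] b(1)]) (use bC in auto)
    show "t \<in> B \<inter> C"
    proof (rule extend_Int_perp[OF sI _ _ b(2) _ tC(1)])
      show "b \<in> perp (B \<inter> C)" by (rule singular_in_perp[OF BC(1) _ b(1)]) blast
      show "y \<in> perp (B \<inter> C)" using y(1) perp_antimono[of "B \<inter> C" C] by blast
    qed (use tB B in simp)
  qed
  obtain x where x: "x \<in> perp B1" "x \<notin> B1" "\<not> B2 \<subseteq> perp {x}" using half[OF nb] by blast
  obtain y where y: "y \<in> perp B2" "y \<notin> B2" "\<not> B1 \<subseteq> perp {y}" using half[OF nb_sym[OF nb]] by blast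
  have s: "sing B1" "sing B2" "rk B1 = rk B2" using nb by (auto simp: nb_def)
  show ?thesis
  proof (intro exI conjI)
    show "gen (insert x B1) \<in> grass (Suc (rk B1))"
      by (rule grassI[OF extend_singular[OF s(1) x(1)] rk_extend[OF s(1) x(1,2)]])
    show "gen (insert y B2) \<in> grass (Suc (rk B1))"
      using grassI[OF extend_singular[OF s(2) y(1)] rk_extend[OF s(2) y(1,2)]] s(3) by simp
    show "gen (insert x B1) \<inter> perp (gen (insert y B2)) \<subseteq> B1 \<inter> B2"
      by (rule meet[OF nb x(1,3) y(1,3)])
    show "gen (insert y B2) \<inter> perp (gen (insert x B1)) \<subseteq> B1 \<inter> B2"
      using meet[OF nb_sym[OF nb] y(1,3) x(1,3)] by blast
  qed (rule extend_superset)+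
qed

text \<open>The point \<open>z\<close> added to \<open>X\<close> is orthogonal to all of
  \<open>Y\<close>, as a rank count permits, and the point \<open>w\<close> added to
  \<open>Y\<close> is not orthogonal to \<open>z\<close>. Both inclusions are carried along because
  \<open>Y \<inter> perp X \<subseteq> D\<close> is what keeps \<open>z\<close> out of
  \<open>Y\<close>.\<close>

lemma opposite_step:
  assumes X: "X \<in> grass m" and Y: "Y \<in> grass m" and D: "sing D" "D \<subseteq> X" "D \<subseteq> Y"
    and op: "X \<inter> perp Y \<subseteq> D" "Y \<inter> perp X \<subseteq> D" and m: "m < N"
  shows "\<exists>X' Y'. X' \<in> grass (Suc m) \<and> Y' \<in> grass (Suc m) \<and> X \<subseteq> X' \<and> Y \<subseteq> Y' \<and>
    X' \<inter> perp Y' \<subseteq> D \<and> Y' \<inter> perp X' \<subseteq> D"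
proof -
  have sX: "sing X" and rX: "rk X = m" and sY: "sing Y" and rY: "rk Y = m"
    using X Y by (auto simp: grass_def)
  obtain z0 where z0: "z0 \<in> perp X" "z0 \<notin> X" using point_outside[OF sX] rX m by blast
  define W where "W = gen (insert z0 X)"
  have W: "sing W" "rk W = Suc m" "X \<subseteq> W" unfolding W_def
    using extend_singular[OF sX z0(1)] rk_extend[OF sX z0] rX extend_superset by auto
  have "D \<subseteq> perp W" using D(2) W singular_iff by blast
  then have "rk W + rk D \<le> rk (W \<inter> perp Y) + rk Y" using rk_perp_codim[OF D(1) sY D(3) W(1)] by blast
  then have "rk D < rk (W \<inter> perp Y)" using W rY by simp
  then have "\<not> W \<inter> perp Y \<subseteq> D" using rk_mono[OF singular_Int[OF W(1) perp_subspace] D(1)] by force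
  then obtain z where z: "z \<in> W" "z \<in> perp Y" "z \<notin> D" by blast
  have zX: "z \<notin> X" using z op by blast
  have zpX: "z \<in> perp X" by (rule singular_in_perp[OF W(1,3) z(1)])
  have zY: "z \<notin> Y" using z op zpX by blast
  obtain w where w: "w \<in> perp Y" "\<not> orth w z"
    using separate_point[OF sY _ zY] z perp_points by blast
  have wY: "w \<notin> Y" using w z perp_orth orth_sym by blast
  define X' Y' where "X' = gen (insert z X)" and "Y' = gen (insert w Y)"
  have X': "sing X'" "rk X' = Suc m" "X \<subseteq> X'" "z \<in> X'" unfolding X'_def
    using extend_singular[OF sX zpX] rk_extend[OF sX zpX zX] rX extend_superset extend_mem by auto
  have Y': "sing Y'" "rk Y' = Suc m" "Y \<subseteq> Y'" unfolding Y'_def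
    using extend_singular[OF sY w(1)] rk_extend[OF sY w(1) wY] rY extend_superset by auto
  have "t \<in> D" if t: "t \<in> X'" "t \<in> perp Y'" for t
  proof (rule ccontr)
    assume tD: "t \<notin> D"
    have tw: "orth t w" "t \<in> perp Y" using t in_perp_extend[OF sY w(1)] by (auto simp: Y'_def)
    have tX: "t \<notin> X" using tD op tw by blast
    have tz: "t \<noteq> z" using tw w orth_sym by blast
    have otz: "orth t z" using singular_orth[OF X'(1) t(1) X'(4)] .
    obtain p where p: "p \<in> perp X" "\<not> orth p z"
      using separate_point[OF sX _ zX] zpX perp_points by blast
    have pp: "p \<in> points \<Pi>" using p perp_points by blast
    \<comment> \<open>The line \<open>t z\<close> meets \<open>X\<close>, the part of
      \<open>X'\<close> orthogonal to \<open>p\<close>. The meeting point is orthogonal to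
      \<open>Y\<close>, so it lies in \<open>D\<close> and is orthogonal to \<open>w\<close>; with
      \<open>t\<close> this would make \<open>z\<close> orthogonal to \<open>w\<close>.\<close>
    obtain c where c: "c \<in> join t z" "orth p c" using join_meets_perp[OF pp otz tz] .
    have cX': "c \<in> X'" by (rule subspace_join[OF singular_sub[OF X'(1)] t(1) X'(4) tz otz c(1)])
    have cX: "c \<in> X"
      by (rule extend_Int_perp[OF sX zpX p(1)]) (use p c cX' orth_sym in \<open>auto simp: X'_def\<close>)
    have "c \<in> perp Y" by (rule subspace_join[OF perp_subspace tw(2) z(2) tz otz c(1)])
    then have "c \<in> D" using op cX by blast
    then have "orth w c" using w(1) D(3) perp_orth by blast
    moreover have "c \<noteq> t" using cX tX by blast
    ultimately have "orth w z" using orth_join'[OF orth_sym[OF tw(1)] _ otz tz c(1)] by simp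
    then show False using w by simp
  qed
  moreover have "t \<in> D" if t: "t \<in> Y'" "t \<in> perp X'" for t
  proof -
    have tz: "orth t z" "t \<in> perp X" using t in_perp_extend[OF sX zpX] by (auto simp: X'_def)
    have "t \<in> Y" by (rule extend_Int_perp[OF sY w(1) z(2) w(2)]) (use t tz in \<open>auto simp: Y'_def\<close>)
    then show ?thesis using op tz by blast
  qed
  ultimately show ?thesis using X' Y' unfolding grass_def by blast
qed

lemma opposite_above:
  assumes nb: "nb B1 B2" and r: "rk B1 < r" "r \<le> N"
  obtains X Y where "X \<in> grass r" "Y \<in> grass r" "B1 \<subseteq> X" "B2 \<subseteq> Y" "X \<inter> perp Y \<subseteq> B1 \<inter> B2"
proof -
  have sD: "sing (B1 \<inter> B2)" using nb singular_Int_singular by (simp add: nb_def)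
  have "\<exists>X Y. X \<in> grass r \<and> Y \<in> grass r \<and> B1 \<subseteq> X \<and> B2 \<subseteq> Y \<and>
    X \<inter> perp Y \<subseteq> B1 \<inter> B2 \<and> Y \<inter> perp X \<subseteq> B1 \<inter> B2"
    using Suc_leI[OF r(1)] r(2)
  proof (induction r rule: dec_induct)
    case base
    show ?case by (rule opposite_start[OF nb])
  next
    case (step m)
    then obtain X Y where XY: "X \<in> grass m" "Y \<in> grass m" "B1 \<subseteq> X" "B2 \<subseteq> Y"
      "X \<inter> perp Y \<subseteq> B1 \<inter> B2" "Y \<inter> perp X \<subseteq> B1 \<inter> B2" by auto
    have "m < N" using step by simp
    then show ?case using opposite_step[OF XY(1,2) sD _ _ XY(5,6)] XY(3,4) by (meson le_infI1 le_infI2 order_trans)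
  qed
  then show ?thesis using that by blast
qed

subsection \<open>Neighbours over a common subspace\<close>

text \<open>Covers the case \<open>k' = n' - 1\<close>, where adjacency is defined by intersections.\<close>

lemma maximal_common_neighbour:
  assumes g: "X \<in> grass N" "Y \<in> grass N" "Z \<in> grass N"
    and r: "N = Suc (rk (X \<inter> Y))" "N = Suc (rk (Z \<inter> X))" "N = Suc (rk (Z \<inter> Y))"
  shows "X \<inter> Y \<subseteq> Z"
proof (rule ccontr)
  assume n: "\<not> X \<inter> Y \<subseteq> Z"
  have s: "sing X" "sing Y" "sing Z" "rk X = N" using g by (auto simp: grass_def)
  note I = singular_Int_singular
  have "\<not> Z \<inter> Y \<subseteq> X"
  proof
    assume "Z \<inter> Y \<subseteq> X"
    then have "Z \<inter> Y \<subseteq> X \<inter> Y" by blast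
    then have "Z \<inter> Y = X \<inter> Y" by (rule eq_of_rk[OF I[OF s(3,2)] I[OF s(1,2)]]) (use r in linarith)
    then show False using n by blast
  qed
  then obtain y where y: "y \<in> Z" "y \<in> Y" "y \<notin> X" by blast
  have "\<not> Z \<inter> X \<subseteq> Y"
  proof
    assume "Z \<inter> X \<subseteq> Y"
    then have "Z \<inter> X \<subseteq> X \<inter> Y" by blast
    then have "Z \<inter> X = X \<inter> Y" by (rule eq_of_rk[OF I[OF s(3,1)] I[OF s(1,2)]]) (use r in linarith)
    then show False using n by blast
  qed
  then obtain x where x: "x \<in> Z" "x \<in> X" "x \<notin> Y" by blast
  have X: "X = gen (insert x (X \<inter> Y))"
    by (rule hyperplane_extend[OF s(1) I[OF s(1,2)]]) (use x r s in auto)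
  \<comment> \<open>\<open>y\<close> is orthogonal to \<open>X \<inter> Y\<close> within
    \<open>Y\<close> and to \<open>x\<close> within \<open>Z\<close>, hence to all of
    \<open>X\<close>. Adding it would give a singular subspace of rank \<open>N + 1\<close>.\<close>
  have "y \<in> perp (X \<inter> Y)" by (rule singular_in_perp[OF s(2) _ y(2)]) blast
  moreover have "orth y x" by (rule singular_orth[OF s(3) y(1) x(1)])
  moreover have "x \<in> perp (X \<inter> Y)" by (rule singular_in_perp[OF s(1) _ x(2)]) blast
  ultimately have yX: "y \<in> perp X" using in_perp_extend[OF I[OF s(1,2)], of x y] X by simp
  show False
    using rk_le_rank[OF extend_singular[OF s(1) yX]] rk_extend[OF s(1) yX y(3)] s(4) by simp
qed

text \<open>With \<open>S = A\<close> this gives connectedness of the residue of \<open>A\<close>.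
  With \<open>S\<close> a subspace \<open>X\<close> over \<open>A\<close>, the connecting
  \<open>Z\<close> is in addition a neighbour of \<open>X\<close>.\<close>

lemma over_connect:
  assumes S: "sing S" "A \<subseteq> S" "Suc (Suc (rk S)) \<le> N"
    and Y: "over A Y" "Y \<subseteq> perp S" and Y': "over A Y'" "Y' \<subseteq> perp S"
    and n: "Y \<noteq> Y'" "\<not> nb Y Y'"
  obtains Z where "over A Z" "nb Z Y" "nb Z Y'" "Z \<subseteq> perp S" "\<not> Z \<subseteq> S"
proof -
  have s: "sing A" "sing Y" "sing Y'" "A \<subseteq> Y" "A \<subseteq> Y'" using Y Y' by (auto simp: over_def)
  obtain y where y: "y \<in> Y" "y \<notin> A" "y \<in> perp A" "Y = gen (insert y A)" using over_point[OF Y(1)] .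
  obtain y' where y': "y' \<in> Y'" "y' \<notin> A" "y' \<in> perp A" "Y' = gen (insert y' A)" using over_point[OF Y'(1)] .
  have inY: "t \<in> perp Y \<longleftrightarrow> orth t y \<and> t \<in> perp A" for t using in_perp_extend[OF s(1) y(3)] y(4) by simp
  have inY': "t \<in> perp Y' \<longleftrightarrow> orth t y' \<and> t \<in> perp A" for t using in_perp_extend[OF s(1) y'(3)] y'(4) by simp
  have no: "\<not> orth y y'"
  proof
    assume "orth y y'"
    then have "y \<in> perp Y'" using inY' y by simp
    then have "Y \<subseteq> perp Y'" using over_perp_subset[OF s(1) y(3) _ s(5,3)] y(4) by simp
    then show False using over_nb[OF Y(1) Y'(1) n(1)] n(2) by simp
  qed
  obtain z where z: "z \<in> perp S" "z \<notin> S" "orth z y" "orth z y'"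
    using common_neighbour[OF S(1,3) _ _ no] y y' Y Y' by blast
  define Z where "Z = gen (insert z A)"
  have zA: "z \<in> perp A" "z \<notin> A" using z S perp_antimono[OF S(2)] by blast+
  have ZA: "over A Z" unfolding Z_def by (rule over_extend[OF s(1) zA])
  have inZ: "t \<in> perp Z \<longleftrightarrow> orth t z \<and> t \<in> perp A" for t
    unfolding Z_def by (rule in_perp_extend[OF s(1) zA(1)])
  have "Z \<subseteq> perp Y" unfolding Z_def
    by (rule over_perp_subset[OF s(1) zA(1) _ s(4,2)]) (use inY z zA in blast)
  moreover have "Z \<noteq> Y" using inZ[of y'] inY[of y'] y' z no orth_sym by metis
  ultimately have ZY: "nb Z Y" using over_nb[OF ZA Y(1)] by simp
  have "Z \<subseteq> perp Y'" unfolding Z_def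
    by (rule over_perp_subset[OF s(1) zA(1) _ s(5,3)]) (use inY' z zA in blast)
  moreover have "Z \<noteq> Y'" using inZ[of y] inY'[of y] y z no orth_sym by metis
  ultimately have ZY': "nb Z Y'" using over_nb[OF ZA Y'(1)] by simp
  have "Z \<subseteq> perp S" unfolding Z_def by (rule over_perp_subset[OF s(1) zA(1) z(1) S(2,1)])
  moreover have "\<not> Z \<subseteq> S" using z(2) extend_mem[of z A] by (auto simp: Z_def)
  ultimately show ?thesis using that ZA ZY ZY' by blast
qed

lemma over_new_neighbour:
  assumes A: "sing A" "A \<subseteq> V" and V: "sing V" "rk V < N"
  obtains Z where "over A Z" "Z \<subseteq> perp V" "\<not> Z \<subseteq> V"
    "\<And>X. \<lbrakk>over A X; X \<subseteq> V\<rbrakk> \<Longrightarrow> nb Z X \<and> X \<inter> Z = A"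
proof -
  obtain z where z: "z \<in> perp V" "z \<notin> V" using point_outside[OF V] .
  define Z where "Z = gen (insert z A)"
  have zA: "z \<in> perp A" "z \<notin> A" using z A perp_antimono[OF A(2)] by blast+
  have ZA: "over A Z" unfolding Z_def by (rule over_extend[OF A(1) zA])
  have ZV: "Z \<subseteq> perp V" unfolding Z_def by (rule over_perp_subset[OF A(1) zA(1) z(1) A(2) V(1)])
  have nZ: "\<not> Z \<subseteq> V" using z(2) extend_mem[of z A] by (auto simp: Z_def)
  have "nb Z X \<and> X \<inter> Z = A" if X: "over A X" "X \<subseteq> V" for X
  proof
    have ne: "Z \<noteq> X" using nZ X by blast
    show "nb Z X" by (rule over_nb[OF ZA X(1) ne]) (use ZV perp_antimono[OF X(2)] in blast)
    show "X \<inter> Z = A" using over_Int[OF X(1) ZA] ne by simp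
  qed
  then show ?thesis using that[OF ZA ZV nZ] by simp
qed

text \<open>\<open>P\<close> and \<open>Q\<close> come from two non-orthogonal points of
  \<open>perp V\<close>. The rank of \<open>V\<close> must be below \<open>N\<close> to leave room
  for them, and this is what limits \<open>k\<close>.\<close>

lemma over_nonadjacent:
  assumes A: "sing A" "A \<subseteq> V" and V: "sing V" "rk V < N"
  obtains P Q where "P \<noteq> Q" "\<not> nb P Q" "over A P" "over A Q"
    "\<And>X. \<lbrakk>over A X; X \<subseteq> V\<rbrakk> \<Longrightarrow> nb P X \<and> nb Q X"
proof -
  obtain p q where pq: "p \<in> perp V" "q \<in> perp V" "\<not> orth p q" using nonorthogonal_pair[OF V] .
  have new: "over A (gen (insert t A)) \<and> (\<forall>X. over A X \<longrightarrow> X \<subseteq> V \<longrightarrow> nb (gen (insert t A)) X)"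
    if t: "t \<in> perp V" "s \<in> perp V" "\<not> orth t s" for t s
  proof
    have tV: "t \<notin> V" using t perp_orth orth_sym by blast
    have tA: "t \<in> perp A" "t \<notin> A" using t tV A perp_antimono[OF A(2)] by blast+
    show ov: "over A (gen (insert t A))" by (rule over_extend[OF A(1) tA])
    show "\<forall>X. over A X \<longrightarrow> X \<subseteq> V \<longrightarrow> nb (gen (insert t A)) X"
    proof (intro allI impI)
      fix X assume X: "over A X" "X \<subseteq> V"
      show "nb (gen (insert t A)) X"
      proof (rule over_nb[OF ov X(1)])
        show "gen (insert t A) \<noteq> X" using extend_mem[of t A] X tV by blast
        show "gen (insert t A) \<subseteq> perp X"
          by (rule over_perp_subset[OF A(1) tA(1)])
            (use t perp_antimono[OF X(2)] X in \<open>auto simp: over_def\<close>)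
      qed
    qed
  qed
  define P Q where "P = gen (insert p A)" and "Q = gen (insert q A)"
  have P: "over A P" "\<And>X. \<lbrakk>over A X; X \<subseteq> V\<rbrakk> \<Longrightarrow> nb P X" using new[OF pq] by (auto simp: P_def)
  have qp: "\<not> orth q p" using pq(3) orth_sym by blast
  have Q: "over A Q" "\<And>X. \<lbrakk>over A X; X \<subseteq> V\<rbrakk> \<Longrightarrow> nb Q X"
    using new[OF pq(2,1) qp] by (auto simp: Q_def)
  have mem: "p \<in> P" "q \<in> Q" unfolding P_def Q_def by (rule extend_mem)+
  have "P \<noteq> Q" using mem pq(3) singular_orth P(1) unfolding over_def by metis
  moreover have "\<not> nb P Q" using nb_perp mem pq(3) perp_orth by blast
  ultimately show ?thesis using that P Q by blast
qed

end

section \<open>Isometric embeddings\<close>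

text \<open>Ranks replace dimensions: \<open>r\<close> is \<open>k + 1\<close> and \<open>r'\<close>
  is \<open>k' + 1\<close>. Isometry enters as preservation of adjacency together with
  \<open>f_near\<close>, which says that \<open>f\<close> does not shorten distances.\<close>

locale grassmann_embedding =
  A: ranked_weak_polar_space \<Pi> N + B: ranked_weak_polar_space \<Pi>' N'
  for \<Pi> :: "'a pls" and N :: nat and \<Pi>' :: "'b pls" and N' :: nat +
  fixes r r' :: nat and f :: "'a set \<Rightarrow> 'b set"
  assumes r: "2 \<le> r" "r + 3 \<le> N" and r': "r' < N'"
    and f_grass: "X \<in> A.grass r \<Longrightarrow> f X \<in> B.grass r'"
    and f_inj: "inj_on f (A.grass r)"
    and f_nb: "\<lbrakk>A.nb X Y; X \<in> A.grass r\<rbrakk> \<Longrightarrow> B.nb (f X) (f Y)"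
    and f_near: "\<lbrakk>X \<in> A.grass r; Y \<in> A.grass r; B.near r' d (f X) (f Y)\<rbrakk> \<Longrightarrow> A.near r d X Y"
begin

text \<open>\<open>g\<close> is the map that \<open>f\<close> induces on subspaces of rank \<open>j\<close>. The last clause fails for \<open>j = 0\<close>.\<close>

definition level :: "nat \<Rightarrow> ('a set \<Rightarrow> 'b set) \<Rightarrow> bool" where
  "level j g \<longleftrightarrow>
     (\<forall>Y\<in>A.grass j. B.sing (g Y) \<and> B.rk (g Y) + r = r' + j) \<and>
     (\<forall>Y\<in>A.grass j. \<forall>X\<in>A.grass r. Y \<subseteq> X \<longrightarrow> g Y \<subseteq> f X) \<and>
     (\<forall>X Y. A.nb X Y \<longrightarrow> X \<in> A.grass j \<longrightarrow> B.nb (g X) (g Y)) \<and>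
     (\<forall>X Y Z. A.nb X Y \<longrightarrow> A.nb X Z \<longrightarrow> A.nb Y Z \<longrightarrow> X \<in> A.grass j \<longrightarrow> X \<inter> Y = X \<inter> Z \<longrightarrow>
        g X \<inter> g Y = g X \<inter> g Z) \<and>
     (1 \<le> j \<longrightarrow> (\<forall>X\<in>A.grass r. f X \<subseteq> B.gen (\<Union>{g Y | Y. Y \<in> A.grass j \<and> Y \<subseteq> X})))"

context
  fixes j g
  assumes "level j g"
begin

lemmas level_conjs = \<open>level j g\<close>[unfolded level_def]

lemma level_sing: "Y \<in> A.grass j \<Longrightarrow> B.sing (g Y)"
  and level_rk: "Y \<in> A.grass j \<Longrightarrow> B.rk (g Y) + r = r' + j"
  using level_conjs[THEN conjunct1] by simp_all

lemma level_below: "\<lbrakk>Y \<in> A.grass j; X \<in> A.grass r; Y \<subseteq> X\<rbrakk> \<Longrightarrow> g Y \<subseteq> f X"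
  using level_conjs[THEN conjunct2, THEN conjunct1] by simp

lemma level_nb: "\<lbrakk>A.nb X Y; X \<in> A.grass j\<rbrakk> \<Longrightarrow> B.nb (g X) (g Y)"
  using level_conjs[THEN conjunct2, THEN conjunct2, THEN conjunct1] by simp

lemma level_star:
  "\<lbrakk>A.nb X Y; A.nb X Z; A.nb Y Z; X \<in> A.grass j; X \<inter> Y = X \<inter> Z\<rbrakk> \<Longrightarrow> g X \<inter> g Y = g X \<inter> g Z"
  using level_conjs[THEN conjunct2, THEN conjunct2, THEN conjunct2, THEN conjunct1, rule_format] .

lemma level_gen:
  "\<lbrakk>1 \<le> j; X \<in> A.grass r\<rbrakk> \<Longrightarrow> f X \<subseteq> B.gen (\<Union>{g Y | Y. Y \<in> A.grass j \<and> Y \<subseteq> X})"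
  using level_conjs[THEN conjunct2, THEN conjunct2, THEN conjunct2, THEN conjunct2, rule_format] .

end

lemma nb_grass: "\<lbrakk>A.nb X Y; X \<in> A.grass j\<rbrakk> \<Longrightarrow> Y \<in> A.grass j"
  using A.nbD[of X Y] by (simp add: A.grass_def)

section \<open>The embedding itself as the top level\<close>

lemma f_nb_iff:
  assumes "X \<in> A.grass r" "Y \<in> A.grass r"
  shows "B.nb (f X) (f Y) \<longleftrightarrow> A.nb X Y"
proof
  assume h: "B.nb (f X) (f Y)"
  have "B.rk (f X) = r'" using f_grass[OF assms(1)] by (simp add: B.grass_def)
  then have "B.near r' 1 (f X) (f Y)" using h B.near_one by blast
  then have "A.near r 1 X Y" using f_near assms by blast
  then show "A.nb X Y" using A.near_one h B.nbD(4)[OF h] by metis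
qed (use f_nb assms in blast)

text \<open>The triangle lies in a singular \<open>V\<close> of rank at most \<open>r + 2\<close>,
  which is below \<open>N\<close> by \<open>r + 3 \<le> N\<close>. Two non-adjacent vertices over
  \<open>A\<close> that are adjacent to the whole triangle are mapped to witnesses for
  \<open>star_triangle\<close>.\<close>

lemma f_star:
  assumes nb: "A.nb X Y" "A.nb X Z" "A.nb Y Z" and X: "X \<in> A.grass r" and eq: "X \<inter> Y = X \<inter> Z"
  shows "f X \<inter> f Y = f X \<inter> f Z"
proof -
  define A where "A = X \<inter> Y"
  have ov: "A.over A X" "A.over A Y" "A.over A Z"
    using A.nb_over[OF nb(1)] A.nb_over'[OF nb(1)] A.nb_over'[OF nb(2)] eq by (simp_all add: A_def)
  have sA: "A.sing A" and AX: "A \<subseteq> X" and sX: "A.sing X" using ov(1) by (auto simp: A.over_def)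
  have Y: "Y \<in> A.grass r" and Z: "Z \<in> A.grass r" using nb_grass nb X by blast+
  have rA: "Suc (A.rk A) = r" using ov(1) X by (simp add: A.over_def A.grass_def)
  obtain U where U: "A.sing U" "A.rk U = Suc (A.rk X)" "X \<subseteq> U" "Y \<subseteq> U"
    using nb(1) unfolding A.nb_def by blast
  obtain z where z: "z \<in> Z" "z \<in> A.perp A" "Z = A.gen (insert z A)" using A.over_point[OF ov(3)] by metis
  \<comment> \<open>If \<open>z\<close> is outside \<open>U\<close>, mutual adjacency still makes it
    orthogonal to \<open>U\<close>, so one more rank suffices.\<close>
  have "\<exists>V. A.sing V \<and> A.rk V \<le> Suc (A.rk U) \<and> U \<subseteq> V \<and> z \<in> V"
  proof (cases "z \<in> U")
    case True
    then show ?thesis using U by (intro exI[of _ U]) simp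
  next
    case False
    obtain y where y: "y \<in> Y" "y \<notin> A" "y \<in> A.perp A" using A.over_point[OF ov(2)] by metis
    have yX: "y \<notin> X" using y by (auto simp: A_def)
    have zX: "z \<in> A.perp X" using A.nb_perp[OF A.nb_sym[OF nb(2)]] z by blast
    have zy: "A.orth z y" using A.nb_perp[OF A.nb_sym[OF nb(3)]] z y A.perp_orth by blast
    have yp: "y \<in> A.perp X" by (rule A.singular_in_perp[OF U(1,3)]) (use y U in blast)
    have "U = A.gen (insert y X)"
      by (rule A.hyperplane_extend[OF U(1) sX U(3,2)]) (use y U yX in auto)
    then have zU: "z \<in> A.perp U" using A.in_perp_extend[OF sX yp] zX zy by simp
    show ?thesis
      using A.extend_singular[OF U(1) zU] A.rk_extend[OF U(1) zU False] A.extend_superset[of U z] A.extend_mem[of z U]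
      by (intro exI[of _ "A.gen (insert z U)"]) simp
  qed
  then obtain V where V: "A.sing V" "A.rk V \<le> Suc (A.rk U)" "U \<subseteq> V" "z \<in> V" by blast
  have rV: "A.rk V < N" using V(2) U(2) X r by (simp add: A.grass_def)
  have AV: "A \<subseteq> V" using AX U V by blast
  have "Z \<subseteq> V" unfolding z(3) by (rule A.gen_least_singular[OF V(1)]) (use AV V in blast)
  then have sub: "X \<subseteq> V" "Y \<subseteq> V" "Z \<subseteq> V" using U V by auto
  obtain P Q where PQ: "P \<noteq> Q" and nPQ: "\<not> A.nb P Q"
    and new: "\<And>W. \<lbrakk>A.over A W; W \<subseteq> V\<rbrakk> \<Longrightarrow> A.nb P W \<and> A.nb Q W"
    using A.over_nonadjacent[OF sA AV V(1) rV] by metis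
  have P: "A.nb P X" "A.nb P Y" "A.nb P Z" and Q: "A.nb Q X" "A.nb Q Y" "A.nb Q Z"
    using new[OF ov(1) sub(1)] new[OF ov(2) sub(2)] new[OF ov(3) sub(3)] by blast+
  have Pg: "P \<in> A.grass r" and Qg: "Q \<in> A.grass r"
    using nb_grass[OF A.nb_sym[OF P(1)] X] nb_grass[OF A.nb_sym[OF Q(1)] X] .
  show ?thesis
  proof (rule B.star_triangle)
    show "f P \<noteq> f Q" using PQ f_inj Pg Qg by (auto simp: inj_on_def)
    show "\<not> B.nb (f P) (f Q)" using nPQ f_nb_iff Pg Qg by blast
  qed (use f_nb nb X Y P Q Pg Qg in blast)+
qed

lemma level_top: "level r f"
  unfolding level_def
proof (intro conjI allI ballI impI)
  fix Y assume "Y \<in> A.grass r"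
  then show "B.sing (f Y)" "B.rk (f Y) + r = r' + r" using f_grass[of Y] by (auto simp: B.grass_def)
next
  fix X Y assume h: "Y \<in> A.grass r" "X \<in> A.grass r" "Y \<subseteq> X"
  have "Y = X" by (rule A.eq_of_rk) (use h in \<open>auto simp: A.grass_def\<close>)
  then show "f Y \<subseteq> f X" by simp
next
  fix X assume X: "X \<in> A.grass r"
  then have "f X \<subseteq> \<Union>{f Y | Y. Y \<in> A.grass r \<and> Y \<subseteq> X}" by blast
  then show "f X \<subseteq> B.gen (\<Union>{f Y | Y. Y \<in> A.grass r \<and> Y \<subseteq> X})"
    using B.gen_superset by blast
qed (use f_nb f_star in blast)+

section \<open>Descent by one rank\<close>

context
  fixes j g
  assumes lev: "level (Suc j) g" and j: "Suc j \<le> r"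
begin

text \<open>If \<open>Y\<close> and \<open>Y'\<close> are distinct and not adjacent, a
  \<open>Z\<close> through the same hyperplane and adjacent to all of \<open>X\<close>,
  \<open>Y\<close>, \<open>Y'\<close> links the triangles \<open>X Y Z\<close> and
  \<open>X Z Y'\<close>.\<close>

lemma level_Int_same:
  assumes nb: "A.nb X Y" "A.nb X Y'" and X: "X \<in> A.grass (Suc j)" and eq: "X \<inter> Y = X \<inter> Y'"
  shows "g X \<inter> g Y = g X \<inter> g Y'"
proof (cases "Y = Y' \<or> A.nb Y Y'")
  case True
  then show ?thesis using level_star[OF lev] nb X eq by blast
next
  case False
  define A where "A = X \<inter> Y"
  have ov: "A.over A X" "A.over A Y" "A.over A Y'"
    using A.nb_over[OF nb(1)] A.nb_over'[OF nb(1)] A.nb_over'[OF nb(2)] eq by (simp_all add: A_def)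
  have sX: "A.sing X" "A \<subseteq> X" using ov(1) by (auto simp: A.over_def)
  have rX: "Suc (Suc (A.rk X)) \<le> N" using X j r by (simp add: A.grass_def)
  obtain Z where Z: "A.over A Z" "A.nb Z Y" "A.nb Z Y'" "Z \<subseteq> A.perp X" "\<not> Z \<subseteq> X"
    by (rule A.over_connect[OF sX rX ov(2) A.nb_perp[OF A.nb_sym[OF nb(1)]] ov(3) A.nb_perp[OF A.nb_sym[OF nb(2)]]])
      (use False in blast)+
  have ne: "Z \<noteq> X" using Z(5) by blast
  have ZX: "A.nb X Z" using A.over_nb[OF Z(1) ov(1) ne Z(4)] A.nb_sym by blast
  have I: "X \<inter> Z = A" using A.over_Int[OF Z(1) ov(1) ne] by blast
  have "g X \<inter> g Y = g X \<inter> g Z"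
    by (rule level_star[OF lev nb(1) ZX A.nb_sym[OF Z(2)] X]) (simp add: I A_def)
  also have "\<dots> = g X \<inter> g Y'"
    by (rule level_star[OF lev ZX nb(2) Z(3) X]) (simp add: I A_def eq)
  finally show ?thesis .
qed

text \<open>For adjacent \<open>X\<close>, \<open>X'\<close> both sides agree with
  \<open>g X \<inter> g X'\<close>. For non-adjacent ones, a common neighbour through the same
  subspace mediates.\<close>

lemma level_Int:
  assumes nb: "A.nb X Y" "A.nb X' Y'" and X: "X \<in> A.grass (Suc j)" and eq: "X \<inter> Y = X' \<inter> Y'"
  shows "g X \<inter> g Y = g X' \<inter> g Y'"
proof -
  define A where "A = X \<inter> Y"
  have ov: "A.over A X" "A.over A X'"
    using A.nb_over[OF nb(1)] A.nb_over[OF nb(2)] eq by (simp_all add: A_def)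
  have sA: "A.sing A" and X': "X' \<in> A.grass (Suc j)" and rA: "A.rk A = j"
    using ov X by (auto simp: A.over_def A.grass_def)
  have adj: "g P \<inter> g Y = g Q \<inter> g Y'"
    if "A.nb P Y" "A.nb Q Y'" "P \<in> A.grass (Suc j)" "P \<inter> Y = A" "Q \<inter> Y' = A" "A.nb P Q" for P Q Y Y'
  proof -
    have o: "A.over A P" "A.over A Q" using A.nb_over[OF that(1)] A.nb_over[OF that(2)] that(4,5) by simp_all
    have I: "P \<inter> Q = A" by (rule A.over_Int[OF o A.nbD(4)[OF that(6)]])
    have Qg: "Q \<in> A.grass (Suc j)" by (rule nb_grass[OF that(6,3)])
    have "g P \<inter> g Y = g P \<inter> g Q"
      by (rule level_Int_same[OF that(1,6,3)]) (simp add: I that)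
    moreover have "g Q \<inter> g P = g Q \<inter> g Y'"
      by (rule level_Int_same[OF A.nb_sym[OF that(6)] that(2) Qg]) (use I that in blast)
    ultimately show ?thesis by blast
  qed
  consider "X = X'" | "A.nb X X'" | "X \<noteq> X'" "\<not> A.nb X X'" by blast
  then show ?thesis
  proof cases
    case 1
    then show ?thesis using level_Int_same[OF nb(1) _ X] nb(2) eq by blast
  next
    case 2
    show ?thesis by (rule adj[OF nb X]) (use A_def eq 2 in auto)
  next
    case 3
    have Ap: "X \<subseteq> A.perp A" "X' \<subseteq> A.perp A"
      using A.singular_in_perp[of X A] A.singular_in_perp[of X' A] ov by (auto simp: A.over_def)
    have rA2: "Suc (Suc (A.rk A)) \<le> N" using rA j r by simp
    obtain Z where Z: "A.over A Z" "A.nb Z X" "A.nb Z X'"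
      by (rule A.over_connect[OF sA order_refl rA2 ov(1) Ap(1) ov(2) Ap(2) 3])
    have I: "Z \<inter> X = A" "Z \<inter> X' = A"
      using A.over_Int[OF Z(1) ov(1) A.nbD(4)[OF Z(2)]] A.over_Int[OF Z(1) ov(2) A.nbD(4)[OF Z(3)]] .
    have Zg: "Z \<in> A.grass (Suc j)" by (rule nb_grass[OF A.nb_sym[OF Z(2)] X])
    have "g X \<inter> g Y = g Z \<inter> g X"
      by (rule adj[OF nb(1) Z(2) X A_def[symmetric] I(1) A.nb_sym[OF Z(2)]])
    also have "\<dots> = g Z \<inter> g X'" by (rule level_Int_same[OF Z(2,3) Zg]) (simp add: I)
    also have "\<dots> = g X' \<inter> g Y'"
      by (rule adj[OF Z(3) nb(2) Zg I(2) _ Z(3)]) (use A_def eq in simp)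
    finally show ?thesis .
  qed
qed

text \<open>The choice is harmless: by \<open>level_Int\<close> all adjacent pairs that intersect in
  \<open>A\<close> give the same set.\<close>

definition lower :: "'a set \<Rightarrow> 'b set" where
  "lower A = (SOME T. \<exists>X Y. A.nb X Y \<and> X \<in> A.grass (Suc j) \<and> X \<inter> Y = A \<and> T = g X \<inter> g Y)"

lemma lower_Int:
  assumes "A.nb X Y" "X \<in> A.grass (Suc j)"
  shows "lower (X \<inter> Y) = g X \<inter> g Y"
proof -
  have "\<exists>T X' Y'. A.nb X' Y' \<and> X' \<in> A.grass (Suc j) \<and> X' \<inter> Y' = X \<inter> Y \<and> T = g X' \<inter> g Y'"
    using assms by blast
  from someI_ex[OF this] obtain X' Y'
    where "A.nb X' Y'" "X' \<in> A.grass (Suc j)" "X' \<inter> Y' = X \<inter> Y" "lower (X \<inter> Y) = g X' \<inter> g Y'"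
    unfolding lower_def by blast
  then show ?thesis using level_Int[OF _ assms(1)] by metis
qed

lemma lower_obtain:
  assumes "X \<in> A.grass (Suc j)" "A \<in> A.grass j" "A \<subseteq> X"
  obtains Y where "A.nb X Y" "X \<inter> Y = A" "lower A = g X \<inter> g Y"
proof -
  have o: "A.over A X" using assms by (auto simp: A.over_def A.grass_def)
  have s: "A.sing A" "A.sing X" "A.rk X < N" using assms j r by (auto simp: A.grass_def)
  obtain Y where Y: "A.nb Y X \<and> X \<inter> Y = A"
    using A.over_new_neighbour[OF s(1) assms(3) s(2,3)] o by (metis order_refl)
  then show ?thesis using that[of Y] lower_Int[of X Y] A.nb_sym assms(1) by blast
qed

lemma lower_subset: "\<lbrakk>X \<in> A.grass (Suc j); A \<in> A.grass j; A \<subseteq> X\<rbrakk> \<Longrightarrow> lower A \<subseteq> g X"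
  using lower_obtain by blast

lemma grass_above:
  assumes "A \<in> A.grass j"
  obtains X where "X \<in> A.grass (Suc j)" "A \<subseteq> X"
proof -
  have s: "A.sing A" "A.rk A < N" using assms j r by (auto simp: A.grass_def)
  obtain z where z: "z \<in> A.perp A" "z \<notin> A" using A.point_outside[OF s] .
  show ?thesis
    using that[of "A.gen (insert z A)"] A.extend_singular[OF s(1) z(1)] A.rk_extend[OF s(1) z] A.extend_superset assms
    by (simp add: A.grass_def)
qed

lemma lower_grass:
  assumes "A \<in> A.grass j"
  shows "B.sing (lower A)" "B.rk (lower A) + r = r' + j"
proof -
  obtain X where X: "X \<in> A.grass (Suc j)" "A \<subseteq> X" using grass_above[OF assms] .
  obtain Y where Y: "A.nb X Y" "X \<inter> Y = A" "lower A = g X \<inter> g Y" using lower_obtain[OF X(1) assms X(2)] .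
  have n: "B.nb (g X) (g Y)" using level_nb[OF lev Y(1) X(1)] .
  show "B.sing (lower A)" using B.singular_Int_singular[OF B.nbD(1,2)[OF n]] Y(3) by simp
  show "B.rk (lower A) + r = r' + j"
    using B.nb_rk_Int[OF n] level_rk[OF lev X(1)] Y(3) by simp
qed

lemma lower_below:
  assumes "A \<in> A.grass j" "X \<in> A.grass r" "A \<subseteq> X"
  shows "lower A \<subseteq> f X"
proof -
  obtain Y where "A.sing Y" "A \<subseteq> Y" "Y \<subseteq> X" "A.rk Y = Suc j"
    using A.rk_between[of A X "Suc j"] assms j by (auto simp: A.grass_def)
  then show ?thesis
    using lower_subset[of Y A] level_below[OF lev, of Y X] assms by (auto simp: A.grass_def)
qed

text \<open>If \<open>lower\<close> identified \<open>B1\<close> and \<open>B2\<close>, opposite subspaces above them would have images through the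
  common subspace \<open>lower B1\<close>, which bounds the distance of these images by a smaller number than the
  distance of the opposite subspaces.\<close>

lemma lower_neq:
  assumes nb: "A.nb B1 B2" and B1: "B1 \<in> A.grass j"
  shows "lower B1 \<noteq> lower B2"
proof
  assume eq: "lower B1 = lower B2"
  have B2: "B2 \<in> A.grass j" by (rule nb_grass[OF nb B1])
  have rB: "A.rk B1 < r" "r \<le> N" using B1 j r by (auto simp: A.grass_def)
  obtain X Y where XY: "X \<in> A.grass r" "Y \<in> A.grass r" "B1 \<subseteq> X" "B2 \<subseteq> Y" "X \<inter> A.perp Y \<subseteq> B1 \<inter> B2"
    using A.opposite_above[OF nb rB] .
  have "B.near r' (Suc (r' - B.rk (lower B1))) (f X) (f Y)"
    by (rule B.near_above[OF r' f_grass[OF XY(1)] f_grass[OF XY(2)] lower_grass(1)[OF B1]])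
      (use lower_below[OF B1 XY(1,3)] lower_below[OF B2 XY(2,4)] eq in simp_all)
  then have n: "A.near r (Suc (r' - B.rk (lower B1))) X Y" using f_near XY by blast
  have sD: "A.sing (B1 \<inter> B2)" by (rule A.singular_Int_singular[OF A.nbD(1,2)[OF nb]])
  have rD: "j = Suc (A.rk (B1 \<inter> B2))" using A.nb_rk_Int[OF nb] B1 by (simp add: A.grass_def)
  \<comment> \<open>Here \<open>A.rk (B1 \<inter> B2) = j - 1\<close> and
    \<open>r' - B.rk (lower B1) = r - j\<close>, so the right side is only \<open>r\<close>.\<close>
  have "Suc r \<le> A.rk (B1 \<inter> B2) + Suc (r' - B.rk (lower B1))"
    by (rule A.near_lower_bound[OF n XY(1) sD XY(5)]) (use rD j in simp)
  moreover have "B.rk (lower B1) + r = r' + j" by (rule lower_grass(2)[OF B1])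
  ultimately show False using rD j by simp
qed

text \<open>Both images are hyperplanes of \<open>g U\<close> for the span \<open>U\<close> of
  \<open>B1\<close> and \<open>B2\<close>; the only danger is that they coincide.\<close>

lemma lower_nb:
  assumes nb: "A.nb B1 B2" and B1: "B1 \<in> A.grass j"
  shows "B.nb (lower B1) (lower B2)"
proof -
  have B2: "B2 \<in> A.grass j" by (rule nb_grass[OF nb B1])
  obtain U where U: "A.sing U" "A.rk U = Suc (A.rk B1)" "B1 \<subseteq> U" "B2 \<subseteq> U"
    using nb unfolding A.nb_def by blast
  have Ug: "U \<in> A.grass (Suc j)" using U B1 by (simp add: A.grass_def)
  show ?thesis unfolding B.nb_def
    using lower_grass[OF B1] lower_grass[OF B2] lower_neq[OF nb B1] level_sing[OF lev Ug] level_rk[OF lev Ug]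
      lower_subset[OF Ug B1 U(3)] lower_subset[OF Ug B2 U(4)] by (intro conjI exI[of _ "g U"]) auto
qed

text \<open>The spans \<open>U\<close>, \<open>U2\<close>, \<open>U3\<close> of the three pairs are
  distinct, mutually adjacent in \<open>V\<close>, and intersect pairwise in \<open>X\<close>,
  \<open>Y\<close>, \<open>Z\<close>. Hence both sides equal
  \<open>g U \<inter> g U2 \<inter> g U3\<close>.\<close>

lemma lower_star_noncoplanar:
  assumes nb: "A.nb X Y" "A.nb X Z" "A.nb Y Z" and X: "X \<in> A.grass j"
    and U: "A.sing U" "A.rk U = Suc j" "X \<subseteq> U" "Y \<subseteq> U" and Z: "\<not> Z \<subseteq> U"
  shows "lower X \<inter> lower Y = lower X \<inter> lower Z"
proof -
  have Yg: "Y \<in> A.grass j" and Zg: "Z \<in> A.grass j" using nb_grass nb X by blast+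
  have Xg: "A.sing X" "A.rk X = j" "A.sing Y" "A.rk Y = j" "A.sing Z" "A.rk Z = j"
    using X Yg Zg by (auto simp: A.grass_def)
  obtain U2 where U2: "A.sing U2" "A.rk U2 = Suc j" "X \<subseteq> U2" "Z \<subseteq> U2"
    using nb(2) Xg unfolding A.nb_def by auto
  obtain U3 where U3: "A.sing U3" "A.rk U3 = Suc j" "Y \<subseteq> U3" "Z \<subseteq> U3"
    using nb(3) Xg unfolding A.nb_def by auto
  have "\<not> Y \<subseteq> X" using A.eq_of_rk[OF Xg(3,1)] Xg A.nbD(4)[OF nb(1)] by auto
  then obtain y where y: "y \<in> Y" "y \<notin> X" by blast
  have Ueq: "U = A.gen (insert y X)" by (rule A.hyperplane_extend[OF U(1) Xg(1) U(3)]) (use U y Xg in auto)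
  obtain z where z: "z \<in> Z" "z \<notin> U" using Z by blast
  have "insert y X \<subseteq> A.perp Z" using A.nb_perp[OF nb(2)] A.nb_perp[OF nb(3)] y by blast
  then have "U \<subseteq> A.perp Z" unfolding Ueq by (rule A.gen_minimal[OF A.perp_subspace])
  then have zU: "z \<in> A.perp U" using A.perp_sym[OF _ A.singular_points[OF Xg(5)]] z by blast
  define V where "V = A.gen (insert z U)"
  have V: "A.sing V" "A.rk V = Suc (Suc j)" "U \<subseteq> V" "z \<in> V" unfolding V_def
    using A.extend_singular[OF U(1) zU] A.rk_extend[OF U(1) zU z(2)] U(2) A.extend_superset A.extend_mem by auto
  have "U2 = A.gen (insert z X)"
    by (rule A.hyperplane_extend[OF U2(1) Xg(1) U2(3)]) (use U2 U z Xg in auto)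
  also have "\<dots> \<subseteq> V" by (rule A.gen_least_singular[OF V(1)]) (use U V in blast)
  finally have U2V: "U2 \<subseteq> V" .
  have "U3 = A.gen (insert z Y)"
    by (rule A.hyperplane_extend[OF U3(1) Xg(3) U3(3)]) (use U3 U z Xg in auto)
  also have "\<dots> \<subseteq> V" by (rule A.gen_least_singular[OF V(1)]) (use U V in blast)
  finally have U3V: "U3 \<subseteq> V" .
  have d12: "U \<noteq> U2" and d13: "U \<noteq> U3" using U2 U3 z by blast+
  have d23: "U2 \<noteq> U3"
  proof
    assume e: "U2 = U3"
    have "U \<subseteq> U2" unfolding Ueq by (rule A.gen_least_singular[OF U2(1)]) (use U2 U3 e y in blast)
    then have "U = U2" using A.eq_of_rk[OF U(1) U2(1)] U U2 by simp
    then show False using d12 by simp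
  qed
  have n12: "A.nb U U2" and n13: "A.nb U U3" and n23: "A.nb U2 U3"
    unfolding A.nb_def using U U2 U3 V U2V U3V d12 d13 d23 by auto
  have g: "U \<in> A.grass (Suc j)" "U2 \<in> A.grass (Suc j)" "U3 \<in> A.grass (Suc j)"
    using U(1,2) U2(1,2) U3(1,2) by (simp_all add: A.grass_def)
  have "A.over X U" "A.over X U2" "A.over Y U" "A.over Y U3" "A.over Z U2" "A.over Z U3"
    unfolding A.over_def using U U2 U3 Xg by simp_all
  then have "U \<inter> U2 = X" "U \<inter> U3 = Y" "U2 \<inter> U3 = Z"
    using A.over_Int d12 d13 d23 by simp_all
  then have "lower X = g U \<inter> g U2" "lower Y = g U \<inter> g U3" "lower Z = g U2 \<inter> g U3"
    using lower_Int[OF n12 g(1)] lower_Int[OF n13 g(1)] lower_Int[OF n23 g(2)] by simp_all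
  then show ?thesis by blast
qed

text \<open>In the coplanar case the three spans collapse to \<open>U\<close>. An auxiliary
  \<open>V\<close> over the same \<open>A\<close> but outside \<open>U\<close> takes the place of
  the third vertex, and both sides equal \<open>lower X \<inter> lower V\<close>.\<close>

lemma lower_star:
  assumes nb: "A.nb X Y" "A.nb X Z" "A.nb Y Z" and X: "X \<in> A.grass j" and eq: "X \<inter> Y = X \<inter> Z"
  shows "lower X \<inter> lower Y = lower X \<inter> lower Z"
proof -
  obtain U where U: "A.sing U" "A.rk U = Suc (A.rk X)" "X \<subseteq> U" "Y \<subseteq> U"
    using nb(1) unfolding A.nb_def by blast
  have rU: "A.rk U = Suc j" using U X by (simp add: A.grass_def)
  show ?thesis
  proof (cases "Z \<subseteq> U")
    case False
    then show ?thesis using lower_star_noncoplanar[OF nb X U(1) rU U(3,4)] by simp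
  next
    case True
    define A where "A = X \<inter> Y"
    have ov: "A.over A X" "A.over A Y" "A.over A Z"
      using A.nb_over[OF nb(1)] A.nb_over'[OF nb(1)] A.nb_over'[OF nb(2)] eq by (simp_all add: A_def)
    have sA: "A.sing A" "A \<subseteq> U" using ov(1) U by (auto simp: A.over_def)
    have rUN: "A.rk U < N" using rU j r by simp
    obtain V where V: "\<not> V \<subseteq> U" "\<And>W. \<lbrakk>A.over A W; W \<subseteq> U\<rbrakk> \<Longrightarrow> A.nb V W \<and> W \<inter> V = A"
      using A.over_new_neighbour[OF sA U(1) rUN] by metis
    have n: "A.nb X V" "A.nb Y V" "A.nb Z V"
      using V(2)[OF ov(1) U(3)] V(2)[OF ov(2) U(4)] V(2)[OF ov(3) True] A.nb_sym by blast+
    show ?thesis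
      using lower_star_noncoplanar[OF nb(1) n(1,2) X U(1) rU U(3,4) V(1)]
        lower_star_noncoplanar[OF nb(2) n(1,3) X U(1) rU U(3) True V(1)] by simp
  qed
qed

text \<open>Each \<open>g Y\<close> is generated by the images of two distinct hyperplanes of
  \<open>Y\<close>. For \<open>j = 0\<close>, \<open>Y\<close> is a point and has only the empty
  hyperplane, whence \<open>1 \<le> j\<close>.\<close>

lemma lower_gen:
  assumes "1 \<le> j" and X: "X \<in> A.grass r"
  shows "f X \<subseteq> B.gen (\<Union>{lower Y | Y. Y \<in> A.grass j \<and> Y \<subseteq> X})"
proof -
  let ?L = "\<Union>{lower Y | Y. Y \<in> A.grass j \<and> Y \<subseteq> X}"
  have "?L \<subseteq> f X" using lower_below X by blast
  then have Lp: "?L \<subseteq> points \<Pi>'" using B.singular_points f_grass[OF X] by (auto simp: B.grass_def)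
  have sL: "B.sub (B.gen ?L)" by (rule B.gen_subspace[OF Lp])
  have in_L: "lower C \<subseteq> ?L" if "C \<in> A.grass j" "C \<subseteq> X" for C
    by (rule Union_upper) (use that in blast)
  have step: "g Y \<subseteq> B.gen ?L" if Y: "Y \<in> A.grass (Suc j)" "Y \<subseteq> X" for Y
  proof -
    have sY: "A.sing Y" "A.rk Y = Suc j" using Y by (auto simp: A.grass_def)
    obtain C where C: "A.sing C" "C \<subseteq> Y" "A.rk C = j"
      using A.rk_between[OF A.empty_singular sY(1), of j] sY(2) A.rk_empty by auto
    have "C \<noteq> Y" using C sY by auto
    then obtain y where y: "y \<in> Y" "y \<notin> C" using C by blast
    have yp: "y \<in> points \<Pi>" using y A.singular_points[OF sY(1)] by blast
    obtain E where E: "A.sing E" "{y} \<subseteq> E" "E \<subseteq> Y" "A.rk E = j"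
      using A.rk_between[OF A.singleton_singular[OF yp] sY(1), of j] sY(2) y A.singleton_grass[OF yp] assms(1)
      by (auto simp: A.grass_def)
    have nb: "A.nb C E" unfolding A.nb_def using C E sY y by auto
    have Cg: "C \<in> A.grass j" and Eg: "E \<in> A.grass j" using C E by (auto simp: A.grass_def)
    have sub: "lower C \<subseteq> g Y" "lower E \<subseteq> g Y" using lower_subset[OF Y(1)] Cg Eg C E by auto
    have bn: "B.nb (lower C) (lower E)" by (rule lower_nb[OF nb Cg])
    have "\<not> lower E \<subseteq> lower C"
      using B.eq_of_rk[OF B.nbD(2,1)[OF bn]] B.nbD(3,4)[OF bn] by auto
    then obtain e where e: "e \<in> lower E" "e \<notin> lower C" by blast
    have "g Y = B.gen (insert e (lower C))"
      by (rule B.hyperplane_extend[OF level_sing[OF lev Y(1)] lower_grass(1)[OF Cg] sub(1)])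
        (use level_rk[OF lev Y(1)] lower_grass(2)[OF Cg] e sub in auto)
    also have "\<dots> \<subseteq> B.gen ?L"
    proof (rule B.gen_mono)
      have C: "lower C \<subseteq> ?L" by (rule in_L[OF Cg]) (use C(2) Y(2) in simp)
      have "lower E \<subseteq> ?L" by (rule in_L[OF Eg]) (use E(3) Y(2) in simp)
      then have "e \<in> ?L" using e(1) by (rule subsetD)
      then show "insert e (lower C) \<subseteq> ?L" using C by (rule insert_subsetI)
    qed
    finally show ?thesis .
  qed
  have "f X \<subseteq> B.gen (\<Union>{g Y | Y. Y \<in> A.grass (Suc j) \<and> Y \<subseteq> X})"
    using level_gen[OF lev _ X] by simp
  also have "\<dots> \<subseteq> B.gen ?L"
    by (rule B.gen_minimal[OF sL]) (use step in blast)
  finally show ?thesis .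
qed

lemma level_lower: "level j lower"
  unfolding level_def
  by (intro conjI allI ballI impI lower_grass lower_below lower_nb lower_star lower_gen)

end

subsection \<open>The induced map on points\<close>

lemma level_exists:
  assumes "j \<le> r"
  obtains g where "level j g"
proof -
  have "\<exists>g. level j g" using assms
  proof (induction j rule: inc_induct)
    case base
    then show ?case using level_top by blast
  next
    case (step m)
    then show ?case using level_lower[of m] by (metis Suc_leI)
  qed
  then show ?thesis using that by blast
qed

text \<open>The points that \<open>h\<close> sends into \<open>T\<close> form a subspace, so it is
  enough to check generators.\<close>

lemma subspace_subset_vimage:
  assumes line: "\<And>a b x. \<lbrakk>A.orth a b; a \<noteq> b; x \<in> A.join a b; h a \<subseteq> T; h b \<subseteq> T\<rbrakk> \<Longrightarrow> h x \<subseteq> T"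
    and G: "G \<subseteq> points \<Pi>" "\<And>x. x \<in> G \<Longrightarrow> h x \<subseteq> T" and x: "x \<in> A.gen G"
  shows "h x \<subseteq> T"
proof -
  have "A.sub {x \<in> points \<Pi>. h x \<subseteq> T}"
    unfolding A.subspace_iff
  proof (intro conjI ballI impI subsetI)
    fix a b c assume ab: "a \<in> {x \<in> points \<Pi>. h x \<subseteq> T}" "b \<in> {x \<in> points \<Pi>. h x \<subseteq> T}"
      and c: "a \<noteq> b" "A.orth a b" "c \<in> A.join a b"
    have "c \<in> points \<Pi>" using A.join_orth[OF c(2,1,3,3)] by (rule A.orth_points)
    then show "c \<in> {x \<in> points \<Pi>. h x \<subseteq> T}" using line[OF c(2,1,3)] ab by simp
  qed simp
  then have "A.gen G \<subseteq> {x \<in> points \<Pi>. h x \<subseteq> T}" by (rule A.gen_minimal) (use G in blast)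
  then show ?thesis using x by blast
qed

text \<open>Levels 1 and 0 give \<open>h\<close> and \<open>S\<close>, and level 2 controls the
  images of lines. What the levels do not provide is that non-collinear points have non-orthogonal
  images; injectivity on such points and the rank inequality follow from it.\<close>

lemma induced_by_points:
  "\<exists>S h. B.sing S \<and> B.rk S + r = r' \<and> N + B.rk S \<le> N' \<and>
    (\<forall>p\<in>points \<Pi>. B.over S (h p)) \<and>
    (\<forall>p\<in>points \<Pi>. \<forall>q\<in>points \<Pi>. p \<noteq> q \<longrightarrow> h p \<noteq> h q \<and> (A.orth p q \<longleftrightarrow> h p \<subseteq> B.perp (h q))) \<and>
    (\<forall>X\<in>A.grass r. S \<subseteq> f X \<and> f X = B.gen (\<Union>p\<in>X. h p))"
proof -
  obtain g2 where lev2: "level 2 g2" using level_exists r by blast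
  define g1 where "g1 = lower 1 g2"
  define g0 where "g0 = lower 0 g1"
  have lev2': "level (Suc 1) g2" and j2: "Suc 1 \<le> r" using lev2 r by (simp_all add: numeral_2_eq_2)
  have lev1: "level 1 g1" unfolding g1_def by (rule level_lower[OF lev2' j2])
  have lev1': "level (Suc 0) g1" and j1: "Suc 0 \<le> r" using lev1 r by simp_all
  have lev0: "level 0 g0" unfolding g0_def by (rule level_lower[OF lev1' j1])
  define S h where "S = g0 {}" and "h p = g1 {p}" for p
  have e0: "{} \<in> A.grass 0" by (simp add: A.grass_def A.empty_singular A.rk_empty)
  have S: "B.sing S" "B.rk S + r = r'"
    using level_sing[OF lev0 e0] level_rk[OF lev0 e0] by (simp_all add: S_def)
  have Sf: "S \<subseteq> f X" if "X \<in> A.grass r" for X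
    unfolding S_def by (rule level_below[OF lev0 e0 that]) simp
  have h: "B.over S (h p)" if p: "p \<in> points \<Pi>" for p
  proof -
    have p1: "{p} \<in> A.grass (Suc 0)" using A.singleton_grass[OF p] by simp
    have "S \<subseteq> h p" unfolding S_def h_def g0_def by (rule lower_subset[OF lev1' j1 p1 e0]) simp
    then show ?thesis
      using S level_sing[OF lev1' p1] level_rk[OF lev1' p1] by (simp add: B.over_def h_def)
  qed
  have hs: "B.sing (h p)" if "p \<in> points \<Pi>" for p using h[OF that] by (simp add: B.over_def)
  have hnb: "B.nb (h p) (h q)" if pq: "A.orth p q" "p \<noteq> q" for p q
    unfolding h_def
    by (rule level_nb[OF lev1 A.nb_singletons[OF pq] A.singleton_grass[OF A.orth_points(1)[OF pq(1)]]])
  have hperp: "h p \<subseteq> B.perp (h q)" if pq: "A.orth p q" for p q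
  proof (cases "p = q")
    case True
    then show ?thesis using hs[OF A.orth_points(1)[OF pq]] by (simp add: B.singular_iff)
  next
    case False
    then show ?thesis using B.nb_perp hnb pq by blast
  qed
  \<comment> \<open>\<open>g2 L\<close> has one rank more than \<open>h a\<close>, so it is
    generated by \<open>h a\<close> and one point of \<open>h b\<close>.\<close>
  have hline: "h x \<subseteq> T" if T: "B.sub T" and ab: "A.orth a b" "a \<noteq> b" "x \<in> A.join a b" "h a \<subseteq> T" "h b \<subseteq> T" for T a b x
  proof -
    have pts: "a \<in> points \<Pi>" "b \<in> points \<Pi>" "x \<in> points \<Pi>"
      using A.orth_points[OF ab(1)] A.orth_points(1)[OF A.join_orth[OF ab(1,2,3,3)]] by auto
    have sa: "A.sing {a}" "A.rk {a} = 1" using A.singleton_grass[OF pts(1)] by (simp_all add: A.grass_def)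
    have b: "b \<in> A.perp {a}" "b \<notin> {a}" using ab A.orth_sym by (auto simp: A.in_perp_singleton)
    define L where "L = A.gen {b, a}"
    have L: "A.sing L" "L \<in> A.grass (Suc 1)"
      using A.extend_singular[OF sa(1) b(1)] A.rk_extend[OF sa(1) b] sa by (simp_all add: L_def A.grass_def)
    have mem: "a \<in> L" "b \<in> L" using A.gen_superset[of "{b, a}"] by (auto simp: L_def)
    have xL: "x \<in> L" by (rule A.subspace_join[OF A.singular_sub[OF L(1)] mem ab(2,1,3)])
    have sub: "h y \<subseteq> g2 L" if "y \<in> L" "y \<in> points \<Pi>" for y
      unfolding h_def g1_def
      by (rule lower_subset[OF lev2' j2 L(2) A.singleton_grass]) (use that in auto)
    have n: "B.nb (h a) (h b)" by (rule hnb[OF ab(1,2)])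
    have "\<not> h b \<subseteq> h a" using B.eq_of_rk[OF B.nbD(2,1)[OF n]] B.nbD(3,4)[OF n] by auto
    then obtain c where c: "c \<in> h b" "c \<notin> h a" by blast
    have "B.rk (g2 L) + r = r' + 2" "B.rk (h a) + r = r' + 1"
      using level_rk[OF lev2' L(2)] level_rk[OF lev1 A.singleton_grass[OF pts(1)]] by (simp_all add: h_def)
    then have "g2 L = B.gen (insert c (h a))"
      by (intro B.hyperplane_extend[OF level_sing[OF lev2' L(2)] hs[OF pts(1)] sub[OF mem(1) pts(1)]])
        (use c sub[OF mem(2) pts(2)] in auto)
    also have "\<dots> \<subseteq> T" by (rule B.gen_minimal[OF T]) (use ab c in blast)
    finally show ?thesis using sub[OF xL pts(3)] by blast
  qed
  have hgen: "h x \<subseteq> B.perp U" if "G \<subseteq> points \<Pi>" "\<And>x. x \<in> G \<Longrightarrow> h x \<subseteq> B.perp U" "x \<in> A.gen G" for x G U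
    by (rule subspace_subset_vimage[OF hline[OF B.perp_subspace] that])
  have fgen: "f X = B.gen (\<Union>p\<in>X. h p)" if X: "X \<in> A.grass r" for X
  proof
    have pX: "X \<subseteq> points \<Pi>" using X A.singular_points by (simp add: A.grass_def)
    have "\<Union>{g1 Y | Y. Y \<in> A.grass 1 \<and> Y \<subseteq> X} \<subseteq> (\<Union>p\<in>X. h p)"
    proof
      fix t assume "t \<in> \<Union>{g1 Y | Y. Y \<in> A.grass 1 \<and> Y \<subseteq> X}"
      then obtain Y where Y: "Y \<in> A.grass 1" "Y \<subseteq> X" "t \<in> g1 Y" by blast
      obtain p where "Y = {p}" using A.grass_1_singleton[OF Y(1)] by metis
      then show "t \<in> (\<Union>p\<in>X. h p)" using Y by (auto simp: h_def)
    qed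
    then have "B.gen (\<Union>{g1 Y | Y. Y \<in> A.grass 1 \<and> Y \<subseteq> X}) \<subseteq> B.gen (\<Union>p\<in>X. h p)" by (rule B.gen_mono)
    then show "f X \<subseteq> B.gen (\<Union>p\<in>X. h p)" using level_gen[OF lev1 order_refl X] by simp
    have "h p \<subseteq> f X" if "p \<in> X" for p
      unfolding h_def by (rule level_below[OF lev1 A.singleton_grass X]) (use that pX in auto)
    then show "B.gen (\<Union>p\<in>X. h p) \<subseteq> f X"
      using B.gen_least_singular[of "f X"] f_grass[OF X] by (simp add: B.grass_def UN_least)
  qed
  \<comment> \<open>For a counterexample, take \<open>X\<close> and \<open>Y\<close> generated by
    \<open>p\<close> and \<open>q\<close> over a common \<open>R\<close> of rank
    \<open>r - 1\<close> in the perp of both. Their images would be orthogonal and share a subspace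
    of rank \<open>r' - 1\<close>, hence be adjacent, although \<open>X\<close> and \<open>Y\<close>
    are not.\<close>
  have reflect: "A.orth p q" if p: "p \<in> points \<Pi>" and q: "q \<in> points \<Pi>" and hpq: "h p \<subseteq> B.perp (h q)" for p q
  proof (rule ccontr)
    assume n: "\<not> A.orth p q"
    have "\<exists>R. R \<in> A.grass m \<and> p \<in> A.perp R \<and> q \<in> A.perp R" if "m \<le> r - 1" for m
      using that
    proof (induction m)
      case 0
      then show ?case using e0 p q by (auto simp: A.perp_def)
    next
      case (Suc m)
      then obtain R where R: "R \<in> A.grass m" "p \<in> A.perp R" "q \<in> A.perp R" by auto
      have sR: "A.sing R" "Suc (Suc (A.rk R)) \<le> N" using R Suc.prems r by (auto simp: A.grass_def)
      obtain z where z: "z \<in> A.perp R" "z \<notin> R" "A.orth z p" "A.orth z q"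
        using A.common_neighbour[OF sR R(2,3) n] .
      show ?case
        using A.in_perp_extend[OF sR(1) z(1)] R z A.orth_sym A.extend_singular[OF sR(1) z(1)]
          A.rk_extend[OF sR(1) z(1,2)]
        by (intro exI[of _ "A.gen (insert z R)"]) (simp add: A.grass_def)
    qed
    then obtain R where R: "R \<in> A.grass (r - 1)" "p \<in> A.perp R" "q \<in> A.perp R" by blast
    have sR: "A.sing R" "A.rk R = r - 1" using R by (auto simp: A.grass_def)
    have out: "p \<notin> R" "q \<notin> R" using R n A.perp_orth A.orth_sym by blast+
    define X Y where "X = A.gen (insert p R)" and "Y = A.gen (insert q R)"
    have X: "X \<in> A.grass r" "R \<subseteq> X" "p \<in> X"
      using A.extend_singular[OF sR(1) R(2)] A.rk_extend[OF sR(1) R(2) out(1)] sR r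
        A.extend_superset A.extend_mem by (auto simp: X_def A.grass_def)
    have Y: "Y \<in> A.grass r" "R \<subseteq> Y" "q \<in> Y"
      using A.extend_singular[OF sR(1) R(3)] A.rk_extend[OF sR(1) R(3) out(2)] sR r
        A.extend_superset A.extend_mem by (auto simp: Y_def A.grass_def)
    have sX: "A.sing X" and sY: "A.sing Y" using X Y by (auto simp: A.grass_def)
    have Rp: "R \<subseteq> points \<Pi>" by (rule A.singular_points[OF sR(1)])
    have pts: "insert p R \<subseteq> points \<Pi>" "insert q R \<subseteq> points \<Pi>" using p q Rp by auto
    \<comment> \<open>Orthogonality spreads by generators: with \<open>h q\<close> fixed it passes
      from \<open>insert p R\<close> to \<open>X\<close>, and below, with \<open>h x\<close> fixed,
      from \<open>insert q R\<close> to \<open>Y\<close>.\<close>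
    have q_side: "h x \<subseteq> B.perp (h q)" if "x \<in> X" for x
    proof (rule hgen[OF pts(1) _ that[unfolded X_def]])
      fix y assume "y \<in> insert p R"
      then show "h y \<subseteq> B.perp (h q)" using hpq hperp[of y q] R(3) A.perp_orth A.orth_sym by blast
    qed
    have XY: "h y \<subseteq> B.perp (h x)" if "x \<in> X" "y \<in> Y" for x y
    proof (rule hgen[OF pts(2) _ that(2)[unfolded Y_def]])
      have xp: "x \<in> points \<Pi>" using that A.singular_points[OF sX] by blast
      fix z assume z: "z \<in> insert q R"
      show "h z \<subseteq> B.perp (h x)"
      proof (cases "z = q")
        case True
        then show ?thesis using B.perp_sym[OF q_side[OF that(1)] B.singular_points[OF hs[OF q]]] by simp
      next
        case False
        then have "z \<in> X" using z X by blast
        then show ?thesis using hperp A.singular_orth[OF sX] that by blast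
      qed
    qed
    have pXY: "X \<subseteq> points \<Pi>" "Y \<subseteq> points \<Pi>" using A.singular_points sX sY by auto
    have UX: "(\<Union>x\<in>X. h x) \<subseteq> points \<Pi>'" using B.singular_points[OF hs] pXY by blast
    have "(\<Union>y\<in>Y. h y) \<subseteq> B.perp (\<Union>x\<in>X. h x)"
    proof
      fix t assume "t \<in> (\<Union>y\<in>Y. h y)"
      then obtain y where y: "y \<in> Y" "t \<in> h y" by blast
      have "t \<in> B.perp (h x)" if "x \<in> X" for x using XY[OF that y(1)] y(2) by (rule subsetD)
      then show "t \<in> B.perp (\<Union>x\<in>X. h x)" using X(3) by (auto simp: B.perp_def)
    qed
    then have "f Y \<subseteq> B.perp (\<Union>x\<in>X. h x)" unfolding fgen[OF Y(1)] by (rule B.gen_minimal[OF B.perp_subspace])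
    then have "f Y \<subseteq> B.perp (f X)" using B.perp_gen[OF UX] fgen[OF X(1)] by simp
    moreover have "Y \<noteq> X" using A.singular_orth[OF sX X(3)] Y(3) n by blast
    then have ne: "f Y \<noteq> f X" using f_inj X Y by (auto simp: inj_on_def)
    moreover have "B.rk (f Y) \<le> Suc (B.rk (f Y \<inter> f X))"
    proof -
      obtain g where lev: "level (r - 1) g" using level_exists[of "r - 1"] by auto
      have "g R \<subseteq> f Y \<inter> f X" using level_below[OF lev R(1)] X Y by blast
      then have "B.rk (g R) \<le> B.rk (f Y \<inter> f X)"
        using B.rk_mono[OF level_sing[OF lev R(1)] B.singular_Int_singular] f_grass[OF X(1)] f_grass[OF Y(1)]
        by (simp add: B.grass_def)
      moreover have "B.rk (g R) + r = r' + (r - 1)" by (rule level_rk[OF lev R(1)])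
      ultimately show ?thesis using f_grass[OF Y(1)] r by (simp add: B.grass_def)
    qed
    ultimately have "B.nb (f Y) (f X)"
      using f_grass[OF X(1)] f_grass[OF Y(1)] by (intro B.nbI) (auto simp: B.grass_def)
    then have "A.nb Y X" using f_nb_iff X Y by blast
    then have "A.orth q p" using A.nb_perp A.perp_orth X(3) Y(3) by blast
    then show False using n A.orth_sym by blast
  qed
  \<comment> \<open>\<open>A\<close> grows from the empty set and \<open>A'\<close> from
    \<open>S\<close>, by one point each, with \<open>A'\<close> orthogonal to \<open>h q\<close> for
    all \<open>q\<close> in \<open>perp A\<close>. If \<open>z\<close> is the next point and
    \<open>w\<close> in \<open>perp A\<close> is not orthogonal to it, then \<open>h z\<close> is
    not orthogonal to \<open>h w\<close>, so it has a point outside \<open>A'\<close>.\<close>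
  have "\<exists>A A'. A \<in> A.grass m \<and> B.sing A' \<and> m + B.rk S \<le> B.rk A' \<and> (\<forall>q\<in>A.perp A. A' \<subseteq> B.perp (h q))"
    if "m \<le> N" for m
    using that
  proof (induction m)
    case 0
    have "S \<subseteq> B.perp (h q)" if "q \<in> points \<Pi>" for q
      using h[OF that] unfolding B.over_def B.singular_iff by blast
    then show ?case using e0 S(1) A.perp_points by (metis add_0 order_refl subsetD)
  next
    case (Suc m)
    then obtain A A' where AA: "A \<in> A.grass m" "B.sing A'" "m + B.rk S \<le> B.rk A'"
      "\<And>q. q \<in> A.perp A \<Longrightarrow> A' \<subseteq> B.perp (h q)" by auto
    have sA: "A.sing A" "A.rk A = m" using AA by (auto simp: A.grass_def)
    obtain z where z: "z \<in> A.perp A" "z \<notin> A" using A.point_outside[OF sA(1)] sA Suc.prems by auto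
    have zp: "z \<in> points \<Pi>" using z A.perp_points by blast
    obtain w where w: "w \<in> A.perp A" "\<not> A.orth w z" using A.separate_point[OF sA(1) zp z(2)] .
    have wp: "w \<in> points \<Pi>" using w A.perp_points by blast
    have "\<not> h z \<subseteq> A'"
    proof
      assume "h z \<subseteq> A'"
      then have "h z \<subseteq> B.perp (h w)" using AA(4)[OF w(1)] by simp
      then show False using reflect[OF zp wp] w(2) A.orth_sym by blast
    qed
    then obtain c where c: "c \<in> h z" "c \<notin> A'" by blast
    have cA': "c \<in> B.perp A'"
      using B.perp_sym[OF AA(4)[OF z(1)] B.singular_points[OF hs[OF zp]]] c by blast
    have "B.gen (insert c A') \<subseteq> B.perp (h q)" if "q \<in> A.perp (A.gen (insert z A))" for q
    proof (rule B.gen_minimal[OF B.perp_subspace])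
      have q: "A.orth q z" "q \<in> A.perp A" using that A.in_perp_extend[OF sA(1) z(1)] by auto
      show "insert c A' \<subseteq> B.perp (h q)"
        using AA(4)[OF q(2)] subsetD[OF hperp[OF A.orth_sym[OF q(1)]] c(1)] by simp
    qed
    then show ?case
      using A.extend_singular[OF sA(1) z(1)] A.rk_extend[OF sA(1) z] sA(2)
        B.extend_singular[OF AA(2) cA'] B.rk_extend[OF AA(2) cA' c(2)] AA(3)
      by (intro exI[of _ "A.gen (insert z A)"] exI[of _ "B.gen (insert c A')"]) (simp add: A.grass_def)
  qed
  then obtain A' where "B.sing A'" "N + B.rk S \<le> B.rk A'" by blast
  then have rank: "N + B.rk S \<le> N'" using B.rk_le_rank by force
  have iff: "h p \<noteq> h q \<and> (A.orth p q \<longleftrightarrow> h p \<subseteq> B.perp (h q))"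
    if pq: "p \<in> points \<Pi>" "q \<in> points \<Pi>" "p \<noteq> q" for p q
  proof
    show "A.orth p q \<longleftrightarrow> h p \<subseteq> B.perp (h q)" using hperp reflect pq by blast
    show "h p \<noteq> h q"
    proof
      assume e: "h p = h q"
      then have "h p \<subseteq> B.perp (h q)" using hs[OF pq(2)] by (simp add: B.singular_iff)
      then have "A.orth p q" by (rule reflect[OF pq(1,2)])
      then show False using B.nbD(4)[OF hnb] pq(3) e by blast
    qed
  qed
  show ?thesis
    by (intro exI[of _ S] exI[of _ h] conjI ballI impI S h Sf fgen rank) (use iff in simp_all)
qed

end

section \<open>Polar spaces and thin polar spaces\<close>

lemma polar_space_weak:
  assumes "polar_space \<Pi>"
  shows "weak_polar_space \<Pi>"
proof -
  interpret polar_space \<Pi> by fact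
  show ?thesis
  proof
    show "\<exists>q\<in>points \<Pi>. p \<noteq> q \<and> \<not> collinear \<Pi> p q" if "p \<in> points \<Pi>" for p using P2 that by blast
  qed (fact P3, fact P4)
qed

lemma weak_polar_space_ranked:
  assumes "weak_polar_space \<Pi>" "has_rank \<Pi> n"
  shows "ranked_weak_polar_space \<Pi> (nat n)"
proof -
  interpret weak_polar_space \<Pi> by fact
  show ?thesis
  proof
    fix M assume "maximal_singular_subspace \<Pi> M"
    then have "int (rk M) = n" using assms(2) by (auto simp: has_rank_def pdim_rk)
    then show "rk M = nat n" by simp
  qed
qed

lemma polar_ranked: "polar_space_of_rank \<Pi> n \<Longrightarrow> ranked_weak_polar_space \<Pi> (nat n)"
  unfolding polar_space_of_rank_def by (rule weak_polar_space_ranked[OF polar_space_weak]) simp_all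

text \<open>Lines have two points, so all sets of points are subspaces and rank is cardinality. A
  maximal singular subspace contains exactly one point of each antipodal pair, hence absolute values
  map it bijectively onto \<open>{1..n}\<close>.\<close>

lemma thin_ranked:
  assumes thin: "thin_polar_space_of_rank \<Pi> n"
  shows "ranked_weak_polar_space \<Pi> (nat n)"
proof -
  interpret partial_linear_space \<Pi> using thin by (simp add: thin_polar_space_of_rank_def)
  define I where "I = {i :: int. i \<noteq> 0 \<and> \<bar>i\<bar> \<le> n}"
  obtain \<phi> where bij: "bij_betw \<phi> (points \<Pi>) I"
    and ln: "lines (standard_thin n) = (\<lambda>l. \<phi> ` l) ` lines \<Pi>"
    using thin by (auto simp: thin_polar_space_of_rank_def isomorphic_def standard_thin_def I_def)
  have std: "L \<in> lines (standard_thin n) \<longleftrightarrow> (\<exists>i j. L = {i, j} \<and> i \<in> I \<and> j \<in> I \<and> i \<noteq> j \<and> j \<noteq> - i)" for L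
    by (auto simp: standard_thin_def I_def)
  have inj: "p = q" if "\<phi> p = \<phi> q" "p \<in> points \<Pi>" "q \<in> points \<Pi>" for p q
    using bij that by (auto simp: bij_betw_def inj_on_def)
  have \<phi>I: "\<phi> p \<in> I" if "p \<in> points \<Pi>" for p using bij that by (auto simp: bij_betw_def)
  have ex: "\<exists>p\<in>points \<Pi>. \<phi> p = i" if "i \<in> I" for i
    using that bij by (auto simp: bij_betw_def image_iff)
  have neg: "- i \<in> I" if "i \<in> I" for i using that by (simp add: I_def)
  have lp: "l \<subseteq> points \<Pi>" if "l \<in> lines \<Pi>" for l using line_proper[OF that] by blast
  have col: "collinear \<Pi> p q \<longleftrightarrow> p \<noteq> q \<and> \<phi> q \<noteq> - \<phi> p" if p: "p \<in> points \<Pi>" and q: "q \<in> points \<Pi>" for p q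
  proof
    assume c: "collinear \<Pi> p q"
    then obtain l where l: "l \<in> lines \<Pi>" "p \<in> l" "q \<in> l" and ne: "p \<noteq> q" by (auto simp: collinear_def)
    have "\<phi> ` l \<in> lines (standard_thin n)" unfolding ln by (rule imageI) (rule l(1))
    then obtain i j where ij: "\<phi> ` l = {i, j}" "j \<noteq> - i" unfolding std by blast
    then have "\<phi> p \<in> {i, j}" "\<phi> q \<in> {i, j}" using l by blast+
    moreover have "\<phi> p \<noteq> \<phi> q" using inj[OF _ p q] ne by blast
    ultimately show "p \<noteq> q \<and> \<phi> q \<noteq> - \<phi> p" using ij(2) ne by auto
  next
    assume c: "p \<noteq> q \<and> \<phi> q \<noteq> - \<phi> p"
    then have "\<phi> p \<noteq> \<phi> q" using inj[OF _ p q] by blast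
    then have "{\<phi> p, \<phi> q} \<in> lines (standard_thin n)" unfolding std using \<phi>I p q c by blast
    then obtain l where l: "l \<in> lines \<Pi>" "\<phi> ` l = {\<phi> p, \<phi> q}" using ln by auto
    have "t \<in> l" if "t \<in> points \<Pi>" "\<phi> t \<in> \<phi> ` l" for t
      using that lp[OF l(1)] inj by blast
    then have "p \<in> l" "q \<in> l" using l(2) p q by auto
    then show "collinear \<Pi> p q" using l c by (auto simp: collinear_def)
  qed
  have two: "\<exists>a b. l = {a, b} \<and> a \<noteq> b \<and> a \<in> points \<Pi> \<and> b \<in> points \<Pi>" if l: "l \<in> lines \<Pi>" for l
  proof -
    have "\<phi> ` l \<in> lines (standard_thin n)" unfolding ln by (rule imageI) (rule l)
    then obtain i j where ij: "\<phi> ` l = {i, j}" "i \<noteq> j" unfolding std by blast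
    then obtain a b where ab: "a \<in> l" "b \<in> l" "\<phi> a = i" "\<phi> b = j" by (metis imageE insertI1 insertI2)
    have "c = a \<or> c = b" if "c \<in> l" for c
    proof -
      have "\<phi> c = \<phi> a \<or> \<phi> c = \<phi> b" using ij ab that by blast
      then show ?thesis using inj[of c a] inj[of c b] lp[OF l] ab that by blast
    qed
    then have "l = {a, b}" using ab by blast
    then show ?thesis using ab ij lp[OF l] by blast
  qed
  have "finite I" by (rule finite_subset[of _ "{-n..n}"]) (auto simp: I_def)
  then have fin: "finite (points \<Pi>)" using bij bij_betw_finite by blast
  interpret weak_polar_space \<Pi>
  proof
    fix p assume p: "p \<in> points \<Pi>"
    obtain q where q: "q \<in> points \<Pi>" "\<phi> q = - \<phi> p" using ex[OF neg[OF \<phi>I[OF p]]] by blast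
    have "\<phi> p \<noteq> 0" using \<phi>I[OF p] by (simp add: I_def)
    then show "\<exists>q\<in>points \<Pi>. p \<noteq> q \<and> \<not> collinear \<Pi> p q"
      using q col[OF p q(1)] by (intro bexI[of _ q]) auto
  next
    fix p l assume p: "p \<in> points \<Pi>" and l: "l \<in> lines \<Pi>"
    obtain a b where ab: "l = {a, b}" "a \<noteq> b" "a \<in> points \<Pi>" "b \<in> points \<Pi>" using two[OF l] by blast
    have "\<phi> a \<noteq> \<phi> b" using inj ab by blast
    \<comment> \<open>\<open>p\<close> has only one antipode, so it fails to be collinear with at
      most one of the two points.\<close>
    then have "(p = a \<or> collinear \<Pi> p a) \<or> (p = b \<or> collinear \<Pi> p b)"
      using col[OF p ab(3)] col[OF p ab(4)] by auto
    then show "(\<exists>!q. q \<in> l \<and> (p = q \<or> collinear \<Pi> p q)) \<or> (\<forall>q\<in>l. p = q \<or> collinear \<Pi> p q)"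
      unfolding ab(1) by auto
  next
    fix C assume "subset.chain {S. singular_subspace \<Pi> S} C"
    then have "C \<subseteq> Pow (points \<Pi>)"
      by (auto simp: subset.chain_def singular_subspace_def subspace_def)
    then show "finite C" using fin by (meson finite_Pow_iff finite_subset)
  qed
  have all_sub: "sub S" if "S \<subseteq> points \<Pi>" for S
  proof (rule subspaceI[OF that])
    fix p q l x assume h: "p \<in> S" "q \<in> S" "l \<in> lines \<Pi>" "p \<noteq> q" "p \<in> l" "q \<in> l" "x \<in> l"
    obtain a b where "l = {a, b}" using two[OF h(3)] by blast
    then show "x \<in> S" using h by auto
  qed
  have rk_card: "rk S = card S" if S: "sing S" for S
  proof (rule rk_eq_card[OF S])
    have Sp: "S \<subseteq> points \<Pi>" by (rule singular_points[OF S])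
    show "finite S" using Sp fin finite_subset by blast
    show "gen S = S" using gen_subspace_eq all_sub Sp by blast
    have "gen (S - {b}) = S - {b}" for b by (rule gen_subspace_eq[OF all_sub]) (use Sp in blast)
    then show "indep S" by (simp add: indep_def)
  qed
  show ?thesis
  proof
    fix M assume M: "maximal_singular_subspace \<Pi> M"
    have sM: "sing M" and maxM: "\<And>S. \<lbrakk>sing S; M \<subseteq> S\<rbrakk> \<Longrightarrow> S = M"
      using M by (auto simp: maximal_singular_subspace_def)
    have Mp: "M \<subseteq> points \<Pi>" by (rule singular_points[OF sM])
    have Mcol: "\<phi> q \<noteq> - \<phi> p" if "p \<in> M" "q \<in> M" for p q
    proof (cases "p = q")
      case True
      then show ?thesis using \<phi>I[of p] that Mp by (auto simp: I_def)
    next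
      case False
      then show ?thesis using sM col[of p q] that Mp unfolding singular_subspace_def by blast
    qed
    have "inj_on (\<lambda>p. \<bar>\<phi> p\<bar>) M"
    proof (rule inj_onI)
      fix p q assume pq: "p \<in> M" "q \<in> M" "\<bar>\<phi> p\<bar> = \<bar>\<phi> q\<bar>"
      then have "\<phi> q = \<phi> p \<or> \<phi> q = - \<phi> p" by (auto simp: abs_eq_iff)
      then have "\<phi> p = \<phi> q" using Mcol[OF pq(1,2)] by simp
      then show "p = q" using inj pq Mp by blast
    qed
    moreover have "(\<lambda>p. \<bar>\<phi> p\<bar>) ` M = {1..n}"
    proof
      show "(\<lambda>p. \<bar>\<phi> p\<bar>) ` M \<subseteq> {1..n}" using \<phi>I Mp by (force simp: I_def)
      show "{1..n} \<subseteq> (\<lambda>p. \<bar>\<phi> p\<bar>) ` M"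
      proof
        fix i assume i: "i \<in> {1..n}"
        then have "i \<in> I" by (simp add: I_def)
        then obtain a b where a: "a \<in> points \<Pi>" "\<phi> a = i" and b: "b \<in> points \<Pi>" "\<phi> b = - i"
          using ex[of i] ex[OF neg, of i] by blast
        have "a \<in> M \<or> b \<in> M"
        proof (rule ccontr)
          assume n: "\<not> (a \<in> M \<or> b \<in> M)"
          have ca: "collinear \<Pi> a q \<and> collinear \<Pi> q a" if q: "q \<in> M" for q
          proof -
            have qp: "q \<in> points \<Pi>" using q Mp by blast
            have "\<phi> q \<noteq> - i" using inj[OF _ qp b(1)] b(2) n q by auto
            then show ?thesis using col[OF a(1) qp] col[OF qp a(1)] a(2) n q by auto
          qed
          have "sing (insert a M)"
            unfolding singular_subspace_def
            using all_sub[of "insert a M"] a(1) Mp ca sM by (auto simp: singular_subspace_def)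
          then have "insert a M = M" by (rule maxM) blast
          then show False using n by blast
        qed
        then show "i \<in> (\<lambda>p. \<bar>\<phi> p\<bar>) ` M" using a b i by (force simp: image_iff)
      qed
    qed
    ultimately have "card M = card {1..n}" using card_image by metis
    then show "rk M = nat n" using rk_card[OF sM] by simp
  qed
qed

text \<open>A nonempty set of natural numbers attains its infimum, and the empty set has infimum
  infinity, so a finite bound is always witnessed by a walk.\<close>

lemma path_distance_le_iff: "path_distance E x y \<le> enat d \<longleftrightarrow> (\<exists>m\<le>d. (x, y) \<in> E ^^ m)"
proof
  assume h: "path_distance E x y \<le> enat d"
  define A where "A = {enat m | m. (x, y) \<in> E ^^ m}"
  have "Inf A \<le> enat d" using h by (simp add: path_distance_def A_def)
  moreover have "A \<noteq> {}"
  proof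
    assume "A = {}"
    then show False using \<open>Inf A \<le> enat d\<close> by (simp add: top_enat_def)
  qed
  then have "Inf A \<in> A" by (metis LeastI_ex Inf_enat_def ex_in_conv)
  ultimately show "\<exists>m\<le>d. (x, y) \<in> E ^^ m" by (auto simp: A_def)
next
  assume "\<exists>m\<le>d. (x, y) \<in> E ^^ m"
  then obtain m where "m \<le> d" "(x, y) \<in> E ^^ m" by blast
  then have "path_distance E x y \<le> enat m" unfolding path_distance_def by (intro Inf_lower) blast
  then show "path_distance E x y \<le> enat d" using \<open>m \<le> d\<close> by (meson enat_ord_simps(1) order_trans)
qed

theorem theorem1:
  fixes \<Pi> :: "'a pls" and \<Pi>' :: "'b pls"
    and n n' k k' :: int
    and f :: "'a set \<Rightarrow> 'b set"
  assumes "polar_space_of_rank \<Pi> n \<or> thin_polar_space_of_rank \<Pi> n"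
    and "n \<ge> 5"
    and "polar_space_of_rank \<Pi>' n'"
    and "1 \<le> k" and "k \<le> n - 4"
    and "0 \<le> k'" and "k' \<le> n' - 1"
    and "isometric_embedding (grassmannian \<Pi> k) (grassmann_edges \<Pi> n k)
           (grassmannian \<Pi>' k') (grassmann_edges \<Pi>' n' k') f"
  shows "k \<le> k' \<and> n - k \<le> n' - k' \<and>
    (\<exists>S. singular_subspace \<Pi>' S \<and> pdim \<Pi>' S = k' - k - 1 \<and>
      f ` grassmannian \<Pi> k \<subseteq> subspaces_above \<Pi>' S k' \<and>
      (\<exists>h. collinearity_preserving_injection \<Pi> (residue \<Pi>' S) h \<and> induced_by \<Pi> k \<Pi>' f h))"
proof -
  define N N' where "N = nat n" and "N' = nat n'"
  define r r' where "r = nat (k + 1)" and "r' = nat (k' + 1)"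
  have "ranked_weak_polar_space \<Pi> N"
    unfolding N_def using assms(1) polar_ranked[of \<Pi> n] thin_ranked[of \<Pi> n] by blast
  then interpret A: ranked_weak_polar_space \<Pi> N .
  have "ranked_weak_polar_space \<Pi>' N'"
    unfolding N'_def by (rule polar_ranked[OF assms(3)])
  then interpret B: ranked_weak_polar_space \<Pi>' N' .
  have rN: "2 \<le> r" "r + 3 \<le> N" and rN': "1 \<le> r'" "r' \<le> N'"
    using assms by (auto simp: r_def r'_def N_def N'_def)
  have G: "grassmannian \<Pi> k = A.grass r" and G': "grassmannian \<Pi>' k' = B.grass r'"
    unfolding r_def r'_def using assms by (auto intro!: A.grassmannian_grass B.grassmannian_grass)
  have E: "grassmann_edges \<Pi> n k = A.edges r"
    unfolding r_def by (rule A.grassmann_edges_edges) (use assms in auto)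
  define E' where "E' = grassmann_edges \<Pi>' n' k'"
  have f_grass: "f X \<in> B.grass r'" if "X \<in> A.grass r" for X
    using assms(8) that by (auto simp: isometric_embedding_def G G')
  have f_inj: "inj_on f (A.grass r)" using assms(8) by (simp add: isometric_embedding_def G)
  have dist: "(\<exists>m\<le>d. (f X, f Y) \<in> E' ^^ m) \<longleftrightarrow> A.near r d X Y"
    if "X \<in> A.grass r" "Y \<in> A.grass r" for X Y d
  proof -
    have "path_distance E' (f X) (f Y) = path_distance (A.edges r) X Y"
      using assms(8) that by (simp add: isometric_embedding_def G E E'_def)
    then show ?thesis unfolding A.near_def path_distance_le_iff[symmetric] by simp
  qed
  \<comment> \<open>Adjacency is distance at most one between distinct vertices. It is stated with
    \<open>E'\<close> because the edges have another form when \<open>k' = n' - 1\<close>, a case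
    still to be excluded.\<close>
  have adj: "(f X, f Y) \<in> E' \<longleftrightarrow> A.nb X Y"
    if X: "X \<in> A.grass r" and Y: "Y \<in> A.grass r" and ne: "X \<noteq> Y" for X Y
  proof -
    have "f X \<noteq> f Y" using f_inj X Y ne by (auto simp: inj_on_def)
    moreover have "(\<exists>m\<le>1. P m) \<longleftrightarrow> P 0 \<or> P 1" for P :: "nat \<Rightarrow> bool"
      by (metis le_Suc_eq le_zero_eq One_nat_def zero_le)
    ultimately have "(f X, f Y) \<in> E' \<longleftrightarrow> (\<exists>m\<le>1. (f X, f Y) \<in> E' ^^ m)" by simp
    also have "\<dots> \<longleftrightarrow> A.nb X Y"
      unfolding dist[OF X Y] A.near_one using ne X by (simp add: A.grass_def)
    finally show ?thesis .
  qed
  \<comment> \<open>In the graph of maximal subspaces, common neighbours of an edge all contain its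
    intersection, so two distinct ones are adjacent. The source has an edge \<open>X Y\<close> with
    non-adjacent common neighbours \<open>P\<close> and \<open>Q\<close>.\<close>
  have "k' \<noteq> n' - 1"
  proof
    assume k': "k' = n' - 1"
    have eq: "r' = N'" using k' by (simp add: r'_def N'_def)
    have E'_iff: "(X, Y) \<in> E' \<longleftrightarrow> X \<in> B.grass N' \<and> Y \<in> B.grass N' \<and> X \<noteq> Y \<and> N' = Suc (B.rk (X \<inter> Y))"
      for X Y
    proof -
      have "0 \<le> n' - 2 + 1" "N' = Suc (nat (n' - 2 + 1))" using assms(6) k' by (auto simp: N'_def)
      then have gr: "grassmannian \<Pi>' (n' - 2) = B.grass (N' - 1)" using B.grassmannian_grass by simp
      have "(X, Y) \<in> E' \<longleftrightarrow> X \<in> B.grass N' \<and> Y \<in> B.grass N' \<and> X \<noteq> Y \<and> X \<inter> Y \<in> B.grass (N' - 1)"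
        unfolding E'_def grassmann_edges_def G' eq gr using k' by simp
      moreover have "X \<inter> Y \<in> B.grass (N' - 1) \<longleftrightarrow> N' = Suc (B.rk (X \<inter> Y))"
        if "X \<in> B.grass N'" "Y \<in> B.grass N'"
        using B.singular_Int_singular[OF B.grassD(1)[OF that(1)] B.grassD(1)[OF that(2)]] rN'
        by (auto simp: B.grass_def)
      ultimately show ?thesis by blast
    qed
    obtain A where A: "A.sing A" "A.rk A = r - 1"
    proof -
      obtain M where M: "maximal_singular_subspace \<Pi> M" using A.below_maximal[OF A.empty_singular] by blast
      then have M: "A.sing M" "A.rk M = N" using A.rank_maximal by (auto simp: maximal_singular_subspace_def)
      have "A.rk {} \<le> r - 1" "r - 1 \<le> A.rk M" using M rN A.rk_empty by auto
      from A.rk_between[OF A.empty_singular M(1) empty_subsetI this] show ?thesis using that by metis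
    qed
    have "A.rk A < N" using A rN by simp
    then obtain x where x: "x \<in> A.perp A" "x \<notin> A" using A.point_outside[OF A(1)] by metis
    define X where "X = A.gen (insert x A)"
    have X: "A.over A X" unfolding X_def by (rule A.over_extend[OF A(1) x])
    then have sX: "A.sing X" "A \<subseteq> X" "A.rk X = r" using A rN by (auto simp: A.over_def)
    have XN: "A.rk X < N" using sX rN by simp
    obtain Y where Y: "A.over A Y" "A.nb Y X"
      using A.over_new_neighbour[OF A(1) sX(2,1) XN] X by (metis order_refl)
    obtain U where U: "A.sing U" "A.rk U = Suc (A.rk Y)" "Y \<subseteq> U" "X \<subseteq> U"
      using Y(2) unfolding A.nb_def by blast
    have AU: "A \<subseteq> U" "A.rk U < N" using sX U A.nbD(3)[OF Y(2)] rN by auto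
    obtain P Q where PQ: "P \<noteq> Q" "\<not> A.nb P Q" "A.over A P" "A.over A Q"
      and nb: "\<And>W. \<lbrakk>A.over A W; W \<subseteq> U\<rbrakk> \<Longrightarrow> A.nb P W \<and> A.nb Q W"
      using A.over_nonadjacent[OF A(1) AU(1) U(1) AU(2)] by metis
    have g: "X \<in> A.grass r" "Y \<in> A.grass r" "P \<in> A.grass r" "Q \<in> A.grass r"
      using X Y PQ A rN by (auto simp: A.over_def A.grass_def)
    have e: "(f Z, f W) \<in> E'" if "A.nb Z W" "Z \<in> A.grass r" "W \<in> A.grass r" for Z W
      using adj[OF that(2,3) A.nbD(4)[OF that(1)]] that(1) by simp
    note nbs = nb[OF X U(4)] nb[OF Y(1) U(3)]
    have XY: "N' = Suc (B.rk (f X \<inter> f Y))" using e[OF A.nb_sym[OF Y(2)] g(1,2)] by (simp add: E'_iff)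
    have sub: "f X \<inter> f Y \<subseteq> f Z" if Z: "A.nb Z X" "A.nb Z Y" "Z \<in> A.grass r" for Z
      by (rule B.maximal_common_neighbour[OF _ _ _ XY])
        (use e[OF Z(1,3) g(1)] e[OF Z(2,3) g(2)] E'_iff in blast)+
    have ne: "f P \<noteq> f Q" using f_inj g PQ by (auto simp: inj_on_def)
    have fs: "B.sing (f P)" "B.sing (f Q)" "B.sing (f X)" "B.sing (f Y)" "B.rk (f P) = N'" "B.rk (f Q) = N'"
      using f_grass g eq by (auto simp: B.grass_def)
    have sI: "B.sing (f P \<inter> f Q)" by (rule B.singular_Int_singular[OF fs(1,2)])
    have "B.rk (f X \<inter> f Y) \<le> B.rk (f P \<inter> f Q)"
      by (rule B.rk_mono[OF B.singular_Int_singular[OF fs(3,4)] sI]) (use sub nbs g in blast)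
    moreover have "f P \<inter> f Q \<noteq> f P" using B.eq_of_rk[OF fs(1,2)] fs ne by auto
    then have "B.rk (f P \<inter> f Q) < N'" using B.rk_strict[OF sI fs(1)] fs(5) by blast
    ultimately have "(f P, f Q) \<in> E'"
      unfolding E'_iff using XY ne f_grass[OF g(3)] f_grass[OF g(4)] eq by simp
    then show False using adj[OF g(3,4) PQ(1)] PQ(2) by simp
  qed
  then have E': "E' = B.edges r'" and r'N': "r' < N'"
    unfolding E'_def r'_def N'_def using B.grassmann_edges_edges[of k' n'] assms(6,7) by auto
  interpret grassmann_embedding \<Pi> N \<Pi>' N' r r' f
  proof
    show "B.nb (f X) (f Y)" if "A.nb X Y" "X \<in> A.grass r" for X Y
    proof -
      have "Y \<in> A.grass r" using that A.nbD[OF that(1)] by (simp add: A.grass_def)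
      from adj[OF that(2) this A.nbD(4)[OF that(1)]] show ?thesis using that(1) by (simp add: E' B.edges_def)
    qed
    show "A.near r d X Y" if "X \<in> A.grass r" "Y \<in> A.grass r" "B.near r' d (f X) (f Y)" for X Y d
      using dist[OF that(1,2)] that(3) by (simp add: E' B.near_def)
  qed (use rN r'N' f_grass f_inj in auto)
  obtain S h where S: "B.sing S" "B.rk S + r = r'" and rank: "N + B.rk S \<le> N'"
    and h: "\<forall>p\<in>points \<Pi>. B.over S (h p)"
    and hh: "\<forall>p\<in>points \<Pi>. \<forall>q\<in>points \<Pi>. p \<noteq> q \<longrightarrow>
      h p \<noteq> h q \<and> (A.orth p q \<longleftrightarrow> h p \<subseteq> B.perp (h q))"
    and ind: "\<forall>X\<in>A.grass r. S \<subseteq> f X \<and> f X = B.gen (\<Union>p\<in>X. h p)"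
    using induced_by_points by (elim exE conjE)
  have res_points: "points (residue \<Pi>' S) = {X. B.over S X}"
    using S(1) by (auto simp: residue_def subspaces_above_def grassmannian_def B.over_def B.pdim_rk)
  have res_collinear: "collinear (residue \<Pi>' S) X Y \<longleftrightarrow> X \<noteq> Y \<and> X \<subseteq> B.perp Y"
    if X: "B.over S X" and Y: "B.over S Y" for X Y
  proof
    assume "collinear (residue \<Pi>' S) X Y"
    then obtain U where "X \<noteq> Y" "B.sing U" "X \<subseteq> U" "Y \<subseteq> U"
      by (auto simp: collinear_def residue_def subspaces_above_def subspaces_between_def grassmannian_def)
    then show "X \<noteq> Y \<and> X \<subseteq> B.perp Y" using B.singular_in_perp by blast
  next
    assume c: "X \<noteq> Y \<and> X \<subseteq> B.perp Y"
    then obtain U where U: "B.sing U" "B.rk U = Suc (B.rk X)" "X \<subseteq> U" "Y \<subseteq> U"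
      using B.over_nb[OF X Y] unfolding B.nb_def by blast
    have "U \<in> subspaces_above \<Pi>' S (pdim \<Pi>' S + 2)"
      using U X by (auto simp: subspaces_above_def grassmannian_def B.pdim_rk B.over_def)
    moreover have "X \<in> subspaces_between \<Pi>' S U (pdim \<Pi>' S + 1)" "Y \<in> subspaces_between \<Pi>' S U (pdim \<Pi>' S + 1)"
      using U X Y by (auto simp: subspaces_between_def grassmannian_def B.pdim_rk B.over_def)
    ultimately show "collinear (residue \<Pi>' S) X Y"
      using c unfolding collinear_def residue_def by auto
  qed
  have "collinearity_preserving_injection \<Pi> (residue \<Pi>' S) h"
    unfolding collinearity_preserving_injection_def
  proof (intro conjI ballI impI)
    show "h ` points \<Pi> \<subseteq> points (residue \<Pi>' S)" using h res_points by blast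
    show "inj_on h (points \<Pi>)" unfolding inj_on_def using hh by blast
    fix p q assume pq: "p \<in> points \<Pi>" "q \<in> points \<Pi>" "p \<noteq> q"
    have "collinear \<Pi> p q \<longleftrightarrow> A.orth p q" using pq by (simp add: A.orth_def)
    then show "collinear \<Pi> p q \<longleftrightarrow> collinear (residue \<Pi>' S) (h p) (h q)"
      using hh pq res_collinear[of "h p" "h q"] h by simp
  qed
  moreover have "induced_by \<Pi> k \<Pi>' f h" using ind by (simp add: induced_by_def G)
  moreover have "f ` grassmannian \<Pi> k \<subseteq> subspaces_above \<Pi>' S k'"
    using ind f_grass by (auto simp: subspaces_above_def G G')
  moreover have "pdim \<Pi>' S = k' - k - 1" using S(2) assms(4,6) by (simp add: B.pdim_rk r_def r'_def)
  \<comment> \<open>As \<open>B.rk S = k' - k\<close>, the fact \<open>rank\<close> reads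
    \<open>n + (k' - k) \<le> n'\<close>.\<close>
  moreover have "k \<le> k'" "n - k \<le> n' - k'"
    using S(2) rank assms(2,4,6,7) by (auto simp: r_def r'_def N_def N'_def)
  ultimately show ?thesis using S(1) by blast
qed

end
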